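(* Let $q,\widetilde q\in L_1(0,\pi)$ be real-valued, let $f,F\in\mathscr R$ with $\operatorname{ind} f=\operatorname{ind} F$, let $\{\lambda_n\}_{n\ge0}$ and $\{\widetilde\lambda_n\}_{n\ge0}$ denote the eigenvalues (in increasing order) of the problems $\mathscr P(q,f,F)$ and $\mathscr P(\widetilde q,f,F)$ respectively, and let $y_n$ and $\widetilde y_n$ be corresponding eigenfunctions. If $$\lambda_n=\widetilde\lambda_n\qquad\text{and}\qquad \frac{y_n'(\pi/2)}{y_n(\pi/2)}=\frac{\widetilde y_n'(\pi/2)}{\widetilde y_n(\pi/2)}\qquad\text{for all } n\ge0,$$ then $q(x)=\widetilde q(x)$ a.e. on $[0,\pi]$.
   Context: $\mathscr R$ is the set consisting of the symbol $\infty$ together with all rational functions $f(\lambda)=h_0\lambda+h+\sum_{k=1}^d\frac{\delta_k}{h_k-\lambda}$ ($d\ge 0$) with real coefficients, $h_0\ge 0$, $\delta_k>0$, $h_1<\dots<h_d$. The index is $\operatorname{ind} f=2d+1$ if $h_0>0$, $\operatorname{ind} f=2d$ if $h_0=0$, and $\operatorname{ind}\infty=-1$. For $f\neq\infty$ put $f_\downarrow(\lambda)=h_0'\prod_{k=1}^d(h_k-\lambda)$ with $h_0'=1/h_0$ if $h_0>0$ and $h_0'=1$ if $h_0=0$, and $f_\uparrow=f\cdot f_\downarrow$ (a polynomial); for $f=\infty$ put $f_\uparrow=-1$, $f_\downarrow=0$. $\mathscr P(q,f,F)$ is the boundary value problem $-y''+q(x)y=\lambda y$ on $(0,\pi)$,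 $\frac{y'(0)}{y(0)}=-f(\lambda)$, $\frac{y'(\pi)}{y(\pi)}=F(\lambda)$, i.e. $f_\downarrow(\lambda)y'(0)+f_\uparrow(\lambda)y(0)=0$ and $F_\downarrow(\lambda)y'(\pi)-F_\uparrow(\lambda)y(\pi)=0$ (so $\infty$ means a Dirichlet condition). Its eigenvalues are real and simple and form an increasing sequence tending to $+\infty$. Quotients $y'(\pi/2)/y(\pi/2)$ are understood as elements of $\mathbb R\cup\{\infty\}$, the value being $\infty$ when $y(\pi/2)=0$. *)

theory Defs
  imports "HOL-Analysis.Analysis" "HOL-Computational_Algebra.Polynomial"
begin

text \<open>
  \<open>Rational h0 h [(h_1, \<delta>_1), \<dots>, (h_d, \<delta>_d)]\<close> stands for the rational function
  \<open>\<lambda> \<mapsto> h0 \<lambda> + h + (\<Sum>k. \<delta>_k / (h_k - \<lambda>))\<close>.  On \<open>rational_class\<close> the data are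
  uniquely determined by that function, so functions and data may be identified.
\<close>

datatype boundary_coeff = Infty | Rational real real "(real \<times> real) list"

definition rational_class :: "boundary_coeff set" where
  "rational_class = insert Infty
     {Rational h0 h ps | h0 h ps.
        h0 \<ge> 0 \<and> (\<forall>(hk, \<delta>) \<in> set ps. \<delta> > 0) \<and> sorted_wrt (<) (map fst ps)}"

fun bc_index :: "boundary_coeff \<Rightarrow> int" where
  "bc_index Infty = -1"
| "bc_index (Rational h0 h ps) =
     (if h0 > 0 then 2 * int (length ps) + 1 else 2 * int (length ps))"

definition rational_eval :: "real \<Rightarrow> real \<Rightarrow> (real \<times> real) list \<Rightarrow> real \<Rightarrow> real" where
  "rational_eval h0 h ps x = h0 * x + h + (\<Sum>k<length ps. snd (ps ! k) / (fst (ps ! k) - x))"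

definition leading_factor :: "real \<Rightarrow> real" where
  "leading_factor h0 = (if h0 > 0 then 1 / h0 else 1)"

fun bc_down :: "boundary_coeff \<Rightarrow> real poly" where
  "bc_down Infty = 0"
| "bc_down (Rational h0 h ps) =
     smult (leading_factor h0) (\<Prod>k<length ps. [:fst (ps ! k), -1:])"

text \<open>
  The product of the rational function with \<open>bc_down\<close>, with denominators cancelled;
  see \<open>bc_up_eq\<close> below.
\<close>

fun bc_up :: "boundary_coeff \<Rightarrow> real poly" where
  "bc_up Infty = -1"
| "bc_up (Rational h0 h ps) =
     smult (leading_factor h0)
       ([:h, h0:] * (\<Prod>k<length ps. [:fst (ps ! k), -1:])
        + (\<Sum>k<length ps. smult (snd (ps ! k))
             (\<Prod>j\<in>{..<length ps} - {k}. [:fst (ps ! j), -1:])))"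

lemma bc_up_eq:
  assumes "x \<notin> fst ` set ps"
  shows "poly (bc_up (Rational h0 h ps)) x
           = rational_eval h0 h ps x * poly (bc_down (Rational h0 h ps)) x"
proof -
  have nz: "fst (ps ! k) - x \<noteq> 0" if "k < length ps" for k
    using assms that by (metis eq_iff_diff_eq_0 image_eqI nth_mem)
  have "(\<Sum>k<length ps. snd (ps ! k) * (\<Prod>j\<in>{..<length ps} - {k}. fst (ps ! j) - x))
      = (\<Sum>k<length ps. snd (ps ! k) / (fst (ps ! k) - x) * (\<Prod>j<length ps. fst (ps ! j) - x))"
  proof (rule sum.cong)
    fix k assume k: "k \<in> {..<length ps}"
    then have "(\<Prod>j<length ps. fst (ps ! j) - x)
        = (fst (ps ! k) - x) * (\<Prod>j\<in>{..<length ps} - {k}. fst (ps ! j) - x)"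
      by (intro prod.remove) auto
    then show "snd (ps ! k) * (\<Prod>j\<in>{..<length ps} - {k}. fst (ps ! j) - x)
        = snd (ps ! k) / (fst (ps ! k) - x) * (\<Prod>j<length ps. fst (ps ! j) - x)"
      using nz[of k] k by simp
  qed simp
  then have "(\<Sum>k<length ps. snd (ps ! k) * (\<Prod>j\<in>{..<length ps} - {k}. fst (ps ! j) - x))
      = (\<Sum>k<length ps. snd (ps ! k) / (fst (ps ! k) - x)) * (\<Prod>j<length ps. fst (ps ! j) - x)"
    by (simp only: sum_distrib_right)
  then show ?thesis
    by (simp add: rational_eval_def poly_prod poly_sum) (simp add: algebra_simps)
qed

text \<open>
  For \<open>q \<in> L\<^sub>1(0,\<pi>)\<close>, solutions are meant in the usual (Caratheodory) sense: \<open>y\<close> is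
  differentiable on \<open>[0,\<pi>]\<close>, its derivative \<open>y'\<close> is absolutely continuous, that is,
  the indefinite Lebesgue integral of some integrable \<open>y''\<close>, and the equation holds a.e.
  One-sided derivatives are taken at the end points.
\<close>

definition interval_deriv :: "(real \<Rightarrow> complex) \<Rightarrow> real \<Rightarrow> complex" where
  "interval_deriv y x = vector_derivative y (at x within {0..pi})"

definition sl_solution :: "(real \<Rightarrow> real) \<Rightarrow> complex \<Rightarrow> (real \<Rightarrow> complex) \<Rightarrow> bool" where
  "sl_solution q z y \<longleftrightarrow>
     (\<forall>x\<in>{0..pi}. (y has_vector_derivative interval_deriv y x) (at x within {0..pi})) \<and>
     (\<exists>y''. y'' absolutely_integrable_on {0..pi} \<and>
        (\<forall>x\<in>{0..pi}. interval_deriv y x = interval_deriv y 0 + integral {0..x} y'') \<and>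
        (AE x in lebesgue. x \<in> {0..pi} \<longrightarrow> - y'' x + of_real (q x) * y x = z * y x))"

abbreviation cpoly :: "real poly \<Rightarrow> complex \<Rightarrow> complex" where
  "cpoly p z \<equiv> poly (map_poly complex_of_real p) z"

definition is_eigenfunction ::
  "(real \<Rightarrow> real) \<Rightarrow> boundary_coeff \<Rightarrow> boundary_coeff \<Rightarrow> complex \<Rightarrow> (real \<Rightarrow> complex) \<Rightarrow> bool" where
  "is_eigenfunction q f F z y \<longleftrightarrow>
     sl_solution q z y \<and> (\<exists>x\<in>{0..pi}. y x \<noteq> 0) \<and>
     cpoly (bc_down f) z * interval_deriv y 0 + cpoly (bc_up f) z * y 0 = 0 \<and>
     cpoly (bc_down F) z * interval_deriv y pi - cpoly (bc_up F) z * y pi = 0"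

definition eigenvalues ::
  "(real \<Rightarrow> real) \<Rightarrow> boundary_coeff \<Rightarrow> boundary_coeff \<Rightarrow> complex set" where
  "eigenvalues q f F = {z. \<exists>y. is_eigenfunction q f F z y}"

text \<open>
  An enumeration in increasing order; as the values are real, this includes the
  (classical) fact that all eigenvalues are real.
\<close>

definition enumerates_eigenvalues ::
  "(real \<Rightarrow> real) \<Rightarrow> boundary_coeff \<Rightarrow> boundary_coeff \<Rightarrow> (nat \<Rightarrow> real) \<Rightarrow> bool" where
  "enumerates_eigenvalues q f F lam \<longleftrightarrow>
     strict_mono lam \<and> range (\<lambda>n. complex_of_real (lam n)) = eigenvalues q f F"

text \<open>
  The quotient \<open>y'(x) / y(x)\<close>, with \<open>None\<close> in the role of \<open>\<infinity>\<close>.  Eigenfunctions may be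
  complex-valued, hence the type; being multiples of real ones, they give real quotients.
\<close>

definition log_deriv :: "(real \<Rightarrow> complex) \<Rightarrow> real \<Rightarrow> complex option" where
  "log_deriv y x = (if y x = 0 then None else Some (interval_deriv y x / y x))"

end

(*
  Let phi(x, lambda) solve the equation with phi(0) = f_down and phi'(0) = - f_up, and let chi be
  the characteristic function F_down phi'(pi) - F_up phi(pi), whose zeros are the eigenvalues; they
  are simple because f and F are Herglotz functions.  The hypothesis says that the Wronskian G at
  pi/2 of the functions phi of the two problems vanishes at all eigenvalues, so G / chi is entire.
  Writing lambda = rho^2, equality of the indices makes G / chi of order 1 / rho on large squares
  in the rho-plane, so G = 0: both problems have the same Weyl function phi'/phi at pi/2.

  Now let C, S be the cosine and sine type solutions started at pi/2 and running to the left, and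
  put tildes for the second problem.  For fixed x, G = 0 shows that S C~ - S~ C is an entire function
  of lambda which is again of order 1 / rho on large squares, hence zero (Bennewitz' proof of the
  Borg-Marchenko theorem).  At lambda = i the function S has no zeros, and differentiating
  S C~ = S~ C gives S^2 = S~^2, so S = S~ and the potentials agree on the left half.  The right half
  follows by reflecting the interval.
*)

theory Submission
  imports Defs "HOL-Complex_Analysis.Complex_Analysis"
begin

section \<open>Absolutely continuous functions\<close>

text \<open>The potentials are only integrable, so second derivatives exist merely a.e.; hence the
  calculus rests on \<open>ac_primitive\<close>, which speaks of integrals over subintervals and not
  of pointwise derivatives. The smallness of G has one cause: the main term of phi does not see the
  potential. Each phi is \<open>A\<close> times a sine or cosine fixed by f, up to one power of rho,
  so the main terms cancel in G, while chi keeps rho A B sin(rho pi). Equal indices give a sine for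
  either parity and make \<open>A\<close> and \<open>B\<close> equal in modulus. For S C~ - S~ C the
  key is phi(pi/2 - x) = phi(pi/2) C - phi'(pi/2) S. With a common quotient phi'/phi the S S~ terms
  drop out, leaving S phi~(pi/2 - x) / phi~(pi/2) minus its counterpart: S is O(exp(|Im rho| x) /
  rho), and the ratio is O(exp(- |Im rho| x)). The squares have half-integer half-sides, so that sin
  and cos of rho pi/2 are both bounded below on them. The bounds hold only there, so the maximum
  principle on each square replaces a growth bound in the whole plane.\<close>

definition ac_primitive :: "real \<Rightarrow> (real \<Rightarrow> complex) \<Rightarrow> (real \<Rightarrow> complex) \<Rightarrow> bool" where
  "ac_primitive L F f \<longleftrightarrow> f absolutely_integrable_on {0..L} \<and>
     (\<forall>s t. 0 \<le> s \<longrightarrow> s \<le> t \<longrightarrow> t \<le> L \<longrightarrow> (f has_integral (F t - F s)) {s..t})"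

lemmas integral_split = Henstock_Kurzweil_Integration.integral_combine

lemma ac_primitiveI:
  assumes f: "f absolutely_integrable_on {0..L}"
    and F: "\<And>t. 0 \<le> t \<Longrightarrow> t \<le> L \<Longrightarrow> F t = c + integral {0..t} f"
  shows "ac_primitive L F f"
  unfolding ac_primitive_def
proof (intro conjI allI impI f)
  fix s t :: real assume st: "0 \<le> s" "s \<le> t" "t \<le> L"
  have i: "f integrable_on {0..L}" using f by (simp add: absolutely_integrable_on_def)
  have i2: "f integrable_on {0..t}" "f integrable_on {s..t}"
    using st integrable_on_subinterval[OF i] by auto
  have "integral {0..s} f + integral {s..t} f = integral {0..t} f"
    using st i2 by (intro integral_split) auto
  then have "F t - F s = integral {s..t} f" using F st by (simp add: algebra_simps)
  then show "(f has_integral (F t - F s)) {s..t}" using i2 by (simp add: integrable_integral)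
qed

lemma ac_primitive_integrable: "ac_primitive L F f \<Longrightarrow> f absolutely_integrable_on {0..L}"
  by (simp add: ac_primitive_def)

lemma ac_primitive_has_integral:
  "ac_primitive L F f \<Longrightarrow> 0 \<le> s \<Longrightarrow> s \<le> t \<Longrightarrow> t \<le> L \<Longrightarrow> (f has_integral (F t - F s)) {s..t}"
  by (simp add: ac_primitive_def)

lemma ac_primitive_eq:
  "ac_primitive L F f \<Longrightarrow> 0 \<le> t \<Longrightarrow> t \<le> L \<Longrightarrow> F t = F 0 + integral {0..t} f"
  using ac_primitive_has_integral[of L F f 0 t] by (simp add: integral_unique)

lemma ac_primitive_continuous:
  assumes "ac_primitive L F f" shows "continuous_on {0..L} F"
proof (rule continuous_on_eq)
  have "f integrable_on {0..L}"
    using assms by (simp add: ac_primitive_def absolutely_integrable_on_def)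
  then show "continuous_on {0..L} (\<lambda>t. F 0 + integral {0..t} f)"
    by (intro continuous_intros indefinite_integral_continuous_1)
qed (use ac_primitive_eq[OF assms, symmetric] in auto)

lemma ac_primitive_mono:
  assumes "ac_primitive L F f" "M \<le> L" shows "ac_primitive M F f"
  using assms unfolding ac_primitive_def
  by (auto intro: absolutely_integrable_on_subinterval)

lemma ac_primitive_add:
  "ac_primitive L F f \<Longrightarrow> ac_primitive L G g \<Longrightarrow> ac_primitive L (\<lambda>x. F x + G x) (\<lambda>x. f x + g x)"
  unfolding ac_primitive_def
  by (auto intro!: set_integral_add(1) has_integral_add simp: add_diff_add)

lemma ac_primitive_cmult:
  "ac_primitive L F f \<Longrightarrow> ac_primitive L (\<lambda>x. c * F x) (\<lambda>x. c * f x)"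
  unfolding ac_primitive_def
  by (auto intro!: set_integrable_mult_right has_integral_mult_right simp flip: right_diff_distrib)

lemma ac_primitive_uminus: "ac_primitive L F f \<Longrightarrow> ac_primitive L (\<lambda>x. - F x) (\<lambda>x. - f x)"
  using ac_primitive_cmult[of L F f "-1"] by simp

lemma ac_primitive_diff:
  "ac_primitive L F f \<Longrightarrow> ac_primitive L G g \<Longrightarrow> ac_primitive L (\<lambda>x. F x - G x) (\<lambda>x. f x - g x)"
  using ac_primitive_add[of L F f "\<lambda>x. - G x" "\<lambda>x. - g x"] ac_primitive_uminus[of L G g] by simp

lemma ac_primitive_cong:
  assumes "ac_primitive L F f" "\<And>x. x \<in> {0..L} \<Longrightarrow> F x = G x" "\<And>x. x \<in> {0..L} \<Longrightarrow> f x = g x"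
  shows "ac_primitive L G g"
  unfolding ac_primitive_def
proof (intro conjI allI impI)
  show "g absolutely_integrable_on {0..L}"
    using absolutely_integrable_spike[OF ac_primitive_integrable[OF assms(1)], of "{}" g] assms(3) by simp
  fix s t :: real assume st: "0 \<le> s" "s \<le> t" "t \<le> L"
  show "(g has_integral (G t - G s)) {s..t}"
    using has_integral_eq[of "{s..t}" f g "F t - F s"] ac_primitive_has_integral[OF assms(1) st] st
      assms(2)[of s] assms(2)[of t] assms(3) by auto
qed

lemma ac_primitive_cnj:
  assumes "ac_primitive L F f"
  shows "ac_primitive L (\<lambda>x. cnj (F x)) (\<lambda>x. cnj (f x))"
  unfolding ac_primitive_def
proof (intro conjI allI impI)
  show "(\<lambda>x. cnj (f x)) absolutely_integrable_on {0..L}"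
    using absolutely_integrable_linear[OF ac_primitive_integrable[OF assms] bounded_linear_cnj]
    by (simp add: o_def)
  fix s t :: real assume st: "0 \<le> s" "s \<le> t" "t \<le> L"
  show "((\<lambda>x. cnj (f x)) has_integral (cnj (F t) - cnj (F s))) {s..t}"
    using has_integral_linear[OF ac_primitive_has_integral[OF assms st] bounded_linear_cnj]
    by (simp add: o_def)
qed

lemma ac_primitive_deriv:
  assumes "\<And>x. x \<in> {0..L} \<Longrightarrow> (F has_vector_derivative f x) (at x within {0..L})"
    "continuous_on {0..L} f"
  shows "ac_primitive L F f"
  unfolding ac_primitive_def
proof (intro conjI allI impI)
  show "f absolutely_integrable_on {0..L}"
    using assms(2) by (rule absolutely_integrable_continuous_real)
  fix s t :: real assume st: "0 \<le> s" "s \<le> t" "t \<le> L"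
  show "(f has_integral (F t - F s)) {s..t}"
    using st by (intro fundamental_theorem_of_calculus)
      (auto intro!: has_vector_derivative_within_subset[OF assms(1)])
qed

lemma has_integral_reflect_shift:
  fixes f :: "real \<Rightarrow> 'a::euclidean_space"
  assumes "(f has_integral I) {L - t..L - s}"
  shows "((\<lambda>x. f (L - x)) has_integral I) {s..t}"
proof -
  have "((\<lambda>x. f (- x)) has_integral I) (cbox (-(L - s)) (-(L - t)))"
    using assms by (subst has_integral_reflect) simp
  from has_integral_affinity'[OF this, of 1 "-L"] show ?thesis by simp
qed

lemma ac_primitive_reflect:
  assumes "ac_primitive L F f"
  shows "ac_primitive L (\<lambda>x. F (L - x)) (\<lambda>x. - f (L - x))"
  unfolding ac_primitive_def
proof (intro conjI allI impI)
  have "f integrable_on {0..L}" "(\<lambda>x. norm (f x)) integrable_on {0..L}"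
    using ac_primitive_integrable[OF assms] by (auto simp: absolutely_integrable_on_def)
  then have "(\<lambda>x. f (L - x)) integrable_on {0..L}" "(\<lambda>x. norm (f (L - x))) integrable_on {0..L}"
    using has_integral_reflect_shift[of f _ L L 0] has_integral_reflect_shift[of "\<lambda>x. norm (f x)" _ L L 0]
    unfolding integrable_on_def by auto
  then show "(\<lambda>x. - f (L - x)) absolutely_integrable_on {0..L}"
    by (auto simp: absolutely_integrable_on_def intro: integrable_neg)
  fix s t :: real assume st: "0 \<le> s" "s \<le> t" "t \<le> L"
  have "((\<lambda>x. f (L - x)) has_integral (F (L - s) - F (L - t))) {s..t}"
    using ac_primitive_has_integral[OF assms, of "L - t" "L - s"] st
    by (intro has_integral_reflect_shift) auto
  from has_integral_neg[OF this]
  show "((\<lambda>x. - f (L - x)) has_integral (F (L - t) - F (L - s))) {s..t}" by simp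
qed

section \<open>The product rule for absolutely continuous functions\<close>

lemma absolutely_integrable_continuous_mult:
  fixes p y :: "real \<Rightarrow> 'a :: {euclidean_space, real_normed_field}"
  assumes "p absolutely_integrable_on {a..b}" "continuous_on {a..b} y"
  shows "(\<lambda>x. p x * y x) absolutely_integrable_on {a..b}"
proof -
  have "bilinear ((*) :: 'a \<Rightarrow> 'a \<Rightarrow> 'a)"
    by (simp add: bilinear_conv_bounded_bilinear bounded_bilinear_mult)
  then have "(\<lambda>x. y x * p x) absolutely_integrable_on {a..b}"
  proof (rule absolutely_integrable_bounded_measurable_product)
    show "y \<in> borel_measurable (lebesgue_on {a..b})"
      using assms(2) by (intro continuous_imp_measurable_on_sets_lebesgue) auto
    show "bounded (y ` {a..b})"
      using assms(2) by (intro compact_imp_bounded compact_continuous_image) auto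
  qed (use assms in auto)
  then show ?thesis by (simp add: mult.commute)
qed

lemma integral_norm_indefinite_mono:
  fixes f :: "real \<Rightarrow> complex"
  assumes "f absolutely_integrable_on {0..L}" "0 \<le> s" "s \<le> t" "t \<le> L"
  shows "integral {0..t} (\<lambda>x. norm (f x)) - integral {0..s} (\<lambda>x. norm (f x))
    = integral {s..t} (\<lambda>x. norm (f x))"
proof -
  have "(\<lambda>x. norm (f x)) integrable_on {0..t}"
    using assms by (auto simp: absolutely_integrable_on_def intro!: integrable_on_subinterval[of _ "{0..L}"])
  then show ?thesis
    using integral_split[of 0 s t "\<lambda>x. norm (f x)"] assms by simp
qed

lemma ac_primitive_norm_diff:
  assumes "ac_primitive L F f" "0 \<le> s" "s \<le> t" "t \<le> L"
  shows "norm (F t - F s) \<le> integral {s..t} (\<lambda>x. norm (f x))"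
proof -
  have "f absolutely_integrable_on {s..t}"
    using assms by (auto intro!: absolutely_integrable_on_subinterval[OF ac_primitive_integrable[OF assms(1)]])
  then have "norm (integral {s..t} f) \<le> integral {s..t} (\<lambda>x. norm (f x))"
    by (intro integral_norm_bound_integral) (auto simp: absolutely_integrable_on_def)
  then show ?thesis using integral_unique[OF ac_primitive_has_integral[OF assms]] by simp
qed

text \<open>On a partition finer than the modulus of uniform continuity of \<Phi>, every first
  factor is at most \<open>e\<close> and the increments of \<Psi> telescope. The total increment of
  \<open>h\<close> is therefore at most \<open>e\<close> times that of \<Psi>, for every
  \<open>e > 0\<close>.\<close>

lemma constant_of_increment_product_bound:
  fixes h :: "real \<Rightarrow> complex" and \<Phi> \<Psi> :: "real \<Rightarrow> real"
  assumes c: "continuous_on {a..b} \<Phi>"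
    and \<Psi>: "\<And>s t. a \<le> s \<Longrightarrow> s \<le> t \<Longrightarrow> t \<le> b \<Longrightarrow> \<Psi> s \<le> \<Psi> t"
    and h: "\<And>s t. a \<le> s \<Longrightarrow> s \<le> t \<Longrightarrow> t \<le> b \<Longrightarrow> norm (h t - h s) \<le> (\<Phi> t - \<Phi> s) * (\<Psi> t - \<Psi> s)"
    and ab: "a \<le> b"
  shows "h b = h a"
proof -
  have *: "norm (h b - h a) \<le> e * (\<Psi> b - \<Psi> a)" if e: "e > 0" for e
  proof -
    have "uniformly_continuous_on {a..b} \<Phi>" by (rule compact_uniformly_continuous[OF c]) simp
    then obtain d where d: "d > 0"
      "\<And>x x'. x \<in> {a..b} \<Longrightarrow> x' \<in> {a..b} \<Longrightarrow> dist x' x < d \<Longrightarrow> dist (\<Phi> x') (\<Phi> x) < e"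
      using e unfolding uniformly_continuous_on_def by metis
    obtain n :: nat where n: "(b - a) / d < real n" using reals_Archimedean2 by blast
    have n0: "n > 0" using n d ab by (metis divide_nonneg_pos diff_ge_0_iff_ge gr0I of_nat_0 not_less)
    define x where "x i = a + (b - a) * real i / real n" for i
    have step: "x i \<le> x (Suc i)" "x (Suc i) - x i < d" for i
    proof -
      show "x i \<le> x (Suc i)" using n0 ab by (simp add: x_def divide_right_mono mult_left_mono)
      have "x (Suc i) - x i = (b - a) / real n" using n0 by (simp add: x_def field_simps)
      also have "\<dots> < d" using n n0 d by (simp add: field_simps)
      finally show "x (Suc i) - x i < d" .
    qed
    have rng: "a \<le> x i" "i \<le> n \<Longrightarrow> x i \<le> b" for i
    proof -
      show "a \<le> x i" using ab by (simp add: x_def)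
      show "x i \<le> b" if "i \<le> n"
        using mult_left_mono[of "real i" "real n" "b - a"] ab that n0 by (simp add: x_def field_simps)
    qed
    have "norm (h (x i) - h a) \<le> e * (\<Psi> (x i) - \<Psi> a)" if "i \<le> n" for i
      using that
    proof (induction i)
      case 0 then show ?case by (simp add: x_def)
    next
      case (Suc i)
      have r: "a \<le> x i" "x i \<le> x (Suc i)" "x (Suc i) \<le> b" using Suc rng step by auto
      have "norm (h (x (Suc i)) - h (x i)) \<le> (\<Phi> (x (Suc i)) - \<Phi> (x i)) * (\<Psi> (x (Suc i)) - \<Psi> (x i))"
        by (rule h[OF r])
      also have "\<dots> \<le> e * (\<Psi> (x (Suc i)) - \<Psi> (x i))"
        using d(2)[of "x i" "x (Suc i)"] r step[of i] \<Psi>[OF r]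
        by (intro mult_right_mono) (auto simp: dist_real_def)
      finally have 1: "norm (h (x (Suc i)) - h (x i)) \<le> e * (\<Psi> (x (Suc i)) - \<Psi> (x i))" .
      have "norm (h (x (Suc i)) - h a) \<le> norm (h (x (Suc i)) - h (x i)) + norm (h (x i) - h a)"
        by (metis diff_add_cancel add_diff_eq norm_triangle_ineq)
      with 1 Suc show ?case by (simp add: algebra_simps)
    qed
    from this[of n] n0 show ?thesis by (simp add: x_def)
  qed
  have "norm (h b - h a) \<le> 0"
  proof (rule field_le_epsilon)
    fix \<epsilon> :: real assume e: "\<epsilon> > 0"
    have "\<Psi> b - \<Psi> a \<ge> 0" using \<Psi>[of a b] ab by simp
    then have "\<epsilon> / (\<Psi> b - \<Psi> a + 1) * (\<Psi> b - \<Psi> a) \<le> \<epsilon>" using e by (simp add: field_simps)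
    with *[of "\<epsilon> / (\<Psi> b - \<Psi> a + 1)"] e \<open>\<Psi> b - \<Psi> a \<ge> 0\<close> show "norm (h b - h a) \<le> 0 + \<epsilon>" by auto
  qed
  then show ?thesis by simp
qed

text \<open>Integration by parts without differentiating at points. The defect \<open>h\<close> of
  the product formula has on [s,t] the increment \<integral> f(x) (G t - G x) + g(x) (F s - F x),
  which is at most twice the product of the integrals of |f| and |g| over [s,t]; the factor 2 is put
  into \<Psi>. Such an \<open>h\<close> is constant by
  \<open>constant_of_increment_product_bound\<close>.\<close>

lemma ac_primitive_mult:
  assumes F: "ac_primitive L F f" and G: "ac_primitive L G g"
  shows "ac_primitive L (\<lambda>x. F x * G x) (\<lambda>x. f x * G x + g x * F x)"
proof -
  let ?k = "\<lambda>x. f x * G x + g x * F x"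
  note cF = ac_primitive_continuous[OF F] and cG = ac_primitive_continuous[OF G]
  note iF = ac_primitive_integrable[OF F] and iG = ac_primitive_integrable[OF G]
  have k: "?k absolutely_integrable_on {0..L}"
    by (intro set_integral_add(1) absolutely_integrable_continuous_mult iF iG cF cG)
  define h where "h t = F t * G t - integral {0..t} ?k" for t
  define \<Phi> where "\<Phi> t = integral {0..t} (\<lambda>x. norm (f x))" for t
  define \<Psi> where "\<Psi> t = 2 * integral {0..t} (\<lambda>x. norm (g x))" for t
  have key: "norm (h t - h s) \<le> (\<Phi> t - \<Phi> s) * (\<Psi> t - \<Psi> s)"
    if st: "0 \<le> s" "s \<le> t" "t \<le> L" for s t
  proof -
    have sub: "{s..t} \<subseteq> {0..L}" using st by auto
    have fi: "f absolutely_integrable_on {s..t}" and gi: "g absolutely_integrable_on {s..t}"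
      and ki: "?k absolutely_integrable_on {s..t}"
      using absolutely_integrable_on_subinterval[OF _ sub] iF iG k by auto
    note F' = ac_primitive_has_integral[OF F st] and G' = ac_primitive_has_integral[OF G st]
    let ?P = "integral {s..t} (\<lambda>x. norm (f x))" and ?Q = "integral {s..t} (\<lambda>x. norm (g x))"
    have "integral {0..s} ?k + integral {s..t} ?k = integral {0..t} ?k"
      using st absolutely_integrable_on_subinterval[OF k, of 0 t]
      by (intro integral_split) (auto simp: absolutely_integrable_on_def)
    then have "h t - h s = F t * G t - F s * G s - integral {s..t} ?k"
      unfolding h_def by (simp add: algebra_simps)
    moreover have "((\<lambda>x. f x * (G t - G x) + g x * (F s - F x)) has_integral
        (F t - F s) * G t + (G t - G s) * F s - integral {s..t} ?k) {s..t}"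
    proof -
      have "((\<lambda>x. (f x * G t + g x * F s) - ?k x) has_integral
          ((F t - F s) * G t + (G t - G s) * F s) - integral {s..t} ?k) {s..t}"
        using ki by (intro has_integral_diff has_integral_add has_integral_mult_left F' G' integrable_integral)
          (simp add: absolutely_integrable_on_def)
      then show ?thesis by (rule has_integral_eq[rotated]) (simp add: algebra_simps)
    qed
    moreover have "F t * G t - F s * G s = (F t - F s) * G t + (G t - G s) * F s"
      by (simp add: algebra_simps)
    ultimately have hi: "((\<lambda>x. f x * (G t - G x) + g x * (F s - F x)) has_integral (h t - h s)) {s..t}"
      by simp
    have bd: "norm (G t - G x) \<le> ?Q" "norm (F s - F x) \<le> ?P" if x: "x \<in> {s..t}" for x
    proof -
      have "norm (G t - G x) \<le> integral {x..t} (\<lambda>x. norm (g x))"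
        using x st by (intro ac_primitive_norm_diff[OF G]) auto
      also have "\<dots> \<le> ?Q" using x gi
        by (intro integral_subset_le)
          (auto simp: absolutely_integrable_on_def intro!: integrable_on_subinterval[of _ "{s..t}"])
      finally show "norm (G t - G x) \<le> ?Q" .
      have "norm (F x - F s) \<le> integral {s..x} (\<lambda>x. norm (f x))"
        using x st by (intro ac_primitive_norm_diff[OF F]) auto
      also have "\<dots> \<le> ?P" using x fi
        by (intro integral_subset_le)
          (auto simp: absolutely_integrable_on_def intro!: integrable_on_subinterval[of _ "{s..t}"])
      finally show "norm (F s - F x) \<le> ?P" by (simp add: norm_minus_commute)
    qed
    have nb: "norm (f x * (G t - G x) + g x * (F s - F x)) \<le> norm (f x) * ?Q + norm (g x) * ?P"
      if "x \<in> {s..t}" for x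
      using mult_left_mono[OF bd(1)[OF that] norm_ge_zero[of "f x"]]
        mult_left_mono[OF bd(2)[OF that] norm_ge_zero[of "g x"]]
      by (intro norm_triangle_le) (simp add: norm_mult)
    have "((\<lambda>x. norm (f x) * ?Q + norm (g x) * ?P) has_integral (?P * ?Q + ?Q * ?P)) {s..t}"
      using fi gi by (intro has_integral_add has_integral_mult_left integrable_integral)
        (auto simp: absolutely_integrable_on_def)
    then have "norm (h t - h s) \<le> ?P * ?Q + ?Q * ?P"
      using integral_norm_bound_integral[of "\<lambda>x. f x * (G t - G x) + g x * (F s - F x)" "{s..t}"
          "\<lambda>x. norm (f x) * ?Q + norm (g x) * ?P"] hi nb
      by (auto simp: has_integral_iff)
    also have "\<dots> = (\<Phi> t - \<Phi> s) * (\<Psi> t - \<Psi> s)"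
      using integral_norm_indefinite_mono[OF iF st] integral_norm_indefinite_mono[OF iG st]
      by (simp add: \<Phi>_def \<Psi>_def algebra_simps)
    finally show ?thesis .
  qed
  have mono: "\<Psi> s \<le> \<Psi> t" if st: "0 \<le> s" "s \<le> t" "t \<le> L" for s t
    using integral_norm_indefinite_mono[OF iG st]
      integral_nonneg[of "\<lambda>x. norm (g x)" "{s..t}"] absolutely_integrable_on_subinterval[OF iG, of s t] st
    unfolding \<Psi>_def by (auto simp: absolutely_integrable_on_def)
  have cont: "continuous_on {0..L} \<Phi>" unfolding \<Phi>_def
    using iF by (intro indefinite_integral_continuous_1) (simp add: absolutely_integrable_on_def)
  show ?thesis
  proof (rule ac_primitiveI[OF k])
    fix t assume t: "0 \<le> t" "t \<le> L"
    have "h t = h 0"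
      using t by (intro constant_of_increment_product_bound[of 0 t \<Phi> \<Psi>] mono key continuous_on_subset[OF cont]) auto
    then show "F t * G t = F 0 * G 0 + integral {0..t} ?k" by (simp add: h_def algebra_simps)
  qed
qed

section \<open>The Sturm--Liouville equation as a first order system\<close>

text \<open>Provides the exponential weight that makes an integral operator with an integrable
  kernel contractive on the whole interval at once. Close to x the mass of \<open>w\<close> is below
  e/2 because its indefinite integral is uniformly continuous; at distance at least \<open>r\<close>
  the exponential pushes the total mass below e/2.\<close>

lemma exp_weight_integral_le:
  fixes w :: "real \<Rightarrow> real"
  assumes w: "w absolutely_integrable_on {0..L}" and w0: "\<And>t. t \<in> {0..L} \<Longrightarrow> 0 \<le> w t"
    and "0 \<le> L" "0 < e"
  obtains k where "0 \<le> k"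
    "\<And>x. x \<in> {0..L} \<Longrightarrow> integral {0..x} (\<lambda>t. w t * exp (- k * (x - t))) \<le> e"
proof -
  define m where "m x = integral {0..x} w" for x
  have wi: "w integrable_on {0..L}" using w by (simp add: absolutely_integrable_on_def)
  have "continuous_on {0..L} m" unfolding m_def by (rule indefinite_integral_continuous_1[OF wi])
  then have "uniformly_continuous_on {0..L} m" by (rule compact_uniformly_continuous) simp
  then obtain d where d: "d > 0"
    "\<And>x x'. x \<in> {0..L} \<Longrightarrow> x' \<in> {0..L} \<Longrightarrow> dist x' x < d \<Longrightarrow> dist (m x') (m x) < e/2"
    using \<open>0 < e\<close> unfolding uniformly_continuous_on_def by (metis half_gt_zero)
  define r where "r = d / 2"
  have r: "r > 0" "r < d" using d by (auto simp: r_def)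
  have wis: "w integrable_on {s..t}" if "0 \<le> s" "t \<le> L" for s t
    using that by (intro integrable_on_subinterval[OF wi]) auto
  have msplit: "integral {s..t} w = m t - m s" if "0 \<le> s" "s \<le> t" "t \<le> L" for s t
    using integral_split[OF that(1,2) wis] that by (simp add: m_def)
  have mL: "m x \<le> m L" "0 \<le> m x" if "x \<in> {0..L}" for x
  proof -
    have "0 \<le> integral {x..L} w" using that w0 by (intro integral_nonneg wis) auto
    with that show "m x \<le> m L" using msplit[of x L] by auto
    show "0 \<le> m x" unfolding m_def using that w0 by (intro integral_nonneg wis) auto
  qed
  have mL0: "0 \<le> m L" using mL \<open>0 \<le> L\<close> by simp
  \<comment> \<open>Chosen so that k r = 2 m(L) / e; then 1 + u \<le> exp u already gives exp(- k r)
    m(L) \<le> e/2.\<close>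
  define k where "k = 2 * m L / (e * r)"
  have k0: "k \<ge> 0" using mL0 r \<open>0 < e\<close> by (simp add: k_def)
  have ek: "exp (- k * r) * m L \<le> e / 2"
  proof -
    have "1 + k * r \<le> exp (k * r)" by (rule exp_ge_add_one_self)
    moreover have "k * r = 2 * m L / e" using r by (simp add: k_def)
    ultimately have "2 * m L / e \<le> exp (k * r)" by linarith
    then have "m L * 2 \<le> e * exp (k * r)" using \<open>0 < e\<close> by (simp add: field_simps)
    then show ?thesis by (simp add: exp_minus field_simps)
  qed
  have main: "integral {0..x} (\<lambda>t. w t * exp (- k * (x - t))) \<le> e" if x: "x \<in> {0..L}" for x
  proof -
    have gi: "(\<lambda>t. w t * exp (- k * (x - t))) integrable_on {s..t}" if "0 \<le> s" "t \<le> L" for s t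
    proof -
      have "w absolutely_integrable_on {s..t}"
        using that by (auto intro: absolutely_integrable_on_subinterval[OF w])
      then have "(\<lambda>t. w t * exp (- k * (x - t))) absolutely_integrable_on {s..t}"
        by (intro absolutely_integrable_continuous_mult) (auto intro!: continuous_intros)
      then show ?thesis by (simp add: absolutely_integrable_on_def)
    qed
    have near: "integral {s..x} (\<lambda>t. w t * exp (- k * (x - t))) \<le> e/2" if s: "0 \<le> s" "s \<le> x" "x - s < d" for s
    proof -
      have "integral {s..x} (\<lambda>t. w t * exp (- k * (x - t))) \<le> integral {s..x} w"
        using x s k0 w0 by (intro integral_le gi wis) (auto intro!: mult_left_le)
      also have "\<dots> = m x - m s" using x s by (intro msplit) auto
      also have "\<dots> \<le> e/2" using d(2)[of s x] x s abs_ge_self[of "m x - m s"] by (auto simp: dist_real_def simp del: abs_ge_self)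
      finally show ?thesis .
    qed
    show ?thesis
    proof (cases "x < d")
      case True
      then show ?thesis using near[of 0] x \<open>0 < e\<close> by auto
    next
      case False
      define s where "s = x - r"
      have s: "0 \<le> s" "s \<le> x" "x - s < d" using False r by (auto simp: s_def)
      have "integral {0..s} (\<lambda>t. w t * exp (- k * (x - t))) \<le> integral {0..s} (\<lambda>t. w t * exp (- k * r))"
        using x s k0 w0
        by (intro integral_le gi integrable_on_mult_left wis)
           (auto intro!: mult_left_mono simp: s_def)
      also have "\<dots> = exp (- k * r) * m s" unfolding m_def by simp
      also have "\<dots> \<le> exp (- k * r) * m L" using mL[of s] s x by (intro mult_left_mono) auto
      also have "\<dots> \<le> e/2" by (rule ek)
      finally have "integral {0..s} (\<lambda>t. w t * exp (- k * (x - t))) \<le> e/2" .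
      moreover have "integral {0..s} (\<lambda>t. w t * exp (- k * (x - t))) + integral {s..x} (\<lambda>t. w t * exp (- k * (x - t)))
        = integral {0..x} (\<lambda>t. w t * exp (- k * (x - t)))"
        using s x by (intro integral_split gi) auto
      ultimately show ?thesis using near[OF s] by simp
    qed
  qed
  show thesis by (rule that[OF k0 main])
qed

text \<open>At the maximum point of exp(- k x) N(x) the integral term is at most half of that
  maximum, so it can be absorbed on the left. \<open>K\<close> is found before \<open>N\<close> and
  \<open>c\<close>, hence serves all of them.\<close>

lemma gronwall_integrable:
  fixes w :: "real \<Rightarrow> real"
  assumes w: "w absolutely_integrable_on {0..L}" and w0: "\<And>t. t \<in> {0..L} \<Longrightarrow> 0 \<le> w t"
    and L: "0 \<le> L"
  obtains K where "0 < K"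
    "\<And>N c x. continuous_on {0..L} N \<Longrightarrow> (\<And>t. t \<in> {0..L} \<Longrightarrow> 0 \<le> N t) \<Longrightarrow>
       (\<And>t. t \<in> {0..L} \<Longrightarrow> N t \<le> c + integral {0..t} (\<lambda>s. w s * N s)) \<Longrightarrow> x \<in> {0..L} \<Longrightarrow> N x \<le> K * c"
proof -
  obtain k where k: "0 \<le> k"
    "\<And>x. x \<in> {0..L} \<Longrightarrow> integral {0..x} (\<lambda>t. w t * exp (- k * (x - t))) \<le> 1/2"
    using exp_weight_integral_le[OF w w0 L, of "1/2"] by auto
  have "N x \<le> 2 * exp (k * L) * c"
    if cN: "continuous_on {0..L} N" and N0: "\<And>t. t \<in> {0..L} \<Longrightarrow> 0 \<le> N t"
      and N: "\<And>t. t \<in> {0..L} \<Longrightarrow> N t \<le> c + integral {0..t} (\<lambda>s. w s * N s)" and x: "x \<in> {0..L}" for N c x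
  proof -
    have "continuous_on {0..L} (\<lambda>x. exp (- k * x) * N x)" by (intro continuous_intros cN)
    then obtain z where z: "z \<in> {0..L}"
      "\<And>x. x \<in> {0..L} \<Longrightarrow> exp (- k * x) * N x \<le> exp (- k * z) * N z"
      using continuous_attains_sup[of "{0..L}" "\<lambda>x. exp (- k * x) * N x"] L by auto
    define M where "M = exp (- k * z) * N z"
    have M0: "M \<ge> 0" using N0 z by (simp add: M_def)
    have c0: "c \<ge> 0" using N[of 0] N0[of 0] L by simp
    have wz: "w absolutely_integrable_on {0..z}"
      using z by (auto intro: absolutely_integrable_on_subinterval[OF w])
    have i1: "(\<lambda>t. w t * N t) absolutely_integrable_on {0..z}"
      using z by (intro absolutely_integrable_continuous_mult wz continuous_on_subset[OF cN]) auto
    have i2: "(\<lambda>t. w t * exp (- k * (z - t))) absolutely_integrable_on {0..z}"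
      by (intro absolutely_integrable_continuous_mult wz) (auto intro!: continuous_intros)
    have "exp (- k * z) * integral {0..z} (\<lambda>s. w s * N s) = integral {0..z} (\<lambda>s. exp (- k * z) * (w s * N s))"
      by simp
    also have "\<dots> \<le> integral {0..z} (\<lambda>s. w s * exp (- k * (z - s)) * M)"
    proof (rule integral_le)
      show "(\<lambda>s. exp (- k * z) * (w s * N s)) integrable_on {0..z}"
        using i1 by (intro integrable_on_mult_right) (simp add: absolutely_integrable_on_def)
      show "(\<lambda>s. w s * exp (- k * (z - s)) * M) integrable_on {0..z}"
        using i2 by (intro integrable_on_mult_left) (simp add: absolutely_integrable_on_def)
      fix s assume s: "s \<in> {0..z}"
      then have "s \<in> {0..L}" using z by auto
      then have "w s * exp (- k * (z - s)) * (exp (- k * s) * N s) \<le> w s * exp (- k * (z - s)) * M"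
        using z(2)[of s] w0[of s] by (intro mult_left_mono) (auto simp: M_def)
      moreover have "exp (- k * (z - s)) * exp (- k * s) = exp (- k * z)"
        by (simp add: exp_add[symmetric] algebra_simps)
      ultimately show "exp (- k * z) * (w s * N s) \<le> w s * exp (- k * (z - s)) * M"
        by (metis (no_types, lifting) mult.assoc mult.left_commute)
    qed
    also have "\<dots> = integral {0..z} (\<lambda>s. w s * exp (- k * (z - s))) * M" by simp
    also have "\<dots> \<le> 1/2 * M" by (intro mult_right_mono k(2) z M0)
    finally have 1: "exp (- k * z) * integral {0..z} (\<lambda>s. w s * N s) \<le> 1/2 * M" .
    have "M \<le> exp (- k * z) * (c + integral {0..z} (\<lambda>s. w s * N s))"
      unfolding M_def by (intro mult_left_mono N z) simp
    also have "\<dots> = exp (- k * z) * c + exp (- k * z) * integral {0..z} (\<lambda>s. w s * N s)"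
      by (simp add: algebra_simps)
    also have "exp (- k * z) * c \<le> c" using z k c0 by (intro mult_left_le_one_le) auto
    finally have "M \<le> 2 * c" using 1 by simp
    then have "exp (- k * x) * N x \<le> 2 * c" using z(2)[OF x] by (simp add: M_def)
    then have "N x \<le> exp (k * x) * (2 * c)" by (simp add: exp_minus field_simps)
    also have "\<dots> \<le> exp (k * L) * (2 * c)" using x k c0 by (intro mult_right_mono) (auto intro!: mult_left_mono)
    finally show ?thesis by (simp add: mult_ac)
  qed
  then show thesis by (intro that[of "2 * exp (k * L)"]) auto
qed

text \<open>The system y' = v, v' = p y + g, with \<open>p\<close> standing for q - z. The
  inhomogeneity \<open>g\<close> is carried along so that differences of solutions for different z,
  and derivatives with respect to z, solve a system of the same type.\<close>

definition sl_ode ::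
  "real \<Rightarrow> (real \<Rightarrow> complex) \<Rightarrow> (real \<Rightarrow> complex) \<Rightarrow> (real \<Rightarrow> complex) \<Rightarrow> (real \<Rightarrow> complex) \<Rightarrow> bool"
  where "sl_ode L p g y v \<longleftrightarrow> ac_primitive L y v \<and> ac_primitive L v (\<lambda>x. p x * y x + g x)"

lemma sl_ode_lincomb:
  assumes "sl_ode L p g1 y1 v1" "sl_ode L p g2 y2 v2"
  shows "sl_ode L p (\<lambda>x. a * g1 x + b * g2 x) (\<lambda>x. a * y1 x + b * y2 x) (\<lambda>x. a * v1 x + b * v2 x)"
  unfolding sl_ode_def
proof
  show "ac_primitive L (\<lambda>x. a * y1 x + b * y2 x) (\<lambda>x. a * v1 x + b * v2 x)"
    using assms unfolding sl_ode_def by (intro ac_primitive_add ac_primitive_cmult) auto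
  have "ac_primitive L (\<lambda>x. a * v1 x + b * v2 x) (\<lambda>x. a * (p x * y1 x + g1 x) + b * (p x * y2 x + g2 x))"
    using assms unfolding sl_ode_def by (intro ac_primitive_add ac_primitive_cmult) auto
  then show "ac_primitive L (\<lambda>x. a * v1 x + b * v2 x)
     (\<lambda>x. p x * (a * y1 x + b * y2 x) + (a * g1 x + b * g2 x))"
    by (rule ac_primitive_cong) (auto simp: algebra_simps)
qed

lemma sl_ode_cong:
  assumes "sl_ode L p g y v" "\<And>x. x \<in> {0..L} \<Longrightarrow> p x * y x + g x = p' x * y' x + g' x"
    "\<And>x. x \<in> {0..L} \<Longrightarrow> y x = y' x" "\<And>x. x \<in> {0..L} \<Longrightarrow> v x = v' x"
  shows "sl_ode L p' g' y' v'"
  unfolding sl_ode_def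
proof
  show "ac_primitive L y' v'"
    by (rule ac_primitive_cong[of L y v]) (use assms in \<open>auto simp: sl_ode_def\<close>)
  show "ac_primitive L v' (\<lambda>x. p' x * y' x + g' x)"
    by (rule ac_primitive_cong[of L v "\<lambda>x. p x * y x + g x"]) (use assms in \<open>auto simp: sl_ode_def\<close>)
qed

text \<open>The function |y| + |v| satisfies the Gronwall inequality with weight 1 + |p|. Since
  \<open>K\<close> depends on \<open>p\<close> and \<open>L\<close> only, the bound yields
  uniqueness (zero data) as well as the estimates of difference quotients in z (small
  \<open>g\<close>).\<close>

lemma sl_ode_bound:
  assumes p: "p absolutely_integrable_on {0..L}" and L: "0 \<le> L"
  obtains K where "0 < K"
    "\<And>g y v x. sl_ode L p g y v \<Longrightarrow> g absolutely_integrable_on {0..L} \<Longrightarrow> x \<in> {0..L} \<Longrightarrow>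
       norm (y x) + norm (v x) \<le> K * (norm (y 0) + norm (v 0) + integral {0..L} (\<lambda>x. norm (g x)))"
proof -
  have np: "(\<lambda>x. norm (p x)) absolutely_integrable_on {0..L}"
    using p by (simp add: absolutely_integrable_on_def)
  then have w: "(\<lambda>x. 1 + norm (p x)) absolutely_integrable_on {0..L}"
    by (intro set_integral_add(1)[OF absolutely_integrable_continuous_real]) auto
  obtain K where K: "0 < K" "\<And>N c x. continuous_on {0..L} N \<Longrightarrow> (\<And>t. t \<in> {0..L} \<Longrightarrow> 0 \<le> N t) \<Longrightarrow>
       (\<And>t. t \<in> {0..L} \<Longrightarrow> N t \<le> c + integral {0..t} (\<lambda>s. (1 + norm (p s)) * N s)) \<Longrightarrow> x \<in> {0..L} \<Longrightarrow> N x \<le> K * c"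
    using gronwall_integrable[OF w _ L] by auto
  have "norm (y x) + norm (v x) \<le> K * (norm (y 0) + norm (v 0) + integral {0..L} (\<lambda>x. norm (g x)))"
    if ode: "sl_ode L p g y v" and g: "g absolutely_integrable_on {0..L}" and x: "x \<in> {0..L}" for g y v x
  proof (rule K(2)[OF _ _ _ x])
    have ay: "ac_primitive L y v" and av: "ac_primitive L v (\<lambda>x. p x * y x + g x)"
      using ode by (auto simp: sl_ode_def)
    note cy = ac_primitive_continuous[OF ay] and cv = ac_primitive_continuous[OF av]
    show "continuous_on {0..L} (\<lambda>x. norm (y x) + norm (v x))" by (intro continuous_intros cy cv)
    fix t assume t: "t \<in> {0..L}"
    show "0 \<le> norm (y t) + norm (v t)" by simp
    have sub: "{0..t} \<subseteq> {0..L}" using t by auto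
    have gi: "(\<lambda>x. norm (g x)) integrable_on {0..L}" using g by (simp add: absolutely_integrable_on_def)
    have gt: "(\<lambda>x. norm (g x)) integrable_on {0..t}" using t by (intro integrable_on_subinterval[OF gi sub])
    have wt: "(\<lambda>s. (1 + norm (p s)) * (norm (y s) + norm (v s))) integrable_on {0..t}"
    proof -
      have "(\<lambda>s. (1 + norm (p s)) * (norm (y s) + norm (v s))) absolutely_integrable_on {0..L}"
        by (intro absolutely_integrable_continuous_mult w continuous_intros cy cv)
      then show ?thesis using sub by (auto simp: absolutely_integrable_on_def intro: integrable_on_subinterval)
    qed
    have vt: "(\<lambda>s. norm (v s)) integrable_on {0..t}"
      by (intro integrable_continuous_real continuous_intros continuous_on_subset[OF cv sub])
    have qt: "(\<lambda>s. norm (p s * y s + g s)) integrable_on {0..t}"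
      using ac_primitive_integrable[OF av] sub by (auto simp: absolutely_integrable_on_def intro: integrable_on_subinterval)
    have "norm (y t - y 0) \<le> integral {0..t} (\<lambda>s. norm (v s))"
      using t by (intro ac_primitive_norm_diff[OF ay]) auto
    moreover have "norm (v t - v 0) \<le> integral {0..t} (\<lambda>s. norm (p s * y s + g s))"
      using t by (intro ac_primitive_norm_diff[OF av]) auto
    moreover have "norm (y t) \<le> norm (y 0) + norm (y t - y 0)" "norm (v t) \<le> norm (v 0) + norm (v t - v 0)"
      by (metis add.commute diff_add_cancel norm_triangle_ineq)+
    ultimately have "norm (y t) + norm (v t) \<le> norm (y 0) + norm (v 0) +
       (integral {0..t} (\<lambda>s. norm (v s)) + integral {0..t} (\<lambda>s. norm (p s * y s + g s)))" by linarith
    also have "integral {0..t} (\<lambda>s. norm (v s)) + integral {0..t} (\<lambda>s. norm (p s * y s + g s))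
        = integral {0..t} (\<lambda>s. norm (v s) + norm (p s * y s + g s))"
      using vt qt by (simp add: Henstock_Kurzweil_Integration.integral_add)
    also have "\<dots> \<le> integral {0..t} (\<lambda>s. (1 + norm (p s)) * (norm (y s) + norm (v s)) + norm (g s))"
    proof (intro integral_le Henstock_Kurzweil_Integration.integrable_add vt qt wt gt)
      fix s
      have "norm (p s * y s + g s) \<le> norm (p s) * norm (y s) + norm (g s)"
        by (metis norm_mult norm_triangle_ineq)
      moreover have "0 \<le> norm (y s)" "0 \<le> norm (p s) * norm (v s)" by auto
      ultimately show "norm (v s) + norm (p s * y s + g s)
        \<le> (1 + norm (p s)) * (norm (y s) + norm (v s)) + norm (g s)"
        unfolding ring_distribs by linarith
    qed
    also have "\<dots> = integral {0..t} (\<lambda>s. (1 + norm (p s)) * (norm (y s) + norm (v s))) + integral {0..t} (\<lambda>x. norm (g x))"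
      by (rule Henstock_Kurzweil_Integration.integral_add[OF wt gt])
    also have "integral {0..t} (\<lambda>x. norm (g x)) \<le> integral {0..L} (\<lambda>x. norm (g x))"
      using gt gi sub by (intro integral_subset_le) auto
    finally show "norm (y t) + norm (v t) \<le> norm (y 0) + norm (v 0) + integral {0..L} (\<lambda>x. norm (g x))
      + integral {0..t} (\<lambda>s. (1 + norm (p s)) * (norm (y s) + norm (v s)))" by simp
  qed
  with K(1) show thesis by (intro that) auto
qed

lemma sl_ode_unique:
  assumes p: "p absolutely_integrable_on {0..L}"
    and "sl_ode L p g y1 v1" "sl_ode L p g y2 v2" "y1 0 = y2 0" "v1 0 = v2 0" "x \<in> {0..L}"
  shows "y1 x = y2 x" "v1 x = v2 x"
proof -
  have L: "0 \<le> L" using assms by auto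
  obtain K where K: "\<And>g y v x. sl_ode L p g y v \<Longrightarrow> g absolutely_integrable_on {0..L} \<Longrightarrow> x \<in> {0..L} \<Longrightarrow>
       norm (y x) + norm (v x) \<le> K * (norm (y 0) + norm (v 0) + integral {0..L} (\<lambda>x. norm (g x)))"
    using sl_ode_bound[OF p L] by metis
  have "sl_ode L p (\<lambda>x. 0) (\<lambda>x. y1 x - y2 x) (\<lambda>x. v1 x - v2 x)"
    using sl_ode_lincomb[OF assms(2,3), of 1 "-1"] by simp
  from K[OF this _ \<open>x \<in> {0..L}\<close>] have "norm (y1 x - y2 x) + norm (v1 x - v2 x) \<le> 0" using assms by simp
  then have "norm (y1 x - y2 x) = 0" "norm (v1 x - v2 x) = 0"
    by (smt (verit) norm_ge_zero)+
  then show "y1 x = y2 x" "v1 x = v2 x" by auto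
qed

text \<open>Banach's fixed point theorem for the unknown u = exp(- k x) (y, v). Moving the
  exponential weight into the unknown lets the ordinary supremum norm do the work, and one
  application covers all of [0,L].\<close>

lemma sl_ode_exists:
  assumes p: "p absolutely_integrable_on {0..L}" and g: "g absolutely_integrable_on {0..L}"
    and L: "0 \<le> L"
  shows "\<exists>y v. sl_ode L p g y v \<and> y 0 = ya \<and> v 0 = va"
proof -
  have np: "(\<lambda>x. norm (p x)) absolutely_integrable_on {0..L}"
    using p by (simp add: absolutely_integrable_on_def)
  then have w: "(\<lambda>x. 1 + norm (p x)) absolutely_integrable_on {0..L}"
    by (intro set_integral_add(1)[OF absolutely_integrable_continuous_real]) auto
  \<comment> \<open>Each of the two components then contributes at most a quarter of the distance,
    which makes 1/2 the contraction constant for pairs.\<close>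
  obtain k where k: "0 \<le> k"
    "\<And>x. x \<in> {0..L} \<Longrightarrow> integral {0..x} (\<lambda>t. (1 + norm (p t)) * exp (- k * (x - t))) \<le> 1/4"
    using exp_weight_integral_le[OF w _ L, of "1/4"] by auto
  let ?e = "\<lambda>x::real. complex_of_real (exp (k * x))" and ?f = "\<lambda>x::real. complex_of_real (exp (- k * x))"
  \<comment> \<open>The factor \<open>1 *\<close> gives both components the shape a(t) exp(k t)
    h(t), with a = 1 here and a = p in \<open>V\<close>, so that \<open>contr\<close> applies to
    either.\<close>
  define Y where "Y u x = ?f x * (ya + integral {0..x} (\<lambda>t. 1 * (?e t * snd (u t))))"
    for u :: "real \<Rightarrow> complex \<times> complex" and x
  define V where "V u x = ?f x * (va + integral {0..x} g + integral {0..x} (\<lambda>t. p t * (?e t * fst (u t))))"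
    for u :: "real \<Rightarrow> complex \<times> complex" and x
  have ef: "?f x * ?e x = 1" "?e x * ?f x = 1" for x
    by (simp_all add: of_real_mult[symmetric] exp_add[symmetric] del: of_real_mult)
  have ai: "(\<lambda>t. a t * (?e t * h t)) absolutely_integrable_on {0..L}"
    if "continuous_on {0..L} h" "a absolutely_integrable_on {0..L}" for h a
    using that by (intro absolutely_integrable_continuous_mult continuous_intros) auto
  have aone: "(\<lambda>t. 1 :: complex) absolutely_integrable_on {0..L}"
    by (intro absolutely_integrable_continuous_real) auto
  have contr: "norm (?f x * integral {0..x} (\<lambda>t. a t * (?e t * h t))) \<le> D / 4"
    if h: "continuous_on {0..L} h" "\<And>t. norm (h t) \<le> D" and a: "a absolutely_integrable_on {0..L}"
      "\<And>t. norm (a t) \<le> 1 + norm (p t)" and x: "x \<in> {0..L}" for h D a x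
  proof -
    have D: "0 \<le> D" using h(2)[of 0] norm_ge_zero order_trans by blast
    have sub: "{0..x} \<subseteq> {0..L}" using x by auto
    have "(\<lambda>t. (1 + norm (p t)) * exp (- k * (x - t))) absolutely_integrable_on {0..x}"
      by (intro absolutely_integrable_continuous_mult absolutely_integrable_on_subinterval[OF w sub] continuous_intros)
    then have i: "(\<lambda>t. (1 + norm (p t)) * exp (- k * (x - t))) integrable_on {0..x}"
      by (simp add: absolutely_integrable_on_def)
    have "(\<lambda>t. a t * (?e t * h t)) integrable_on {0..x}"
      using absolutely_integrable_on_subinterval[OF ai[OF h(1) a(1)] sub]
      by (simp add: absolutely_integrable_on_def)
    then have i2: "(\<lambda>t. ?f x * (a t * (?e t * h t))) integrable_on {0..x}"
      by (rule integrable_on_mult_right)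
    have "norm (?f x * integral {0..x} (\<lambda>t. a t * (?e t * h t)))
      = norm (integral {0..x} (\<lambda>t. ?f x * (a t * (?e t * h t))))" by simp
    also have "\<dots> \<le> integral {0..x} (\<lambda>t. (1 + norm (p t)) * exp (- k * (x - t)) * D)"
    proof (rule integral_norm_bound_integral[OF i2])
      show "(\<lambda>t. (1 + norm (p t)) * exp (- k * (x - t)) * D) integrable_on {0..x}"
        using i by (rule integrable_on_mult_left)
      fix t
      have "norm (?f x * (a t * (?e t * h t))) = exp (- k * (x - t)) * (norm (a t) * norm (h t))"
        by (simp add: norm_mult exp_add[symmetric] algebra_simps)
      also have "\<dots> \<le> exp (- k * (x - t)) * ((1 + norm (p t)) * D)"
        using a(2)[of t] h(2)[of t] D by (intro mult_left_mono mult_mono) auto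
      finally show "norm (?f x * (a t * (?e t * h t))) \<le> (1 + norm (p t)) * exp (- k * (x - t)) * D"
        by (simp add: mult_ac)
    qed
    also have "\<dots> = integral {0..x} (\<lambda>t. (1 + norm (p t)) * exp (- k * (x - t))) * D" by simp
    also have "\<dots> \<le> 1/4 * D" by (intro mult_right_mono k(2) x D)
    finally show ?thesis by simp
  qed
  have cont: "continuous_on (cbox 0 L) (\<lambda>x. (Y u x, V u x))" if u: "continuous_on {0..L} u" for u
  proof -
    have c: "continuous_on {0..L} (\<lambda>t. fst (u t))" "continuous_on {0..L} (\<lambda>t. snd (u t))"
      by (intro continuous_intros u)+
    have "continuous_on {0..L} (\<lambda>x. integral {0..x} (\<lambda>t. 1 * (?e t * snd (u t))))"
      "continuous_on {0..L} (\<lambda>x. integral {0..x} g)"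
      "continuous_on {0..L} (\<lambda>x. integral {0..x} (\<lambda>t. p t * (?e t * fst (u t))))"
      using ai[OF c(2) aone] ai[OF c(1) p] g unfolding absolutely_integrable_on_def
      by (blast intro: indefinite_integral_continuous_1)+
    then show ?thesis unfolding Y_def V_def cbox_interval
      by (intro continuous_intros)
  qed
  \<comment> \<open>The complete space is that of bounded continuous functions on the whole line;
    \<open>clamp\<close> extends the image constantly beyond [0,L].\<close>
  have "\<exists>T::real \<Rightarrow>\<^sub>C (complex \<times> complex). \<forall>x. apply_bcontfun T x = (Y u (clamp 0 L x), V u (clamp 0 L x))"
    if "continuous_on {0..L} u" for u
    using continuous_on_cbox_bcontfunE[OF cont[OF that]] by metis
  then have "\<forall>u :: real \<Rightarrow>\<^sub>C (complex \<times> complex). \<exists>w :: real \<Rightarrow>\<^sub>C (complex \<times> complex).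
      \<forall>x. apply_bcontfun w x = (Y (apply_bcontfun u) (clamp 0 L x), V (apply_bcontfun u) (clamp 0 L x))"
    by auto
  then obtain T :: "(real \<Rightarrow>\<^sub>C (complex \<times> complex)) \<Rightarrow> (real \<Rightarrow>\<^sub>C (complex \<times> complex))"
    where T: "\<And>u x. apply_bcontfun (T u) x
      = (Y (apply_bcontfun u) (clamp 0 L x), V (apply_bcontfun u) (clamp 0 L x))"
    unfolding choice_iff by blast
  have "dist (T u) (T u') \<le> 1/2 * dist u u'" for u u'
  proof (rule dist_bound)
    fix x :: real
    define z where "z = clamp 0 L x"
    have z: "z \<in> {0..L}" using clamp_in_interval[of 0 L x] L by (simp add: z_def)
    define D where "D = dist u u'"
    have D: "norm (fst (u t) - fst (u' t)) \<le> D" "norm (snd (u t) - snd (u' t)) \<le> D" for t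
    proof -
      have "dist (u t) (u' t) \<le> D" unfolding D_def by (rule dist_bounded)
      then show "norm (fst (u t) - fst (u' t)) \<le> D" "norm (snd (u t) - snd (u' t)) \<le> D"
        using dist_fst_le[of "u t" "u' t"] dist_snd_le[of "u t" "u' t"] by (auto simp: dist_norm)
    qed
    have cu: "continuous_on {0..L} (\<lambda>t. fst (apply_bcontfun w t))" "continuous_on {0..L} (\<lambda>t. snd (apply_bcontfun w t))"
      for w :: "real \<Rightarrow>\<^sub>C (complex \<times> complex)"
      by (intro continuous_intros continuous_on_apply_bcontfun)+
    have sub: "{0..z} \<subseteq> {0..L}" using z by auto
    have ii: "(\<lambda>t. a t * (?e t * h t)) integrable_on {0..z}"
      if "continuous_on {0..L} h" "a absolutely_integrable_on {0..L}" for h a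
      using absolutely_integrable_on_subinterval[OF ai[OF that] sub] by (simp add: absolutely_integrable_on_def)
    have "Y u z - Y u' z = ?f z * integral {0..z} (\<lambda>t. 1 * (?e t * (snd (u t) - snd (u' t))))"
      unfolding Y_def using ii[OF cu(2) aone, of u] ii[OF cu(2) aone, of u']
      by (simp add: Henstock_Kurzweil_Integration.integral_diff right_diff_distrib ring_distribs)
    then have 1: "norm (Y u z - Y u' z) \<le> D / 4"
      using contr[of "\<lambda>t. snd (u t) - snd (u' t)" D "\<lambda>_. 1" z] cu D(2) aone z
      by (simp add: continuous_on_diff)
    have "V u z - V u' z = ?f z * integral {0..z} (\<lambda>t. p t * (?e t * (fst (u t) - fst (u' t))))"
      unfolding V_def using ii[OF cu(1) p, of u] ii[OF cu(1) p, of u']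
      by (simp add: Henstock_Kurzweil_Integration.integral_diff right_diff_distrib ring_distribs)
    then have 2: "norm (V u z - V u' z) \<le> D / 4"
      using contr[of "\<lambda>t. fst (u t) - fst (u' t)" D p z] cu D(1) p z
      by (simp add: continuous_on_diff)
    have "dist (T u x) (T u' x) \<le> norm (Y u z - Y u' z) + norm (V u z - V u' z)"
      using norm_Pair_le[of "Y u z - Y u' z" "V u z - V u' z"] by (simp add: T z_def[symmetric] dist_norm)
    with 1 2 show "dist (T u x) (T u' x) \<le> 1/2 * dist u u'" by (simp add: D_def)
  qed
  then have "\<exists>!u. T u = u" by (intro banach_fix_type[of "1/2"]) auto
  then obtain u where u: "T u = u" by blast
  have uL: "fst (u x) = Y u x" "snd (u x) = V u x" if "x \<in> {0..L}" for x
    using T[of u x] that by (simp_all add: u)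
  define y where "y x = ?e x * fst (u x)" for x
  define v where "v x = ?e x * snd (u x)" for x
  have cu: "continuous_on {0..L} (\<lambda>t. fst (u t))" "continuous_on {0..L} (\<lambda>t. snd (u t))"
    by (rule continuous_on_fst[OF continuous_on_apply_bcontfun] continuous_on_snd[OF continuous_on_apply_bcontfun])+
  have y: "y x = ya + integral {0..x} v" if "x \<in> {0..L}" for x
  proof -
    have "y x = (?e x * ?f x) * (ya + integral {0..x} (\<lambda>t. 1 * (?e t * snd (u t))))"
      unfolding y_def uL(1)[OF that] Y_def by (simp only: mult.assoc)
    then show ?thesis unfolding ef by (simp add: v_def[abs_def])
  qed
  have pyi: "(\<lambda>t. p t * y t) absolutely_integrable_on {0..L}"
    unfolding y_def by (rule ai[OF cu(1) p])
  have v: "v x = va + integral {0..x} (\<lambda>t. p t * y t + g t)" if "x \<in> {0..L}" for x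
  proof -
    have sub: "{0..x} \<subseteq> {0..L}" using that by auto
    have "v x = (?e x * ?f x) * (va + integral {0..x} g + integral {0..x} (\<lambda>t. p t * (?e t * fst (u t))))"
      unfolding v_def uL(2)[OF that] V_def by (simp only: mult.assoc)
    then have "v x = va + integral {0..x} g + integral {0..x} (\<lambda>t. p t * y t)"
      unfolding ef by (simp add: y_def[abs_def])
    then show ?thesis
      using absolutely_integrable_on_subinterval[OF pyi sub] absolutely_integrable_on_subinterval[OF g sub]
      by (simp add: Henstock_Kurzweil_Integration.integral_add absolutely_integrable_on_def)
  qed
  have "ac_primitive L y v"
  proof (rule ac_primitiveI)
    show "v absolutely_integrable_on {0..L}"
      unfolding v_def by (intro absolutely_integrable_continuous_real continuous_intros cu)
  qed (use y in auto)
  moreover have "ac_primitive L v (\<lambda>x. p x * y x + g x)"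
    by (rule ac_primitiveI[where c = va]) (use v pyi g in \<open>auto intro: set_integral_add(1)\<close>)
  moreover have "y 0 = ya" "v 0 = va" using y[of 0] v[of 0] L by auto
  ultimately show ?thesis unfolding sl_ode_def by blast
qed

section \<open>Holomorphic dependence on the spectral parameter\<close>

lemma absolutely_integrable_diff_const:
  fixes q :: "real \<Rightarrow> complex"
  assumes "q absolutely_integrable_on {0..L}"
  shows "(\<lambda>x. q x - z) absolutely_integrable_on {0..L}"
  by (rule set_integral_diff(1)[OF assms]) (auto intro: absolutely_integrable_continuous_real)

lemma sl_ode_integrable:
  assumes "sl_ode L p g y v"
  shows "y absolutely_integrable_on {0..L}" "v absolutely_integrable_on {0..L}"
    "continuous_on {0..L} y" "continuous_on {0..L} v"
  using assms unfolding sl_ode_def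
  by (auto intro: absolutely_integrable_continuous_real dest: ac_primitive_continuous)

lemma integral_norm_le_sup:
  fixes h :: "real \<Rightarrow> complex"
  assumes "h absolutely_integrable_on {0..L}" "\<And>x. x \<in> {0..L} \<Longrightarrow> norm (h x) \<le> B" "0 \<le> L"
  shows "integral {0..L} (\<lambda>x. norm (h x)) \<le> B * L"
proof -
  have "integral {0..L} (\<lambda>x. norm (h x)) \<le> integral {0..L} (\<lambda>x. B)"
    using assms by (intro integral_le) (auto simp: absolutely_integrable_on_def)
  then show ?thesis using assms by (simp add: mult.commute)
qed

text \<open>\<open>D\<close> solves the equation formally differentiated in z. The difference
  quotient minus \<open>D\<close> solves the equation at \<open>z0\<close> with zero initial values
  and inhomogeneity - (y z - y z0), which is O(z - z0); \<open>sl_ode_bound\<close> carries this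
  order over to the solution.\<close>

lemma sl_ode_spectral_derivative:
  fixes q :: "real \<Rightarrow> complex" and y v :: "complex \<Rightarrow> real \<Rightarrow> complex"
  assumes q: "q absolutely_integrable_on {0..L}" and L: "0 \<le> L"
    and ode: "\<And>z. sl_ode L (\<lambda>x. q x - z) (\<lambda>x. 0) (y z) (v z)"
    and init: "\<And>z. y z 0 = ya" "\<And>z. v z 0 = va"
    and D: "sl_ode L (\<lambda>x. q x - z0) (\<lambda>x. - y z0 x) D D'" "D 0 = 0" "D' 0 = 0"
    and x: "x \<in> {0..L}"
  shows "((\<lambda>z. y z x) has_field_derivative D x) (at z0)"
    and "((\<lambda>z. v z x) has_field_derivative D' x) (at z0)"
proof -
  obtain K where K: "0 < K" "\<And>g y v x. sl_ode L (\<lambda>x. q x - z0) g y v \<Longrightarrow> g absolutely_integrable_on {0..L} \<Longrightarrow> x \<in> {0..L} \<Longrightarrow>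
       norm (y x) + norm (v x) \<le> K * (norm (y 0) + norm (v 0) + integral {0..L} (\<lambda>x. norm (g x)))"
    using sl_ode_bound[OF absolutely_integrable_diff_const[OF q] L] by metis
  obtain B where B: "\<And>t. t \<in> {0..L} \<Longrightarrow> norm (y z0 t) \<le> B"
  proof -
    have "bounded (y z0 ` {0..L})"
      by (intro compact_imp_bounded compact_continuous_image sl_ode_integrable[OF ode]) simp
    then show thesis using that unfolding bounded_iff by (metis image_eqI)
  qed
  have B0: "0 \<le> B" using B[OF x] norm_ge_zero order_trans by blast
  have dode: "sl_ode L (\<lambda>x. q x - z0) (\<lambda>x. - (z - z0) * y z x) (\<lambda>x. y z x - y z0 x) (\<lambda>x. v z x - v z0 x)" for z
  proof -
    have "sl_ode L (\<lambda>x. q x - z0) (\<lambda>x. - (z - z0) * y z x) (y z) (v z)"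
      by (rule sl_ode_cong[OF ode[of z]]) (auto simp: algebra_simps)
    from sl_ode_lincomb[OF this ode[of z0], of 1 "-1"] show ?thesis by simp
  qed
  \<comment> \<open>The difference y z - y z0 has inhomogeneity - (z - z0) y z, which involves the
    unknown \<open>y z\<close> itself. For z close to \<open>z0\<close> its maximum is absorbed,
    giving |y z| \<le> 2 B.\<close>
  have small: "norm (y z t - y z0 t) \<le> 2 * K * L * B * norm (z - z0)"
    if z: "norm (z - z0) * (K * L) \<le> 1/2" and t: "t \<in> {0..L}" for z t
  proof -
    have "continuous_on {0..L} (\<lambda>t. norm (y z t))" by (intro continuous_intros sl_ode_integrable[OF ode])
    then obtain s where s: "s \<in> {0..L}" "\<And>t. t \<in> {0..L} \<Longrightarrow> norm (y z t) \<le> norm (y z s)"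
      using continuous_attains_sup[of "{0..L}" "\<lambda>t. norm (y z t)"] L by auto
    let ?A = "norm (y z s)"
    have 1: "norm (y z t - y z0 t) \<le> K * (norm (z - z0) * ?A * L)" if t: "t \<in> {0..L}" for t
    proof -
      have gi: "(\<lambda>x. - (z - z0) * y z x) absolutely_integrable_on {0..L}"
        by (intro set_integrable_mult_right impI sl_ode_integrable[OF ode])
      have "norm (y z t - y z0 t) + norm (v z t - v z0 t)
        \<le> K * (norm (y z 0 - y z0 0) + norm (v z 0 - v z0 0) + integral {0..L} (\<lambda>x. norm (- (z - z0) * y z x)))"
        by (rule K(2)[OF dode gi t])
      also have "\<dots> = K * integral {0..L} (\<lambda>x. norm (- (z - z0) * y z x))" by (simp add: init)
      also have "\<dots> \<le> K * (norm (z - z0) * ?A * L)"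
        using K(1) s by (intro mult_left_mono integral_norm_le_sup gi L)
          (auto simp: norm_mult norm_minus_commute intro!: mult_left_mono)
      finally show ?thesis by (smt (verit) norm_ge_zero)
    qed
    have "?A \<le> norm (y z0 s) + norm (y z s - y z0 s)"
      by (metis add.commute diff_add_cancel norm_triangle_ineq)
    also have "\<dots> \<le> B + (norm (z - z0) * (K * L)) * ?A"
      using B[OF s(1)] 1[OF s(1)] by (simp add: mult_ac)
    also have "\<dots> \<le> B + 1/2 * ?A" using z by (intro add_left_mono mult_right_mono) auto
    finally have "?A \<le> 2 * B" by simp
    then have "K * (norm (z - z0) * ?A * L) \<le> K * (norm (z - z0) * (2 * B) * L)"
      using K(1) L by (intro mult_left_mono mult_right_mono) auto
    with 1[OF t] show ?thesis by (simp add: mult_ac)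
  qed
  define C where "C = K * (2 * K * L * B * L)"
  have C0: "0 \<le> C" using K(1) L B0 by (simp add: C_def)
  have est: "norm ((y z x - y z0 x) / (z - z0) - D x) \<le> C * norm (z - z0)"
    "norm ((v z x - v z0 x) / (z - z0) - D' x) \<le> C * norm (z - z0)"
    if z: "norm (z - z0) * (K * L) \<le> 1/2" "z \<noteq> z0" for z
  proof -
    let ?c = "1 / (z - z0)"
    have cc: "?c * (- (z - z0) * w) = - w" for w using z(2) by (simp add: divide_simps) (simp add: algebra_simps)
    have "sl_ode L (\<lambda>x. q x - z0) (\<lambda>x. ?c * (- (z - z0) * y z x) + (-1) * (- y z0 x))
      (\<lambda>x. ?c * (y z x - y z0 x) + (-1) * D x) (\<lambda>x. ?c * (v z x - v z0 x) + (-1) * D' x)"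
      by (rule sl_ode_lincomb[OF dode D(1)])
    then have e: "sl_ode L (\<lambda>x. q x - z0) (\<lambda>x. - (y z x - y z0 x))
      (\<lambda>x. (y z x - y z0 x) / (z - z0) - D x) (\<lambda>x. (v z x - v z0 x) / (z - z0) - D' x)"
      by (rule sl_ode_cong) (simp_all only: cc, simp_all)
    have gi: "(\<lambda>x. - (y z x - y z0 x)) absolutely_integrable_on {0..L}"
      using set_integral_diff(1)[OF sl_ode_integrable(1)[OF ode[of z0]] sl_ode_integrable(1)[OF ode[of z]]] by simp
    have "norm ((y z x - y z0 x) / (z - z0) - D x) + norm ((v z x - v z0 x) / (z - z0) - D' x)
      \<le> K * integral {0..L} (\<lambda>x. norm (- (y z x - y z0 x)))"
      using K(2)[OF e gi x] D init by simp
    also have "\<dots> \<le> K * (2 * K * L * B * norm (z - z0) * L)"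
      using K(1) small[OF z(1)]
      by (intro mult_left_mono integral_norm_le_sup gi L) (auto simp: norm_minus_commute)
    also have "\<dots> = C * norm (z - z0)" by (simp add: C_def)
    finally show "norm ((y z x - y z0 x) / (z - z0) - D x) \<le> C * norm (z - z0)"
      "norm ((v z x - v z0 x) / (z - z0) - D' x) \<le> C * norm (z - z0)"
      by (smt (verit) norm_ge_zero)+
  qed
  have ev: "\<forall>\<^sub>F z in at z0. norm (z - z0) * (K * L) \<le> 1/2 \<and> z \<noteq> z0"
  proof -
    have "((\<lambda>z. norm (z - z0) * (K * L)) \<longlongrightarrow> norm (z0 - z0) * (K * L)) (at z0)"
      by (intro tendsto_intros)
    then have "\<forall>\<^sub>F z in at z0. norm (z - z0) * (K * L) < 1/2"
      by (rule order_tendstoD) simp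
    then show ?thesis by (auto simp: eventually_at_filter elim!: eventually_mono)
  qed
  have lim: "((\<lambda>z. C * norm (z - z0)) \<longlongrightarrow> 0) (at z0)"
  proof -
    have "((\<lambda>z. C * norm (z - z0)) \<longlongrightarrow> C * norm (z0 - z0)) (at z0)" by (intro tendsto_intros)
    then show ?thesis by simp
  qed
  have "((\<lambda>z. (y z x - y z0 x) / (z - z0) - D x) \<longlongrightarrow> 0) (at z0)"
    by (rule Lim_null_comparison[OF _ lim]) (use ev in eventually_elim, use est in blast)
  then show "((\<lambda>z. y z x) has_field_derivative D x) (at z0)"
    unfolding has_field_derivative_iff by (simp add: LIM_zero_iff)
  have "((\<lambda>z. (v z x - v z0 x) / (z - z0) - D' x) \<longlongrightarrow> 0) (at z0)"
    by (rule Lim_null_comparison[OF _ lim]) (use ev in eventually_elim, use est in blast)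
  then show "((\<lambda>z. v z x) has_field_derivative D' x) (at z0)"
    unfolding has_field_derivative_iff by (simp add: LIM_zero_iff)
qed

text \<open>The choice is determined on [0,L] only; outside that interval the values are arbitrary,
  so every statement below restricts x.\<close>

definition sl_init :: "real \<Rightarrow> (real \<Rightarrow> complex) \<Rightarrow> complex \<Rightarrow> complex \<Rightarrow> complex \<Rightarrow>
    (real \<Rightarrow> complex) \<times> (real \<Rightarrow> complex)" where
  "sl_init L q ya va z = (SOME (y, v). sl_ode L (\<lambda>x. q x - z) (\<lambda>x. 0) y v \<and> y 0 = ya \<and> v 0 = va)"

abbreviation "sl_y L q ya va z \<equiv> fst (sl_init L q ya va z)"
abbreviation "sl_v L q ya va z \<equiv> snd (sl_init L q ya va z)"

lemma sl_init:
  assumes "q absolutely_integrable_on {0..L}" "0 \<le> L"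
  shows "sl_ode L (\<lambda>x. q x - z) (\<lambda>x. 0) (sl_y L q ya va z) (sl_v L q ya va z)"
    "sl_y L q ya va z 0 = ya" "sl_v L q ya va z 0 = va"
proof -
  have "\<exists>y v. sl_ode L (\<lambda>x. q x - z) (\<lambda>x. 0) y v \<and> y 0 = ya \<and> v 0 = va"
    by (rule sl_ode_exists[OF absolutely_integrable_diff_const[OF assms(1)] _ assms(2)]) simp
  then have "\<exists>p. case p of (y, v) \<Rightarrow> sl_ode L (\<lambda>x. q x - z) (\<lambda>x. 0) y v \<and> y 0 = ya \<and> v 0 = va"
    by auto
  from someI_ex[OF this] show "sl_ode L (\<lambda>x. q x - z) (\<lambda>x. 0) (sl_y L q ya va z) (sl_v L q ya va z)"
    "sl_y L q ya va z 0 = ya" "sl_v L q ya va z 0 = va"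
    by (auto simp: sl_init_def case_prod_unfold)
qed

lemma sl_init_eqI:
  assumes "q absolutely_integrable_on {0..L}" "sl_ode L (\<lambda>x. q x - z) (\<lambda>x. 0) y v" "x \<in> {0..L}"
  shows "y x = sl_y L q (y 0) (v 0) z x" "v x = sl_v L q (y 0) (v 0) z x"
proof -
  have L: "0 \<le> L" using assms(3) by auto
  note S = sl_init[OF assms(1) L]
  show "y x = sl_y L q (y 0) (v 0) z x" "v x = sl_v L q (y 0) (v 0) z x"
    using sl_ode_unique[OF absolutely_integrable_diff_const[OF assms(1)] assms(2) S(1) _ _ assms(3)] S by auto
qed

lemma sl_init_holomorphic:
  assumes "q absolutely_integrable_on {0..L}" "x \<in> {0..L}"
  shows "(\<lambda>z. sl_y L q ya va z x) holomorphic_on A" "(\<lambda>z. sl_v L q ya va z x) holomorphic_on A"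
proof -
  have L: "0 \<le> L" using assms(2) by auto
  note S = sl_init[OF assms(1) L]
  have *: "\<exists>D. ((\<lambda>z. sl_y L q ya va z x) has_field_derivative D) (at z)"
    "\<exists>D. ((\<lambda>z. sl_v L q ya va z x) has_field_derivative D) (at z)" for z
  proof -
    have "(\<lambda>x. (-1) * sl_y L q ya va z x) absolutely_integrable_on {0..L}"
      by (intro set_integrable_mult_right impI sl_ode_integrable(1)[OF S(1)])
    then have "(\<lambda>x. - sl_y L q ya va z x) absolutely_integrable_on {0..L}" by simp
    then obtain D D' where D: "sl_ode L (\<lambda>x. q x - z) (\<lambda>x. - sl_y L q ya va z x) D D'" "D 0 = 0" "D' 0 = 0"
      using sl_ode_exists[OF absolutely_integrable_diff_const[OF assms(1)] _ L] by metis
    show "\<exists>D. ((\<lambda>z. sl_y L q ya va z x) has_field_derivative D) (at z)"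
      "\<exists>D. ((\<lambda>z. sl_v L q ya va z x) has_field_derivative D) (at z)"
      using sl_ode_spectral_derivative[OF assms(1) L S(1) S(2) S(3) D assms(2)] by auto
  qed
  then show "(\<lambda>z. sl_y L q ya va z x) holomorphic_on A" "(\<lambda>z. sl_v L q ya va z x) holomorphic_on A"
    unfolding holomorphic_on_def field_differentiable_def
    by (blast intro: has_field_derivative_at_within)+
qed

text \<open>Separates the dependence on the initial values from that on z. Initial values that vary
  with z, as those of \<open>phi\<close> do, are thereby reduced to the two fundamental
  solutions.\<close>

lemma sl_init_lincomb:
  assumes "q absolutely_integrable_on {0..L}" "x \<in> {0..L}"
  shows "sl_y L q ya va z x = ya * sl_y L q 1 0 z x + va * sl_y L q 0 1 z x"
    "sl_v L q ya va z x = ya * sl_v L q 1 0 z x + va * sl_v L q 0 1 z x"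
proof -
  have L: "0 \<le> L" using assms(2) by auto
  note S = sl_init[OF assms(1) L]
  have "sl_ode L (\<lambda>x. q x - z) (\<lambda>x. 0) (\<lambda>x. ya * sl_y L q 1 0 z x + va * sl_y L q 0 1 z x)
      (\<lambda>x. ya * sl_v L q 1 0 z x + va * sl_v L q 0 1 z x)"
    using sl_ode_lincomb[OF S(1)[where z = z and ya = 1 and va = 0] S(1)[where z = z and ya = 0 and va = 1],
        of ya va] by simp
  from sl_init_eqI[OF assms(1) this assms(2)]
  show "sl_y L q ya va z x = ya * sl_y L q 1 0 z x + va * sl_y L q 0 1 z x"
    "sl_v L q ya va z x = ya * sl_v L q 1 0 z x + va * sl_v L q 0 1 z x"
    by (simp_all add: S)
qed

section \<open>The Lagrange identity and reflection\<close>

text \<open>In the product rule the terms u' w' and p u w cancel. With g = (p2 - p1) w this is the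
  Lagrange identity for two equations; with w the z-derivative of u, where g = - u, it produces the
  integral of u squared.\<close>

lemma sl_ode_wronskian_inhomogeneous:
  assumes "sl_ode L p (\<lambda>x. 0) u u'" "sl_ode L p g w w'"
  shows "ac_primitive L (\<lambda>x. u x * w' x - u' x * w x) (\<lambda>x. u x * g x)"
proof -
  have 1: "ac_primitive L u u'" "ac_primitive L u' (\<lambda>x. p x * u x)"
    "ac_primitive L w w'" "ac_primitive L w' (\<lambda>x. p x * w x + g x)"
    using assms by (auto simp: sl_ode_def)
  have "ac_primitive L (\<lambda>x. u x * w' x - u' x * w x)
     (\<lambda>x. (u' x * w' x + (p x * w x + g x) * u x) - (p x * u x * w x + w' x * u' x))"
    by (intro ac_primitive_diff ac_primitive_mult 1)
  then show ?thesis by (rule ac_primitive_cong) (auto simp: algebra_simps)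
qed

lemma sl_ode_wronskian:
  assumes y: "sl_ode L p1 (\<lambda>x. 0) y v" and w: "sl_ode L p2 (\<lambda>x. 0) w u"
  shows "ac_primitive L (\<lambda>x. y x * u x - v x * w x) (\<lambda>x. (p2 x - p1 x) * (y x * w x))"
proof -
  have "sl_ode L p1 (\<lambda>x. (p2 x - p1 x) * w x) w u"
    by (rule sl_ode_cong[OF w]) (simp_all add: algebra_simps)
  from sl_ode_wronskian_inhomogeneous[OF y this] show ?thesis
    by (rule ac_primitive_cong) simp_all
qed

lemma sl_ode_wronskian_constant:
  assumes "sl_ode L p (\<lambda>x. 0) y v" "sl_ode L p (\<lambda>x. 0) w u" "x \<in> {0..L}"
  shows "y x * u x - v x * w x = y 0 * u 0 - v 0 * w 0"
  using ac_primitive_eq[OF sl_ode_wronskian[OF assms(1,2)], of x] assms(3) by simp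

lemma sl_ode_mono: "sl_ode L p g y v \<Longrightarrow> M \<le> L \<Longrightarrow> sl_ode M p g y v"
  unfolding sl_ode_def by (auto intro: ac_primitive_mono)

lemma sl_ode_reflect:
  assumes "sl_ode L p g y v"
  shows "sl_ode L (\<lambda>x. p (L - x)) (\<lambda>x. g (L - x)) (\<lambda>x. y (L - x)) (\<lambda>x. - v (L - x))"
  unfolding sl_ode_def
proof
  have y: "ac_primitive L y v" and v: "ac_primitive L v (\<lambda>x. p x * y x + g x)"
    using assms by (auto simp: sl_ode_def)
  show "ac_primitive L (\<lambda>x. y (L - x)) (\<lambda>x. - v (L - x))" by (rule ac_primitive_reflect[OF y])
  show "ac_primitive L (\<lambda>x. - v (L - x)) (\<lambda>x. p (L - x) * y (L - x) + g (L - x))"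
    using ac_primitive_uminus[OF ac_primitive_reflect[OF v]] by (simp add: algebra_simps)
qed

lemma sl_ode_cnj:
  assumes "sl_ode L p (\<lambda>x. 0) y v"
  shows "sl_ode L (\<lambda>x. cnj (p x)) (\<lambda>x. 0) (\<lambda>x. cnj (y x)) (\<lambda>x. cnj (v x))"
  unfolding sl_ode_def
proof
  have y: "ac_primitive L y v" and v: "ac_primitive L v (\<lambda>x. p x * y x)"
    using assms by (auto simp: sl_ode_def)
  show "ac_primitive L (\<lambda>x. cnj (y x)) (\<lambda>x. cnj (v x))" by (rule ac_primitive_cnj[OF y])
  show "ac_primitive L (\<lambda>x. cnj (v x)) (\<lambda>x. cnj (p x) * cnj (y x) + 0)"
    using ac_primitive_cnj[OF v] by simp
qed

text \<open>For real data the complex conjugate solves the same initial value problem.\<close>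

lemma sl_init_real:
  assumes "(\<lambda>x. complex_of_real (q x)) absolutely_integrable_on {0..L}" "x \<in> {0..L}"
    "ya \<in> \<real>" "va \<in> \<real>" "z \<in> \<real>"
  shows "sl_y L (\<lambda>x. complex_of_real (q x)) ya va z x \<in> \<real>"
    "sl_v L (\<lambda>x. complex_of_real (q x)) ya va z x \<in> \<real>"
proof -
  let ?q = "\<lambda>x. complex_of_real (q x)"
  have L: "0 \<le> L" using assms(2) by auto
  note S = sl_init[OF assms(1) L]
  have "cnj z = z" "cnj ya = ya" "cnj va = va" using assms by (auto simp: Reals_cnj_iff)
  then have "sl_ode L (\<lambda>x. ?q x - z) (\<lambda>x. 0) (\<lambda>x. cnj (sl_y L ?q ya va z x)) (\<lambda>x. cnj (sl_v L ?q ya va z x))"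
    and "cnj (sl_y L ?q ya va z 0) = ya" "cnj (sl_v L ?q ya va z 0) = va"
    using sl_ode_cnj[OF S(1)[where z = z and ya = ya and va = va]] by (auto simp: S)
  from sl_init_eqI[OF assms(1) this(1) assms(2)] this(2,3)
  show "sl_y L ?q ya va z x \<in> \<real>" "sl_v L ?q ya va z x \<in> \<real>"
    by (auto simp: Reals_cnj_iff)
qed

section \<open>Asymptotics of solutions\<close>

lemma ac_primitive_exp:
  "ac_primitive L (\<lambda>x. exp (c * of_real x)) (\<lambda>x. c * exp (c * of_real x))"
proof (rule ac_primitive_deriv)
  fix x
  have "((\<lambda>z. exp (c * z)) has_field_derivative c * exp (c * of_real x)) (at (of_real x))"
    by (auto intro!: derivative_eq_intros)
  then show "((\<lambda>x. exp (c * of_real x)) has_vector_derivative c * exp (c * of_real x)) (at x within {0..L})"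
    by (rule has_vector_derivative_real_field[THEN has_vector_derivative_at_within])
qed (intro continuous_intros)

text \<open>
  The combinations \<open>v \<plusminus> i rho y\<close> diagonalise the principal part of the system:
  each satisfies a first order equation with perturbation \<open>q y\<close>.
\<close>

lemma sl_ode_variation_of_constants:
  assumes ode: "sl_ode L (\<lambda>x. q x + c\<^sup>2) (\<lambda>x. 0) y v" and q: "q absolutely_integrable_on {0..L}"
    and x: "x \<in> {0..L}"
  shows "((\<lambda>t. exp (c * of_real (x - t)) * (q t * y t)) has_integral
    ((v x + c * y x) - exp (c * of_real x) * (v 0 + c * y 0))) {0..x}"
proof -
  have y: "ac_primitive L y v" and v: "ac_primitive L v (\<lambda>x. (q x + c\<^sup>2) * y x)"
    using ode by (auto simp: sl_ode_def)
  have "ac_primitive L (\<lambda>x. (v x + c * y x) * exp (- c * of_real x))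
     (\<lambda>x. ((q x + c\<^sup>2) * y x + c * v x) * exp (- c * of_real x)
        + - c * exp (- c * of_real x) * (v x + c * y x))"
    by (intro ac_primitive_mult ac_primitive_add ac_primitive_cmult y v ac_primitive_exp)
  then have "ac_primitive L (\<lambda>x. (v x + c * y x) * exp (- c * of_real x))
     (\<lambda>x. exp (- c * of_real x) * (q x * y x))"
    by (rule ac_primitive_cong) (auto simp: algebra_simps power2_eq_square)
  from has_integral_mult_right[OF ac_primitive_has_integral[OF this, of 0 x], of "exp (c * of_real x)"] x
  have "((\<lambda>t. exp (c * of_real x) * (exp (- c * of_real t) * (q t * y t))) has_integral
      exp (c * of_real x) * ((v x + c * y x) * exp (- c * of_real x) - (v 0 + c * y 0))) {0..x}"
    by simp
  moreover have "exp (c * of_real x) * (exp (- c * of_real t) * (q t * y t)) = exp (c * of_real (x - t)) * (q t * y t)" for t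
    by (simp add: exp_diff exp_minus algebra_simps divide_inverse)
  moreover have "exp (c * of_real x) * ((v x + c * y x) * exp (- c * of_real x) - (v 0 + c * y 0))
     = (v x + c * y x) - exp (c * of_real x) * (v 0 + c * y 0)"
    by (simp add: exp_minus algebra_simps)
  ultimately show ?thesis by (simp only:)
qed

text \<open>Variation of constants bounds the defect by exp(|Im rho| x) Q M, where \<open>M\<close>
  is the unknown maximum of exp(- |Im rho| x) |y x|. The two choices of \<open>c\<close> together
  give M |rho| \<le> N + Q M, and 2 Q \<le> |rho| absorbs the last term, so M \<le> 2 N /
  |rho|.\<close>

lemma sl_ode_exp_estimate:
  assumes q: "q absolutely_integrable_on {0..L}" and L: "0 \<le> L"
    and Q: "integral {0..L} (\<lambda>x. norm (q x)) \<le> Q" and rho: "2 * Q \<le> norm rho" "rho \<noteq> 0"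
    and ode: "sl_ode L (\<lambda>x. q x - rho\<^sup>2) (\<lambda>x. 0) y v" and x: "x \<in> {0..L}"
    and c: "c = \<i> * rho \<or> c = - (\<i> * rho)"
  shows "norm ((v x + c * y x) - exp (c * of_real x) * (v 0 + c * y 0))
    \<le> exp (\<bar>Im rho\<bar> * x) * (2 * Q * (norm (v 0) + norm rho * norm (y 0)) / norm rho)"
proof -
  define tau where "tau = \<bar>Im rho\<bar>"
  note cy = sl_ode_integrable(3)[OF ode] and cv = sl_ode_integrable(4)[OF ode]
  have "0 \<le> integral {0..L} (\<lambda>x. norm (q x))"
    using q by (intro integral_nonneg) (auto simp: absolutely_integrable_on_def)
  then have Q0: "0 \<le> Q" using Q by simp
  define N where "N = norm (v 0) + norm rho * norm (y 0)"
  have N0: "N \<ge> 0" by (simp add: N_def)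
  have "continuous_on {0..L} (\<lambda>x. exp (- tau * x) * norm (y x))" by (intro continuous_intros cy)
  then obtain s where s: "s \<in> {0..L}"
    "\<And>x. x \<in> {0..L} \<Longrightarrow> exp (- tau * x) * norm (y x) \<le> exp (- tau * s) * norm (y s)"
    using continuous_attains_sup[of "{0..L}" "\<lambda>x. exp (- tau * x) * norm (y x)"] L by auto
  define M where "M = exp (- tau * s) * norm (y s)"
  have M0: "M \<ge> 0" by (simp add: M_def)
  have yM: "norm (y x) \<le> exp (tau * x) * M" if "x \<in> {0..L}" for x
    using s(2)[OF that] by (simp add: M_def exp_minus field_simps)
  have est: "norm ((v x + c * y x) - exp (c * of_real x) * (v 0 + c * y 0)) \<le> exp (tau * x) * (Q * M)"
    if x: "x \<in> {0..L}" and c: "c = \<i> * rho \<or> c = - (\<i> * rho)" for x c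
  proof -
    have c2: "c\<^sup>2 = - rho\<^sup>2" using c by (auto simp: power_mult_distrib)
    have hi: "((\<lambda>t. exp (c * of_real (x - t)) * (q t * y t)) has_integral
       ((v x + c * y x) - exp (c * of_real x) * (v 0 + c * y 0))) {0..x}"
      by (rule sl_ode_variation_of_constants[OF _ q x]) (use ode in \<open>simp add: c2\<close>)
    have sub: "{0..x} \<subseteq> {0..L}" using x by auto
    have qi: "(\<lambda>t. norm (q t)) integrable_on {0..L}" using q by (simp add: absolutely_integrable_on_def)
    have qx: "(\<lambda>t. norm (q t)) integrable_on {0..x}" by (rule integrable_on_subinterval[OF qi sub])
    have "norm ((v x + c * y x) - exp (c * of_real x) * (v 0 + c * y 0))
       = norm (integral {0..x} (\<lambda>t. exp (c * of_real (x - t)) * (q t * y t)))"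
      by (simp only: integral_unique[OF hi])
    also have "\<dots> \<le> integral {0..x} (\<lambda>t. norm (q t) * (exp (tau * x) * M))"
    proof (rule integral_norm_bound_integral)
      show "(\<lambda>t. exp (c * of_real (x - t)) * (q t * y t)) integrable_on {0..x}" using hi by blast
      show "(\<lambda>t. norm (q t) * (exp (tau * x) * M)) integrable_on {0..x}"
        by (rule integrable_on_mult_left[OF qx])
      fix t assume t: "t \<in> {0..x}"
      have "Re c \<le> tau" using c by (auto simp: tau_def)
      then have "Re (c * of_real (x - t)) \<le> tau * (x - t)"
        using t mult_right_mono[of "Re c" tau "x - t"] by simp
      then have 1: "norm (exp (c * of_real (x - t))) \<le> exp (tau * (x - t))" by simp
      have 2: "norm (y t) \<le> exp (tau * t) * M" using yM[of t] t x by auto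
      have "norm (exp (c * of_real (x - t)) * (q t * y t))
        = norm (q t) * (norm (exp (c * of_real (x - t))) * norm (y t))" by (simp only: norm_mult mult_ac)
      also have "\<dots> \<le> norm (q t) * (exp (tau * (x - t)) * (exp (tau * t) * M))"
        by (intro mult_left_mono mult_mono 1 2) auto
      also have "exp (tau * (x - t)) * (exp (tau * t) * M) = exp (tau * x) * M"
        by (simp add: mult.assoc[symmetric] exp_add[symmetric] algebra_simps)
      finally show "norm (exp (c * of_real (x - t)) * (q t * y t)) \<le> norm (q t) * (exp (tau * x) * M)" .
    qed
    also have "\<dots> = integral {0..x} (\<lambda>t. norm (q t)) * (exp (tau * x) * M)" by simp
    also have "\<dots> \<le> Q * (exp (tau * x) * M)"
    proof (rule mult_right_mono)
      have "integral {0..x} (\<lambda>t. norm (q t)) \<le> integral {0..L} (\<lambda>t. norm (q t))"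
        by (rule integral_subset_le[OF sub qx qi]) auto
      then show "integral {0..x} (\<lambda>t. norm (q t)) \<le> Q" using Q by simp
    qed (use M0 in auto)
    finally show ?thesis by (simp add: mult_ac)
  qed
  have init: "norm (exp (c * of_real x) * (v 0 + c * y 0)) \<le> exp (tau * x) * N"
    if x: "x \<in> {0..L}" and c: "c = \<i> * rho \<or> c = - (\<i> * rho)" for x c
  proof -
    have "Re c \<le> tau" using c by (auto simp: tau_def)
    then have "Re (c * of_real x) \<le> tau * x" using x mult_right_mono[of "Re c" tau x] by simp
    then have "norm (exp (c * of_real x)) \<le> exp (tau * x)" by simp
    moreover have "norm (v 0 + c * y 0) \<le> N"
      unfolding N_def using c by (intro norm_triangle_le) (auto simp: norm_mult)
    ultimately show ?thesis by (simp add: norm_mult mult_mono)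
  qed
  \<comment> \<open>At the maximum point \<open>s\<close> the difference of the two combinations v +
    c y is 2 i rho y, so their separate bounds control y alone.\<close>
  have "M * norm rho \<le> N + Q * M"
  proof -
    let ?c = "\<i> * rho"
    have a: "norm (v s + c * y s) \<le> exp (tau * s) * (N + Q * M)"
      if c: "c = \<i> * rho \<or> c = - (\<i> * rho)" for c
    proof -
      have "norm (v s + c * y s) \<le> norm (exp (c * of_real s) * (v 0 + c * y 0))
          + norm ((v s + c * y s) - exp (c * of_real s) * (v 0 + c * y 0))"
        by (metis add.commute diff_add_cancel norm_triangle_ineq)
      with est[OF s(1) c] init[OF s(1) c] show ?thesis by (simp add: algebra_simps)
    qed
    have "2 * (norm rho * norm (y s)) = norm ((v s + ?c * y s) - (v s + - ?c * y s))"
      by (simp add: norm_mult[symmetric] del: norm_mult) (simp add: norm_mult)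
    also have "\<dots> \<le> norm (v s + ?c * y s) + norm (v s + - ?c * y s)" by (rule norm_triangle_ineq4)
    also have "\<dots> \<le> 2 * (exp (tau * s) * (N + Q * M))" using a[of ?c] a[of "- ?c"] by simp
    finally have "norm rho * norm (y s) \<le> exp (tau * s) * (N + Q * M)" by simp
    then have "exp (- tau * s) * (norm rho * norm (y s)) \<le> exp (- tau * s) * (exp (tau * s) * (N + Q * M))"
      by (intro mult_left_mono) auto
    moreover have "exp (- tau * s) * (exp (tau * s) * (N + Q * M)) = N + Q * M"
      by (simp only: mult.assoc[symmetric] exp_add[symmetric]) simp
    moreover have "exp (- tau * s) * (norm rho * norm (y s)) = M * norm rho"
      by (simp only: M_def mult_ac)
    ultimately show ?thesis by linarith
  qed
  moreover have "Q * M \<le> norm rho / 2 * M" using rho M0 by (intro mult_right_mono) auto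
  ultimately have "M * norm rho \<le> 2 * N" by (simp add: mult.commute)
  then have "Q * M \<le> 2 * Q * N / norm rho"
    using rho Q0 mult_left_mono[of "M * norm rho" "2 * N" Q] by (simp add: field_simps)
  then have "exp (tau * x) * (Q * M) \<le> exp (tau * x) * (2 * Q * N / norm rho)" by (intro mult_left_mono) auto
  with est[OF x c] show ?thesis unfolding tau_def N_def by linarith
qed

text \<open>Half the difference and half the sum of the two exponential estimates. The first line is
  for rho y and not for y, so that both lines share one error term.\<close>

lemma sl_ode_asymptotics:
  assumes q: "q absolutely_integrable_on {0..L}" and L: "0 \<le> L"
    and Q: "integral {0..L} (\<lambda>x. norm (q x)) \<le> Q" and rho: "2 * Q \<le> norm rho" "rho \<noteq> 0"
    and ode: "sl_ode L (\<lambda>x. q x - rho\<^sup>2) (\<lambda>x. 0) y v" and x: "x \<in> {0..L}"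
  defines "N \<equiv> norm (v 0) + norm rho * norm (y 0)"
  shows "norm (rho * y x - (rho * y 0 * cos (rho * of_real x) + v 0 * sin (rho * of_real x)))
      \<le> exp (\<bar>Im rho\<bar> * x) * (2 * Q * N / norm rho)" (is ?y)
    and "norm (v x - (v 0 * cos (rho * of_real x) - rho * y 0 * sin (rho * of_real x)))
      \<le> exp (\<bar>Im rho\<bar> * x) * (2 * Q * N / norm rho)" (is ?v)
proof -
  define B where "B = exp (\<bar>Im rho\<bar> * x) * (2 * Q * N / norm rho)"
  define w where "w = rho * complex_of_real x"
  have ew: "exp (\<i> * rho * of_real x) = cos w + \<i> * sin w" "exp (- (\<i> * rho) * of_real x) = cos w - \<i> * sin w"
    using exp_Euler[of w] exp_Euler[of "- w"] by (simp_all add: w_def mult.assoc)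
  define a where "a = (v x + \<i> * rho * y x) - (cos w + \<i> * sin w) * (v 0 + \<i> * rho * y 0)"
  define b where "b = (v x + - (\<i> * rho) * y x) - (cos w - \<i> * sin w) * (v 0 + - (\<i> * rho) * y 0)"
  have ab: "norm a \<le> B" "norm b \<le> B"
    using sl_ode_exp_estimate[OF q L Q rho ode x, of "\<i> * rho"] sl_ode_exp_estimate[OF q L Q rho ode x, of "- (\<i> * rho)"]
    unfolding a_def b_def B_def N_def ew[symmetric] by auto
  have "2 * \<i> * (rho * y x - (rho * y 0 * cos w + v 0 * sin w)) = a - b"
    unfolding a_def b_def by (simp add: algebra_simps)
  then have "norm (2 * \<i> * (rho * y x - (rho * y 0 * cos w + v 0 * sin w))) \<le> norm a + norm b"
    by (metis norm_triangle_ineq4)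
  then have "norm (rho * y x - (rho * y 0 * cos w + v 0 * sin w)) \<le> B" using ab by (simp add: norm_mult)
  then show ?y unfolding B_def w_def .
  have "2 * (v x - (v 0 * cos w - rho * y 0 * sin w)) = a + b"
    unfolding a_def b_def by (simp add: algebra_simps)
  then have "norm (2 * (v x - (v 0 * cos w - rho * y 0 * sin w))) \<le> norm a + norm b"
    by (metis norm_triangle_ineq)
  then have "norm (v x - (v 0 * cos w - rho * y 0 * sin w)) \<le> B"
    using ab unfolding norm_mult[of 2] by simp
  then show ?v unfolding B_def w_def .
qed

section \<open>Trigonometric lower bounds and entire functions\<close>

lemma norm_sin_cos_squared:
  fixes w :: complex
  shows "(norm (sin w))\<^sup>2 = (sin (Re w))\<^sup>2 + (sinh (Im w))\<^sup>2"
    "(norm (cos w))\<^sup>2 = (cos (Re w))\<^sup>2 + (sinh (Im w))\<^sup>2"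
proof -
  have c: "(exp (Im w) + inverse (exp (Im w))) / 2 = cosh (Im w)"
    "(exp (Im w) - inverse (exp (Im w))) / 2 = sinh (Im w)"
    by (simp_all add: cosh_def sinh_def exp_minus)
  have cs: "(cosh (Im w))\<^sup>2 = 1 + (sinh (Im w))\<^sup>2" by (simp add: cosh_square_eq)
  have r: "Re (sin w) = sin (Re w) * cosh (Im w)" "Im (sin w) = cos (Re w) * sinh (Im w)"
    "Re (cos w) = cos (Re w) * cosh (Im w)" "Im (cos w) = - sin (Re w) * sinh (Im w)"
    unfolding Re_sin Im_sin Re_cos Im_cos
    by (simp_all add: cosh_def sinh_def exp_minus field_simps)
  show "(norm (sin w))\<^sup>2 = (sin (Re w))\<^sup>2 + (sinh (Im w))\<^sup>2"
    "(norm (cos w))\<^sup>2 = (cos (Re w))\<^sup>2 + (sinh (Im w))\<^sup>2"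
    unfolding cmod_power2 r power_mult_distrib power2_minus cs sin_squared_eq
    by (simp_all add: algebra_simps)
qed

lemma norm_sin_cos_le:
  fixes w :: complex
  shows "norm (sin w) \<le> exp \<bar>Im w\<bar>" "norm (cos w) \<le> exp \<bar>Im w\<bar>"
proof -
  have e: "1 + (sinh (Im w))\<^sup>2 \<le> (exp \<bar>Im w\<bar>)\<^sup>2"
  proof -
    have "1 + (sinh (Im w))\<^sup>2 = (cosh \<bar>Im w\<bar>)\<^sup>2" by (simp add: cosh_square_eq)
    also have "cosh \<bar>Im w\<bar> \<le> exp \<bar>Im w\<bar>"
      unfolding cosh_def using exp_le_cancel_iff[of "- \<bar>Im w\<bar>" "\<bar>Im w\<bar>"] by (simp del: exp_le_cancel_iff)
    then have "(cosh \<bar>Im w\<bar>)\<^sup>2 \<le> (exp \<bar>Im w\<bar>)\<^sup>2" by (intro power_mono) auto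
    finally show ?thesis .
  qed
  have "(sin (Re w))\<^sup>2 \<le> 1" "(cos (Re w))\<^sup>2 \<le> 1" by (simp_all add: abs_square_le_1)
  then have "(norm (sin w))\<^sup>2 \<le> (exp \<bar>Im w\<bar>)\<^sup>2" "(norm (cos w))\<^sup>2 \<le> (exp \<bar>Im w\<bar>)\<^sup>2"
    unfolding norm_sin_cos_squared using e by linarith+
  then show "norm (sin w) \<le> exp \<bar>Im w\<bar>" "norm (cos w) \<le> exp \<bar>Im w\<bar>"
    by (auto elim: power2_le_imp_le)
qed

text \<open>If |Im w| \<ge> 1/2, the term sinh squared suffices, since sinh t \<ge> exp(t) / 4
  there. Otherwise the real part contributes 1/2, and exp(t) < 4 makes exp(t) / 8 at most 1/2. The
  constant 8 serves both cases.\<close>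

lemma norm_sin_cos_ge:
  fixes w :: complex
  assumes "((sin (Re w))\<^sup>2 = 1/2 \<and> (cos (Re w))\<^sup>2 = 1/2) \<or> 1/2 \<le> \<bar>Im w\<bar>"
  shows "exp \<bar>Im w\<bar> / 8 \<le> norm (sin w)" "exp \<bar>Im w\<bar> / 8 \<le> norm (cos w)"
proof -
  define t where "t = \<bar>Im w\<bar>"
  have sh: "(sinh (Im w))\<^sup>2 = (sinh t)\<^sup>2" by (simp add: t_def abs_if)
  have "(exp t / 8)\<^sup>2 \<le> (sin (Re w))\<^sup>2 + (sinh t)\<^sup>2 \<and> (exp t / 8)\<^sup>2 \<le> (cos (Re w))\<^sup>2 + (sinh t)\<^sup>2"
  proof (cases "1/2 \<le> t")
    case True
    have "2 \<le> exp (2 * t)" using exp_ge_add_one_self[of "2 * t"] True by linarith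
    then have "exp (-t) * 2 \<le> exp (-t) * exp (2 * t)" by (intro mult_left_mono) auto
    then have "exp (-t) * 2 \<le> exp t" by (simp add: exp_add[symmetric])
    then have "exp t / 8 \<le> sinh t" unfolding sinh_field_def using exp_gt_zero[of t] by (simp only: field_simps)
    then have "(exp t / 8)\<^sup>2 \<le> (sinh t)\<^sup>2" by (intro power_mono) auto
    then show ?thesis by (smt (verit) zero_le_power2)
  next
    case False
    then have sc: "(sin (Re w))\<^sup>2 = 1/2" "(cos (Re w))\<^sup>2 = 1/2" using assms by (auto simp: t_def)
    have "exp t \<le> exp 1" using False by simp
    also have "\<dots> < 4" using exp_le by simp
    finally have "(exp t / 8)\<^sup>2 \<le> (4/8)\<^sup>2" by (intro power_mono) auto
    then show ?thesis unfolding sc by (simp add: power2_eq_square add_increasing2)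
  qed
  then have "(exp t / 8)\<^sup>2 \<le> (norm (sin w))\<^sup>2" "(exp t / 8)\<^sup>2 \<le> (norm (cos w))\<^sup>2"
    unfolding norm_sin_cos_squared sh by auto
  then show "exp \<bar>Im w\<bar> / 8 \<le> norm (sin w)" "exp \<bar>Im w\<bar> / 8 \<le> norm (cos w)"
    unfolding t_def[symmetric] by (auto elim: power2_le_imp_le)
qed

text \<open>Lies in the plane of rho, not of \<lambda> = rho squared. On the vertical sides Re rho
  times pi/2 is an odd multiple of pi/4, midway between the zeros of sine and cosine; this keeps sin
  and cos of rho pi/2, and with them sin(rho pi), away from zero simultaneously.\<close>

definition square_contour :: "nat \<Rightarrow> complex set" where
  "square_contour n = frontier (cbox (Complex (- (n + 1/2)) (- (n + 1/2))) (Complex (n + 1/2) (n + 1/2)))"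

lemma square_contourD:
  assumes "rho \<in> square_contour n"
  shows "(\<bar>Re rho\<bar> = n + 1/2 \<and> \<bar>Im rho\<bar> \<le> n + 1/2) \<or> (\<bar>Im rho\<bar> = n + 1/2 \<and> \<bar>Re rho\<bar> \<le> n + 1/2)"
    and "n \<le> norm rho"
proof -
  let ?R = "real n + 1/2"
  have "rho \<in> cbox (Complex (- ?R) (- ?R)) (Complex ?R ?R) - box (Complex (- ?R) (- ?R)) (Complex ?R ?R)"
    using assms unfolding square_contour_def frontier_def interior_cbox by simp
  then show d: "(\<bar>Re rho\<bar> = ?R \<and> \<bar>Im rho\<bar> \<le> ?R) \<or> (\<bar>Im rho\<bar> = ?R \<and> \<bar>Re rho\<bar> \<le> ?R)"
    by (auto simp: in_cbox_complex_iff in_box_complex_iff)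
  then show "n \<le> norm rho" using abs_Re_le_cmod[of rho] abs_Im_le_cmod[of rho] by auto
qed

lemma sin_cos_half_odd_multiple:
  "(sin ((real n + 1/2) * (pi/2)))\<^sup>2 = 1/2 \<and> (cos ((real n + 1/2) * (pi/2)))\<^sup>2 = 1/2"
proof -
  let ?x = "(real n + 1/2) * (pi/2)"
  have e: "2 * ?x = pi * (real n) + pi / 2" by (simp add: algebra_simps)
  have "cos (2 * ?x) = 0" unfolding e cos_add by simp
  then show ?thesis using cos_double_cos[of ?x] sin_cos_squared_add[of ?x] by linarith
qed

lemma square_contour_sin_cos:
  assumes "rho \<in> square_contour n"
  shows "exp (\<bar>Im rho\<bar> * (pi/2)) / 8 \<le> norm (sin (rho * of_real (pi/2)))"
    "exp (\<bar>Im rho\<bar> * (pi/2)) / 8 \<le> norm (cos (rho * of_real (pi/2)))"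
proof -
  let ?w = "rho * complex_of_real (pi/2)"
  have im: "\<bar>Im ?w\<bar> = \<bar>Im rho\<bar> * (pi/2)" by (simp add: abs_mult)
  have "((sin (Re ?w))\<^sup>2 = 1/2 \<and> (cos (Re ?w))\<^sup>2 = 1/2) \<or> 1/2 \<le> \<bar>Im ?w\<bar>"
    using square_contourD(1)[OF assms]
  proof (elim disjE conjE)
    assume "\<bar>Re rho\<bar> = real n + 1/2"
    then have "Re rho = real n + 1/2 \<or> Re rho = - (real n + 1/2)" by linarith
    then show ?thesis
    proof
      assume "Re rho = real n + 1/2"
      then have "Re ?w = (real n + 1/2) * (pi/2)" by simp
      then show ?thesis using sin_cos_half_odd_multiple[of n] by metis
    next
      assume "Re rho = - (real n + 1/2)"
      then have "Re rho * (pi/2) = - ((real n + 1/2) * (pi/2))" by (simp only: mult_minus_left)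
      then have "Re ?w = - ((real n + 1/2) * (pi/2))" by simp
      then show ?thesis using sin_cos_half_odd_multiple[of n] by (metis cos_minus power2_minus sin_minus)
    qed
  next
    assume "\<bar>Im rho\<bar> = real n + 1/2"
    then have "1/2 * 1 \<le> \<bar>Im rho\<bar> * (pi/2)" using pi_ge_two by (intro mult_mono) auto
    then show ?thesis unfolding im by simp
  qed
  from norm_sin_cos_ge[OF this] show "exp (\<bar>Im rho\<bar> * (pi/2)) / 8 \<le> norm (sin ?w)"
    "exp (\<bar>Im rho\<bar> * (pi/2)) / 8 \<le> norm (cos ?w)" unfolding im by auto
qed

text \<open>The maximum principle is applied to rho \<mapsto> H(rho squared), so the images of the
  squares in the \<lambda>-plane never have to be described. A fixed square root \<open>w\<close> of
  z lies in all large squares, and the bound on their boundaries tends to zero.\<close>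

lemma entire_eq_0_of_square_contour_bound:
  assumes h: "H holomorphic_on UNIV"
    and bd: "\<And>n rho. n0 \<le> n \<Longrightarrow> rho \<in> square_contour n \<Longrightarrow> norm (H (rho\<^sup>2)) \<le> C / norm rho"
  shows "H z = 0"
proof -
  define w where "w = csqrt z"
  have w: "w\<^sup>2 = z" by (simp add: w_def)
  have "norm (H z) \<le> e" if e: "0 < e" for e
  proof -
    obtain n :: nat where n: "max (max (real n0) (norm w)) (max 1 (\<bar>C\<bar> / e)) < real n"
      using reals_Archimedean2 by blast
    let ?R = "real n + 1/2" let ?S = "cbox (Complex (- ?R) (- ?R)) (Complex ?R ?R)"
    have "norm (H (w\<^sup>2)) \<le> e"
    proof (rule maximum_modulus_frontier[of "\<lambda>rho. H (rho\<^sup>2)" ?S])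
      have hol: "(\<lambda>rho. H (rho\<^sup>2)) holomorphic_on UNIV"
        using holomorphic_on_compose_gen[OF _ h, of "\<lambda>rho. rho\<^sup>2" UNIV]
        by (simp add: o_def holomorphic_on_power)
      show "(\<lambda>rho. H (rho\<^sup>2)) holomorphic_on interior ?S" by (rule holomorphic_on_subset[OF hol]) simp
      show "continuous_on (closure ?S) (\<lambda>rho. H (rho\<^sup>2))"
        using holomorphic_on_imp_continuous_on[OF hol] continuous_on_subset by blast
      show "bounded ?S" by simp
      show "w \<in> ?S" using n abs_Re_le_cmod[of w] abs_Im_le_cmod[of w] by (auto simp: in_cbox_complex_iff)
      fix rho assume "rho \<in> frontier ?S"
      then have rho: "rho \<in> square_contour n" by (simp add: square_contour_def)
      have nrho: "real n \<le> norm rho" by (rule square_contourD(2)[OF rho])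
      have "norm (H (rho\<^sup>2)) \<le> C / norm rho" using bd[OF _ rho] n by simp
      also have "\<dots> \<le> \<bar>C\<bar> / norm rho" by (intro divide_right_mono) auto
      also have "\<dots> \<le> \<bar>C\<bar> / real n" using nrho n by (intro divide_left_mono mult_pos_pos) auto
      also have "\<dots> \<le> e"
      proof -
        have "\<bar>C\<bar> / e < real n" "0 < real n" using n by auto
        then show ?thesis using e by (simp add: field_simps)
      qed
      finally show "norm (H (rho\<^sup>2)) \<le> e" .
    qed
    then show ?thesis by (simp add: w)
  qed
  then have "norm (H z) \<le> 0" by (meson dense_ge)
  then show ?thesis by simp
qed

text \<open>A nonzero derivative isolates the zeros of \<open>X\<close>. At such a zero l'Hospital's
  rule gives the quotient the limit G' / X', so the singularity is removable.\<close>

lemma entire_quotient_simple_zeros: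
  assumes G: "G holomorphic_on UNIV" and X: "X holomorphic_on UNIV"
    and zero: "\<And>z. X z = 0 \<Longrightarrow> G z = 0" and simple: "\<And>z. X z = 0 \<Longrightarrow> deriv X z \<noteq> 0"
  obtains H where "H holomorphic_on UNIV" "\<And>z. G z = H z * X z"
proof -
  define H where "H z = (if X z = 0 then deriv G z / deriv X z else G z / X z)" for z
  have dG: "(G has_field_derivative deriv G z) (at z)" and dX: "(X has_field_derivative deriv X z) (at z)" for z
    using holomorphic_derivI[OF G] holomorphic_derivI[OF X] by auto
  have "H holomorphic_on ball z d \<and> d > 0" if d: "d > 0" "\<And>w. w \<in> ball z d \<Longrightarrow> w \<noteq> z \<Longrightarrow> X w \<noteq> 0" for z d
  proof -
    have hol: "H holomorphic_on ball z d - {z}"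
    proof (rule holomorphic_transform)
      show "(\<lambda>w. G w / X w) holomorphic_on ball z d - {z}"
        using d by (intro holomorphic_intros holomorphic_on_subset[OF G] holomorphic_on_subset[OF X]) auto
    qed (use d in \<open>auto simp: H_def\<close>)
    have lim: "(H \<longlongrightarrow> H z) (at z)"
    proof -
      have ev: "\<forall>\<^sub>F w in at z. G w / X w = H w"
        unfolding eventually_at using d by (intro exI[of _ d]) (auto simp: H_def dist_commute)
      have "((\<lambda>w. G w / X w) \<longlongrightarrow> H z) (at z)"
      proof (cases "X z = 0")
        case True
        show ?thesis using lhopital_complex_simple[OF dG dX] True zero simple by (simp add: H_def)
      next
        case False
        have "isCont G z" "isCont X z" using DERIV_isCont[OF dG] DERIV_isCont[OF dX] by auto
        then show ?thesis using False unfolding isCont_def by (auto simp: H_def intro!: tendsto_divide)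
      qed
      then show ?thesis by (rule Lim_transform_eventually[OF _ ev])
    qed
    have "continuous_on (ball z d) H"
    proof (rule continuous_at_imp_continuous_on, rule ballI)
      fix w assume w: "w \<in> ball z d"
      show "isCont H w"
      proof (cases "w = z")
        case False
        have "H field_differentiable at w"
          using hol w False by (intro holomorphic_on_imp_differentiable_at[of H "ball z d - {z}"]) auto
        then show ?thesis by (rule field_differentiable_imp_continuous_at)
      qed (use lim in \<open>simp add: isCont_def\<close>)
    qed
    then have "H holomorphic_on ball z d" by (rule no_isolated_singularity) (use hol in auto)
    with d show ?thesis by simp
  qed
  moreover have "\<exists>d>0. \<forall>w\<in>ball z d. w \<noteq> z \<longrightarrow> X w \<noteq> 0" for z
  proof (cases "X z = 0")
    case True
    have nc: "deriv X z \<noteq> 0" by (rule simple[OF True])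
    have "((\<lambda>w. (X w - X z) / (w - z)) \<longlongrightarrow> deriv X z) (at z)"
      using dX by (simp add: has_field_derivative_iff)
    from tendsto_imp_eventually_ne[OF this nc] obtain d where "d > 0"
      "\<And>w. w \<noteq> z \<Longrightarrow> dist w z < d \<Longrightarrow> (X w - X z) / (w - z) \<noteq> 0"
      unfolding eventually_at by auto
    then show ?thesis using True by (intro exI[of _ d]) (auto simp: dist_commute)
  next
    case False
    have "isCont X z" by (rule DERIV_isCont[OF dX])
    then have "\<forall>\<^sub>F w in at z. X w \<noteq> 0" using False tendsto_imp_eventually_ne unfolding isCont_def by blast
    then show ?thesis unfolding eventually_at by (auto simp: dist_commute)
  qed
  ultimately have "\<exists>d>0. H holomorphic_on ball z d" for z by meson
  then have "H field_differentiable at z" for z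
    using holomorphic_on_imp_differentiable_at[of H "ball z _" z] by fastforce
  then have "H holomorphic_on UNIV"
    unfolding holomorphic_on_def by (simp add: field_differentiable_at_within)
  moreover have "G z = H z * X z" for z using zero by (auto simp: H_def)
  ultimately show thesis by (rule that)
qed

section \<open>Boundary coefficients\<close>

lemma cpoly_add: "cpoly (p + r) z = cpoly p z + cpoly r z"
proof -
  have "map_poly complex_of_real (p + r) = map_poly complex_of_real p + map_poly complex_of_real r"
    by (rule poly_eqI) (simp add: coeff_map_poly)
  then show ?thesis by simp
qed

lemma cpoly_smult: "cpoly (smult a p) z = of_real a * cpoly p z"
  by (simp add: map_poly_smult)

lemma cpoly_mult: "cpoly (p * r) z = cpoly p z * cpoly r z"
proof (induction p)
  case (pCons a p)
  then show ?case by (simp add: cpoly_add cpoly_smult map_poly_pCons algebra_simps)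
qed simp

lemma cpoly_prod: "cpoly (\<Prod>k\<in>A. p k) z = (\<Prod>k\<in>A. cpoly (p k) z)"
  by (induction A rule: infinite_finite_induct) (simp_all add: cpoly_mult)

lemma cpoly_of_real: "cpoly p (of_real x) = of_real (poly p x)"
  by (induction p) (simp_all add: map_poly_pCons)

lemma cpoly_minus_one [simp]: "cpoly (- 1) z = - 1"
proof -
  have "smult (- 1) 1 = (- 1 :: real poly)" by (metis smult_1_left smult_minus_left)
  then show ?thesis using cpoly_smult[of "-1" 1 z] by simp
qed

lemma cpoly_has_field_derivative: "(cpoly p has_field_derivative cpoly (pderiv p) z) (at z)"
proof -
  have "pderiv (map_poly complex_of_real p) = map_poly complex_of_real (pderiv p)"
    by (rule poly_eqI) (simp add: coeff_map_poly coeff_pderiv)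
  then show ?thesis using poly_DERIV[of "map_poly complex_of_real p" z] by simp
qed

text \<open>The factor \<open>norm z\<close> on the left expresses an error of order |z|^(n-1)
  without a subtraction in the exponent, so n = 0 is included. Since \<open>n\<close> may exceed the
  degree, the leading coefficient may vanish.\<close>

lemma cpoly_leading_asymptotics:
  assumes "degree p \<le> n"
  shows "\<exists>K\<ge>0. \<forall>z. 1 \<le> norm z \<longrightarrow> norm (cpoly p z - of_real (coeff p n) * z ^ n) * norm z \<le> K * norm z ^ n"
proof (intro exI conjI allI impI)
  let ?K = "\<Sum>i<n. \<bar>coeff p i\<bar>"
  show "0 \<le> ?K" by (intro sum_nonneg) auto
  fix z :: complex assume z: "1 \<le> norm z"
  have "cpoly p z = (\<Sum>i\<le>n. coeff (map_poly complex_of_real p) i * z ^ i)"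
    unfolding poly_altdef
  proof (rule sum.mono_neutral_left)
    show "{..degree (map_poly complex_of_real p)} \<subseteq> {..n}"
      using degree_map_poly[of complex_of_real p] assms by auto
  qed (auto intro: coeff_eq_0)
  also have "\<dots> = (\<Sum>i<n. of_real (coeff p i) * z ^ i) + of_real (coeff p n) * z ^ n"
    by (simp add: coeff_map_poly lessThan_Suc_atMost[symmetric])
  finally have "norm (cpoly p z - of_real (coeff p n) * z ^ n) * norm z = norm (\<Sum>i<n. of_real (coeff p i) * z ^ i) * norm z"
    by simp
  also have "\<dots> \<le> (\<Sum>i<n. norm (complex_of_real (coeff p i) * z ^ i)) * norm z"
    by (intro mult_right_mono norm_sum) auto
  also have "\<dots> = (\<Sum>i<n. \<bar>coeff p i\<bar> * norm z ^ Suc i)"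
    by (simp add: sum_distrib_right sum_distrib_left norm_mult norm_power mult_ac)
  also have "\<dots> \<le> (\<Sum>i<n. \<bar>coeff p i\<bar> * norm z ^ n)"
    using z by (intro sum_mono mult_left_mono power_increasing) auto
  finally show "norm (cpoly p z - of_real (coeff p n) * z ^ n) * norm z \<le> ?K * norm z ^ n"
    by (simp add: sum_distrib_right)
qed

lemma cpoly_growth:
  assumes "degree p \<le> n"
  shows "\<exists>K\<ge>0. \<forall>z. 1 \<le> norm z \<longrightarrow> norm (cpoly p z) \<le> K * norm z ^ n"
proof -
  obtain K where K: "K \<ge> 0" "\<And>z. 1 \<le> norm z \<Longrightarrow> norm (cpoly p z - of_real (coeff p n) * z ^ n) * norm z \<le> K * norm z ^ n"
    using cpoly_leading_asymptotics[OF assms] by blast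
  have "norm (cpoly p z) \<le> (K + \<bar>coeff p n\<bar>) * norm z ^ n" if z: "1 \<le> norm z" for z
  proof -
    have "norm (cpoly p z - of_real (coeff p n) * z ^ n) \<le> norm (cpoly p z - of_real (coeff p n) * z ^ n) * norm z"
      using z mult_left_mono[of 1 "norm z" "norm (cpoly p z - of_real (coeff p n) * z ^ n)"] by simp
    then have "norm (cpoly p z - of_real (coeff p n) * z ^ n) \<le> K * norm z ^ n" using K(2)[OF z] by linarith
    moreover have "norm (cpoly p z) \<le> norm (cpoly p z - of_real (coeff p n) * z ^ n) + norm (complex_of_real (coeff p n) * z ^ n)"
      by (metis diff_add_cancel norm_triangle_ineq)
    moreover have "norm (complex_of_real (coeff p n) * z ^ n) = \<bar>coeff p n\<bar> * norm z ^ n"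
      by (simp add: norm_mult norm_power)
    ultimately show ?thesis by (simp add: algebra_simps)
  qed
  with K(1) show ?thesis by (intro exI[of _ "K + \<bar>coeff p n\<bar>"]) auto
qed

lemma prod_linear_poly:
  fixes a :: "nat \<Rightarrow> real"
  assumes "finite A"
  shows "degree (\<Prod>k\<in>A. [:a k, -1:]) = card A" "coeff (\<Prod>k\<in>A. [:a k, -1:]) (card A) = (-1) ^ card A"
proof -
  show d: "degree (\<Prod>k\<in>A. [:a k, -1:]) = card A"
    by (subst degree_prod_eq_sum_degree) auto
  have "lead_coeff (\<Prod>k\<in>A. [:a k, -1:]) = (-1) ^ card A" by (simp add: lead_coeff_prod)
  then show "coeff (\<Prod>k\<in>A. [:a k, -1:]) (card A) = (-1) ^ card A" by (simp add: d)
qed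

text \<open>
  The leading behaviour of the boundary coefficients at \<open>\<lambda> = rho\<^sup>2\<close>: asymptotically they are
  \<open>A\<close> times those of a Neumann condition (\<open>al = 1\<close>) or \<open>A rho\<close> times those of a Dirichlet
  condition (\<open>be = 1\<close>), where the size of \<open>A\<close> depends only on the index.
\<close>

definition bc_leading ::
  "boundary_coeff \<Rightarrow> complex \<Rightarrow> complex \<Rightarrow> real \<Rightarrow> (complex \<Rightarrow> complex) \<Rightarrow> bool" where
  "bc_leading f al be K A \<longleftrightarrow> (al, be) = (if even (bc_index f) then (1, 0) else (0, 1)) \<and> 0 \<le> K \<and>
    (\<forall>rho. 1 \<le> norm rho \<longrightarrow> norm (A rho) * norm rho = norm rho ^ nat (bc_index f + 1) \<and>
      norm (rho * cpoly (bc_down f) (rho\<^sup>2) - rho * A rho * al) \<le> K * norm (A rho) \<and>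
      norm (cpoly (bc_up f) (rho\<^sup>2) + rho * A rho * be) \<le> K * norm (A rho))"

text \<open>For h0 > 0 the polynomial \<open>bc_up\<close> has degree d + 1 and dominates, for h0 =
  0 it is \<open>bc_down\<close>, of degree d. The normalisation by \<open>leading_factor\<close>
  makes the dominating leading coefficient 1 or -1, so that |A| depends on the index alone.\<close>

lemma bc_leading_exists:
  assumes "f \<in> rational_class"
  shows "\<exists>al be K A. bc_leading f al be K A"
proof (cases f)
  case Infty
  \<comment> \<open>Here \<open>bc_up\<close> = -1 has to equal - rho A exactly, which forces A = 1
    / rho; the index -1 then matches |A| |rho| = 1.\<close>
  show ?thesis unfolding bc_leading_def
    by (rule exI[of _ 0], rule exI[of _ 1], rule exI[of _ "0::real"], rule exI[of _ "\<lambda>rho. 1 / rho"])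
      (auto simp: Infty norm_divide)
next
  case (Rational h0 h ps)
  then have h0: "h0 \<ge> 0" using assms by (auto simp: rational_class_def)
  define d where "d = length ps"
  define P where "P = (\<Prod>k<d. [:fst (ps ! k), -1:])"
  define S where "S = (\<Sum>k<d. smult (snd (ps ! k)) (\<Prod>j\<in>{..<d} - {k}. [:fst (ps ! j), -1:]))"
  define l where "l = leading_factor h0"
  have down: "bc_down f = smult l P" and up: "bc_up f = smult l ([:h, h0:] * P + S)"
    by (simp_all add: Rational d_def P_def S_def l_def)
  have P: "degree P = d" "coeff P d = (-1) ^ d"
    using prod_linear_poly[of "{..<d}" "\<lambda>k. fst (ps ! k)"] by (simp_all add: P_def)
  have S: "degree S \<le> d" unfolding S_def
  proof (rule degree_sum_le)
    fix k assume k: "k \<in> {..<d}"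
    have "degree (\<Prod>j\<in>{..<d} - {k}. [:fst (ps ! j), -1:]) \<le> d"
      using k prod_linear_poly(1)[of "{..<d} - {k}" "\<lambda>k. fst (ps ! k)"] by simp
    then show "degree (smult (snd (ps ! k)) (\<Prod>j\<in>{..<d} - {k}. [:fst (ps ! j), -1:])) \<le> d"
      using degree_smult_le order_trans by blast
  qed simp
  have dd: "degree (bc_down f) \<le> d" unfolding down using degree_smult_le[of l P] P by simp
  have sq: "1 \<le> norm (rho\<^sup>2)" if "1 \<le> norm rho" for rho :: complex using that by (simp add: norm_power)
  show ?thesis
  proof (cases "h0 > 0")
    case True
    have l: "l = 1 / h0" using True by (simp add: l_def leading_factor_def)
    have du1: "degree ([:h, h0:] * P) \<le> Suc d"
      using degree_mult_le[of "[:h, h0:]" P] P True by simp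
    have du: "degree (bc_up f) \<le> Suc d"
      unfolding up using S du1 degree_smult_le[of l "[:h, h0:] * P + S"] degree_add_le[of "[:h, h0:] * P" "Suc d" S]
      by simp
    have "coeff ([:h, h0:] * P) (degree [:h, h0:] + degree P) = lead_coeff [:h, h0:] * lead_coeff P"
      by (rule coeff_mult_degree_sum)
    then have "coeff ([:h, h0:] * P) (Suc d) = h0 * (-1) ^ d" using True P by simp
    moreover have "coeff S (Suc d) = 0" using S by (intro coeff_eq_0) simp
    ultimately have cu: "coeff (bc_up f) (Suc d) = (-1) ^ d" unfolding up using True by (simp add: l)
    obtain K1 where K1: "K1 \<ge> 0" "\<And>z. 1 \<le> norm z \<Longrightarrow> norm (cpoly (bc_down f) z) \<le> K1 * norm z ^ d"
      using cpoly_growth[OF dd] by blast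
    obtain K2 where K2: "K2 \<ge> 0" "\<And>z. 1 \<le> norm z \<Longrightarrow>
        norm (cpoly (bc_up f) z - of_real (coeff (bc_up f) (Suc d)) * z ^ Suc d) * norm z \<le> K2 * norm z ^ Suc d"
      using cpoly_leading_asymptotics[OF du] by blast
    \<comment> \<open>The extra sign comes from the convention that \<open>bc_up\<close> is close to
      - rho A, as the initial derivative of \<open>phi\<close> is minus
      \<open>bc_up\<close>.\<close>
    define A where "A rho = (-1) ^ Suc d * rho ^ (2 * d + 1)" for rho :: complex
    have nA: "norm (A rho) = norm rho ^ (2 * d + 1)" for rho by (simp add: A_def norm_mult norm_power)
    have main: "norm (A rho) * norm rho = norm rho ^ nat (bc_index f + 1) \<and>
      norm (rho * cpoly (bc_down f) (rho\<^sup>2) - rho * A rho * 0) \<le> (K1 + K2) * norm (A rho) \<and>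
      norm (cpoly (bc_up f) (rho\<^sup>2) + rho * A rho * 1) \<le> (K1 + K2) * norm (A rho)" if rho: "1 \<le> norm rho" for rho
    proof (intro conjI)
      have "nat (bc_index f + 1) = Suc (2 * d + 1)" using True by (simp add: Rational d_def)
      then show "norm (A rho) * norm rho = norm rho ^ nat (bc_index f + 1)" unfolding nA by simp
      have "norm (rho * cpoly (bc_down f) (rho\<^sup>2)) \<le> norm rho * (K1 * norm (rho\<^sup>2) ^ d)"
        unfolding norm_mult[of rho] by (intro mult_left_mono K1(2) sq rho) auto
      also have "\<dots> = K1 * norm (A rho)" unfolding nA by (simp add: norm_power power_mult[symmetric])
      also have "\<dots> \<le> (K1 + K2) * norm (A rho)" using K2(1) by (intro mult_right_mono) auto
      finally show "norm (rho * cpoly (bc_down f) (rho\<^sup>2) - rho * A rho * 0) \<le> (K1 + K2) * norm (A rho)" by simp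
      have e: "cpoly (bc_up f) (rho\<^sup>2) - of_real (coeff (bc_up f) (Suc d)) * (rho\<^sup>2) ^ Suc d = cpoly (bc_up f) (rho\<^sup>2) + rho * A rho * 1"
        unfolding cu A_def by (simp add: power_mult power2_eq_square)
      have "norm (cpoly (bc_up f) (rho\<^sup>2) + rho * A rho * 1) * norm (rho\<^sup>2) \<le> K2 * norm (rho\<^sup>2) ^ Suc d"
        using K2(2)[OF sq[OF rho]] unfolding e .
      also have "K2 * norm (rho\<^sup>2) ^ Suc d = (K2 * norm (rho\<^sup>2) ^ d) * norm (rho\<^sup>2)" by simp
      finally have "norm (cpoly (bc_up f) (rho\<^sup>2) + rho * A rho * 1) \<le> K2 * norm (rho\<^sup>2) ^ d"
        by (rule mult_right_le_imp_le) (use sq[OF rho] in linarith)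
      also have "norm (rho\<^sup>2) ^ d \<le> norm (A rho)"
        unfolding nA norm_power power_mult[symmetric] using rho by (intro power_increasing) auto
      finally have "norm (cpoly (bc_up f) (rho\<^sup>2) + rho * A rho * 1) \<le> K2 * norm (A rho)"
        using K2(1) by (simp add: mult_left_mono)
      also have "\<dots> \<le> (K1 + K2) * norm (A rho)" using K1(1) by (intro mult_right_mono) auto
      finally show "norm (cpoly (bc_up f) (rho\<^sup>2) + rho * A rho * 1) \<le> (K1 + K2) * norm (A rho)" .
    qed
    show ?thesis unfolding bc_leading_def
      by (rule exI[of _ 0], rule exI[of _ 1], rule exI[of _ "K1 + K2"], rule exI[of _ A])
        (use main K1(1) K2(1) in \<open>simp add: Rational True\<close>)
  next
    case False
    then have h00: "h0 = 0" using h0 by simp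
    have l: "l = 1" by (simp add: l_def leading_factor_def h00)
    have "degree ([:h, h0:] * P) \<le> d"
      using degree_mult_le[of "[:h, h0:]" P] P h00 by simp
    then have du: "degree (bc_up f) \<le> d"
      unfolding up using S degree_smult_le[of l "[:h, h0:] * P + S"] degree_add_le[of "[:h, h0:] * P" "d" S]
      by simp
    have cd: "coeff (bc_down f) d = (-1) ^ d" unfolding down using P by (simp add: l)
    obtain K1 where K1: "K1 \<ge> 0" "\<And>z. 1 \<le> norm z \<Longrightarrow> norm (cpoly (bc_up f) z) \<le> K1 * norm z ^ d"
      using cpoly_growth[OF du] by blast
    obtain K2 where K2: "K2 \<ge> 0" "\<And>z. 1 \<le> norm z \<Longrightarrow>
        norm (cpoly (bc_down f) z - of_real (coeff (bc_down f) d) * z ^ d) * norm z \<le> K2 * norm z ^ d"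
      using cpoly_leading_asymptotics[OF dd] by blast
    define A where "A rho = (-1) ^ d * rho ^ (2 * d)" for rho :: complex
    have nA: "norm (A rho) = norm (rho\<^sup>2) ^ d" for rho by (simp add: A_def norm_mult norm_power power_mult)
    have main: "norm (A rho) * norm rho = norm rho ^ nat (bc_index f + 1) \<and>
      norm (rho * cpoly (bc_down f) (rho\<^sup>2) - rho * A rho * 1) \<le> (K1 + K2) * norm (A rho) \<and>
      norm (cpoly (bc_up f) (rho\<^sup>2) + rho * A rho * 0) \<le> (K1 + K2) * norm (A rho)" if rho: "1 \<le> norm rho" for rho
    proof (intro conjI)
      have "nat (bc_index f + 1) = Suc (2 * d)" using False by (simp add: Rational d_def)
      then show "norm (A rho) * norm rho = norm rho ^ nat (bc_index f + 1)"
        unfolding nA by (simp add: norm_power power_mult)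
      have "norm (cpoly (bc_up f) (rho\<^sup>2)) \<le> K1 * norm (A rho)" unfolding nA by (intro K1(2) sq rho)
      also have "\<dots> \<le> (K1 + K2) * norm (A rho)" using K2(1) by (intro mult_right_mono) auto
      finally show "norm (cpoly (bc_up f) (rho\<^sup>2) + rho * A rho * 0) \<le> (K1 + K2) * norm (A rho)" by simp
      have e: "cpoly (bc_down f) (rho\<^sup>2) - of_real (coeff (bc_down f) d) * (rho\<^sup>2) ^ d = cpoly (bc_down f) (rho\<^sup>2) - A rho"
        unfolding cd A_def by (simp add: power_mult)
      have "rho * cpoly (bc_down f) (rho\<^sup>2) - rho * A rho * 1 = rho * (cpoly (bc_down f) (rho\<^sup>2) - A rho)"
        by (simp add: algebra_simps)
      then have "norm (rho * cpoly (bc_down f) (rho\<^sup>2) - rho * A rho * 1) = norm rho * norm (cpoly (bc_down f) (rho\<^sup>2) - A rho)"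
        by (simp only: norm_mult)
      also have "\<dots> \<le> norm (rho\<^sup>2) * norm (cpoly (bc_down f) (rho\<^sup>2) - A rho)"
        using rho by (intro mult_right_mono) (simp_all add: norm_power self_le_power)
      also have "\<dots> \<le> K2 * norm (A rho)"
        using K2(2)[OF sq[OF rho]] unfolding e nA by (simp only: mult.commute)
      also have "\<dots> \<le> (K1 + K2) * norm (A rho)" using K1(1) by (intro mult_right_mono) auto
      finally show "norm (rho * cpoly (bc_down f) (rho\<^sup>2) - rho * A rho * 1) \<le> (K1 + K2) * norm (A rho)" .
    qed
    show ?thesis unfolding bc_leading_def
      by (rule exI[of _ 1], rule exI[of _ 0], rule exI[of _ "K1 + K2"], rule exI[of _ A])
        (use main K1(1) K2(1) in \<open>simp add: Rational False\<close>)
  qed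
qed

section \<open>Common zeros and monotonicity of the boundary coefficients\<close>

lemma leading_factor_pos: "0 \<le> h0 \<Longrightarrow> 0 < leading_factor h0"
  by (simp add: leading_factor_def)

text \<open>A zero of \<open>bc_down\<close> is one of the poles h_k. There only the k-th summand of
  \<open>bc_up\<close> survives, with value \<delta>_k times the product of the h_j - h_k, up to the
  normalising factor; it is nonzero because the poles are distinct.\<close>

lemma bc_not_both_zero:
  assumes "f \<in> rational_class"
  shows "cpoly (bc_down f) z \<noteq> 0 \<or> cpoly (bc_up f) z \<noteq> 0"
proof (cases f)
  case Infty
  then show ?thesis by simp
next
  case (Rational h0 h ps)
  have h0: "h0 \<ge> 0" and pos: "\<And>k. k < length ps \<Longrightarrow> snd (ps ! k) > 0"
    and srt: "sorted_wrt (<) (map fst ps)"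
    using assms by (auto simp: rational_class_def Rational case_prod_unfold)
  note lf = leading_factor_pos[OF h0]
  have "cpoly (bc_up f) z \<noteq> 0" if "cpoly (bc_down f) z = 0"
  proof -
    have "(\<Prod>k<length ps. cpoly [:fst (ps ! k), -1:] z) = 0"
      using that lf by (simp add: Rational cpoly_smult cpoly_prod del: prod_zero_iff)
    then obtain k where k: "k < length ps" "z = of_real (fst (ps ! k))"
      by (auto simp: map_poly_pCons)
    let ?x = "fst (ps ! k)"
    have ne: "fst (ps ! j) \<noteq> ?x" if "j < length ps" "j \<noteq> k" for j
      using sorted_wrt_nth_less[OF srt, of j k] sorted_wrt_nth_less[OF srt, of k j] that k by fastforce
    have "(\<Sum>i<length ps. snd (ps ! i) * (\<Prod>j\<in>{..<length ps} - {i}. fst (ps ! j) - ?x))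
      = (\<Sum>i<length ps. if i = k then snd (ps ! k) * (\<Prod>j\<in>{..<length ps} - {k}. fst (ps ! j) - ?x) else 0)"
    proof (rule sum.cong)
      fix i assume "i \<in> {..<length ps}"
      show "snd (ps ! i) * (\<Prod>j\<in>{..<length ps} - {i}. fst (ps ! j) - ?x)
        = (if i = k then snd (ps ! k) * (\<Prod>j\<in>{..<length ps} - {k}. fst (ps ! j) - ?x) else 0)"
        using k by auto
    qed simp
    also have "\<dots> = snd (ps ! k) * (\<Prod>j\<in>{..<length ps} - {k}. fst (ps ! j) - ?x)"
      using k by simp
    also have "\<dots> \<noteq> 0" using pos[OF k(1)] ne by auto
    finally have "(\<Sum>i<length ps. snd (ps ! i) * (\<Prod>j\<in>{..<length ps} - {i}. fst (ps ! j) - ?x)) \<noteq> 0" .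
    moreover have "(\<Prod>i<length ps. fst (ps ! i) - ?x) = 0" using k by auto
    ultimately have "poly (bc_up f) ?x \<noteq> 0"
      using lf by (simp add: Rational poly_sum poly_prod del: prod_zero_iff)
    then show "cpoly (bc_up f) z \<noteq> 0" unfolding k(2) cpoly_of_real by simp
  qed
  then show ?thesis by blast
qed

text \<open>The Herglotz property in polynomial form. Away from the poles the expression is f' times
  the square of \<open>bc_down\<close>, with f' = h0 + sum of \<delta>_k / (h_k - x)^2 \<ge> 0. At
  the finitely many poles it follows by continuity.\<close>

lemma bc_wronskian_nonneg:
  assumes "f \<in> rational_class"
  shows "0 \<le> poly (pderiv (bc_up f)) x * poly (bc_down f) x - poly (bc_up f) x * poly (pderiv (bc_down f)) x"
proof (cases f)
  case (Rational h0 h ps)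
  have h0: "h0 \<ge> 0" and pos: "\<And>k. k < length ps \<Longrightarrow> snd (ps ! k) > 0"
    using assms by (auto simp: rational_class_def Rational case_prod_unfold)
  define W where "W x = poly (pderiv (bc_up f)) x * poly (bc_down f) x - poly (bc_up f) x * poly (pderiv (bc_down f)) x" for x
  have off: "0 \<le> W x" if x: "x \<notin> fst ` set ps" for x
  proof -
    let ?r = "rational_eval h0 h ps"
    define r' where "r' = h0 + (\<Sum>k<length ps. snd (ps ! k) / (fst (ps ! k) - x)\<^sup>2)"
    have nz: "fst (ps ! k) - x \<noteq> 0" if "k < length ps" for k
      using x that by (metis eq_iff_diff_eq_0 image_eqI nth_mem)
    have r: "(?r has_real_derivative r') (at x)"
      unfolding rational_eval_def[abs_def] r'_def using nz
      by (auto intro!: derivative_eq_intros sum.cong simp: power2_eq_square)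
    have r'0: "0 \<le> r'" unfolding r'_def using h0 pos by (intro add_nonneg_nonneg sum_nonneg) (auto simp: less_imp_le)
    have d: "((\<lambda>t. ?r t * poly (bc_down f) t) has_real_derivative
        (r' * poly (bc_down f) x + poly (pderiv (bc_down f)) x * ?r x)) (at x)"
      by (rule DERIV_mult[OF r poly_DERIV])
    have "open (- (fst ` set ps))" by (intro open_Compl finite_imp_closed) simp
    then have "(poly (bc_up f) has_real_derivative (r' * poly (bc_down f) x + poly (pderiv (bc_down f)) x * ?r x)) (at x)"
      using x by (intro has_field_derivative_transform_within_open[OF d]) (auto simp: Rational bc_up_eq simp del: bc_up.simps)
    then have "poly (pderiv (bc_up f)) x = r' * poly (bc_down f) x + poly (pderiv (bc_down f)) x * ?r x"
      using poly_DERIV DERIV_unique by blast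
    moreover have "poly (bc_up f) x = ?r x * poly (bc_down f) x" unfolding Rational by (rule bc_up_eq[OF x])
    ultimately have "W x = r' * (poly (bc_down f) x)\<^sup>2"
      unfolding W_def by (simp add: algebra_simps power2_eq_square)
    then show ?thesis using r'0 by simp
  qed
  have "0 \<le> W x"
  proof (rule ccontr)
    assume "\<not> 0 \<le> W x"
    moreover have "(W \<longlongrightarrow> W x) (at x)" unfolding W_def by (intro tendsto_intros)
    ultimately have "\<forall>\<^sub>F t in at x. W t < 0" by (intro order_tendstoD) auto
    moreover have "\<not> x islimpt fst ` set ps" by (intro islimpt_finite) simp
    then have "\<forall>\<^sub>F t in at x. t \<notin> fst ` set ps" by (simp add: islimpt_iff_eventually)
    ultimately have "\<forall>\<^sub>F t in at x. False" by eventually_elim (use off in force)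
    then show False by simp
  qed
  then show ?thesis by (simp add: W_def)
qed simp

section \<open>Eigenfunctions and the characteristic function\<close>

lemma AE_lebesgue_negligibleE:
  assumes "AE x in lebesgue. P x"
  obtains N where "negligible N" "\<And>x. x \<notin> N \<Longrightarrow> P x"
  using assms unfolding eventually_ae_filter by (auto simp: negligible_iff_null_sets)

lemma ac_primitive_AE:
  assumes F: "ac_primitive L F f" and ae: "AE x in lebesgue. x \<in> {0..L} \<longrightarrow> f x = g x"
  shows "ac_primitive L F g"
  unfolding ac_primitive_def
proof (intro conjI allI impI)
  obtain N where N: "negligible N" "\<And>x. x \<notin> N \<Longrightarrow> x \<in> {0..L} \<longrightarrow> f x = g x"
    using AE_lebesgue_negligibleE[OF ae] by blast
  show "g absolutely_integrable_on {0..L}"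
    by (rule absolutely_integrable_spike[OF ac_primitive_integrable[OF F] N(1)]) (use N in auto)
  fix s t :: real assume st: "0 \<le> s" "s \<le> t" "t \<le> L"
  show "(g has_integral (F t - F s)) {s..t}"
    by (rule has_integral_spike[OF N(1) _ ac_primitive_has_integral[OF F st]]) (use N st in auto)
qed

lemma of_real_absolutely_integrable:
  fixes q :: "real \<Rightarrow> real"
  shows "q absolutely_integrable_on A \<Longrightarrow> (\<lambda>x. complex_of_real (q x)) absolutely_integrable_on A"
  using absolutely_integrable_linear[OF _ bounded_linear_of_real] by (simp add: o_def)

text \<open>The given second derivative agrees with (q - z) y off a null set, and replacing it there
  changes no integral.\<close>

lemma sl_solution_imp_sl_ode:
  assumes "sl_solution q z y"
  shows "sl_ode pi (\<lambda>x. of_real (q x) - z) (\<lambda>x. 0) y (interval_deriv y)"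
proof -
  obtain y'' where y'': "y'' absolutely_integrable_on {0..pi}"
    "\<And>x. x \<in> {0..pi} \<Longrightarrow> interval_deriv y x = interval_deriv y 0 + integral {0..x} y''"
    "AE x in lebesgue. x \<in> {0..pi} \<longrightarrow> - y'' x + of_real (q x) * y x = z * y x"
    and d: "\<And>x. x \<in> {0..pi} \<Longrightarrow> (y has_vector_derivative interval_deriv y x) (at x within {0..pi})"
    using assms unfolding sl_solution_def by blast
  have v: "ac_primitive pi (interval_deriv y) y''"
    by (rule ac_primitiveI[OF y''(1)]) (rule y''(2), simp)
  have "AE x in lebesgue. x \<in> {0..pi} \<longrightarrow> y'' x = (of_real (q x) - z) * y x + 0"
    using y''(3) by eventually_elim (auto simp: algebra_simps eq_neg_iff_add_eq_0 add_eq_0_iff)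
  then have "ac_primitive pi (interval_deriv y) (\<lambda>x. (of_real (q x) - z) * y x + 0)"
    by (rule ac_primitive_AE[OF v])
  moreover have "ac_primitive pi y (interval_deriv y)"
    by (rule ac_primitive_deriv[OF d ac_primitive_continuous[OF v]])
  ultimately show ?thesis by (simp add: sl_ode_def)
qed

lemma ac_primitive_has_vector_derivative:
  assumes F: "ac_primitive L F f" and f: "continuous_on {0..L} f" and x: "x \<in> {0..L}"
  shows "(F has_vector_derivative f x) (at x within {0..L})"
proof -
  have "((\<lambda>t. F 0 + integral {0..t} f) has_vector_derivative (0 + f x)) (at x within {0..L})"
    by (intro has_vector_derivative_add has_vector_derivative_const integral_has_vector_derivative f x)
  then have "((\<lambda>t. F 0 + integral {0..t} f) has_vector_derivative f x) (at x within {0..L})" by simp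
  then show ?thesis
    by (rule has_vector_derivative_transform[OF x, rotated]) (use ac_primitive_eq[OF F, symmetric] in auto)
qed

text \<open>Since \<open>v\<close> is continuous, the integral relation for \<open>y\<close> may be
  differentiated at every point, end points included.\<close>

lemma sl_ode_imp_sl_solution:
  assumes ode: "sl_ode pi (\<lambda>x. of_real (q x) - z) (\<lambda>x. 0) y v"
  shows "sl_solution q z y" and "\<And>x. x \<in> {0..pi} \<Longrightarrow> interval_deriv y x = v x"
proof -
  have y: "ac_primitive pi y v" and v: "ac_primitive pi v (\<lambda>x. (of_real (q x) - z) * y x)"
    using ode by (auto simp: sl_ode_def)
  have d: "(y has_vector_derivative v x) (at x within {0..pi})" if "x \<in> {0..pi}" for x
    by (rule ac_primitive_has_vector_derivative[OF y ac_primitive_continuous[OF v] that])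
  show id: "interval_deriv y x = v x" if "x \<in> {0..pi}" for x
    unfolding interval_deriv_def
    by (rule vector_derivative_within_closed_interval[OF pi_gt_zero that d[OF that]])
  show "sl_solution q z y" unfolding sl_solution_def
  proof (intro conjI ballI exI[of _ "\<lambda>x. (of_real (q x) - z) * y x"])
    show "(y has_vector_derivative interval_deriv y x) (at x within {0..pi})" if "x \<in> {0..pi}" for x
      using d[OF that] id[OF that] by simp
    show "(\<lambda>x. (of_real (q x) - z) * y x) absolutely_integrable_on {0..pi}"
      by (rule ac_primitive_integrable[OF v])
    show "interval_deriv y x = interval_deriv y 0 + integral {0..x} (\<lambda>x. (of_real (q x) - z) * y x)"
      if "x \<in> {0..pi}" for x
      using ac_primitive_eq[OF v, of x] id[of x] id[of 0] that by simp
    show "AE x in lebesgue. x \<in> {0..pi} \<longrightarrow>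
        - ((of_real (q x) - z) * y x) + of_real (q x) * y x = z * y x"
      by (rule AE_I2) (simp add: algebra_simps)
  qed
qed

section \<open>The solution \<open>phi\<close>, its spectral derivative and the zeros of
  \<open>chi\<close>\<close>

definition phi :: "(real \<Rightarrow> real) \<Rightarrow> boundary_coeff \<Rightarrow> complex \<Rightarrow> real \<Rightarrow> complex" where
  "phi q f z = sl_y pi (\<lambda>x. of_real (q x)) (cpoly (bc_down f) z) (- cpoly (bc_up f) z) z"

definition dphi :: "(real \<Rightarrow> real) \<Rightarrow> boundary_coeff \<Rightarrow> complex \<Rightarrow> real \<Rightarrow> complex" where
  "dphi q f z = sl_v pi (\<lambda>x. of_real (q x)) (cpoly (bc_down f) z) (- cpoly (bc_up f) z) z"

definition chi :: "(real \<Rightarrow> real) \<Rightarrow> boundary_coeff \<Rightarrow> boundary_coeff \<Rightarrow> complex \<Rightarrow> complex" where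
  "chi q f F z = cpoly (bc_down F) z * dphi q f z pi - cpoly (bc_up F) z * phi q f z pi"

lemma phi_sl_ode:
  assumes "q absolutely_integrable_on {0..pi}"
  shows "sl_ode pi (\<lambda>x. of_real (q x) - z) (\<lambda>x. 0) (phi q f z) (dphi q f z)"
    "phi q f z 0 = cpoly (bc_down f) z" "dphi q f z 0 = - cpoly (bc_up f) z"
  unfolding phi_def dphi_def by (rule sl_init[OF of_real_absolutely_integrable[OF assms] pi_ge_zero])+

lemma phi_holomorphic:
  assumes q: "q absolutely_integrable_on {0..pi}" and x: "x \<in> {0..pi}"
  shows "(\<lambda>z. phi q f z x) holomorphic_on A" "(\<lambda>z. dphi q f z x) holomorphic_on A"
  unfolding phi_def dphi_def sl_init_lincomb[OF of_real_absolutely_integrable[OF q] x, of "cpoly p z" for p z]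
  by (intro holomorphic_intros sl_init_holomorphic of_real_absolutely_integrable q x)+

lemma chi_holomorphic:
  assumes "q absolutely_integrable_on {0..pi}"
  shows "chi q f F holomorphic_on A"
  unfolding chi_def[abs_def] by (intro holomorphic_intros phi_holomorphic assms) auto

lemma sl_ode_zero:
  assumes ode: "sl_ode L p (\<lambda>x. 0) y v" and y0: "\<And>x. x \<in> {0..L} \<Longrightarrow> y x = 0" and L: "0 < L"
  shows "v 0 = 0"
proof -
  have y: "ac_primitive L y v" and v: "ac_primitive L v (\<lambda>x. p x * y x)"
    using ode by (auto simp: sl_ode_def)
  have "ac_primitive L v (\<lambda>x. 0)" by (rule ac_primitive_cong[OF v]) (auto simp: y0)
  then have vc: "v x = v 0" if "x \<in> {0..L}" for x using ac_primitive_eq[of L v "\<lambda>x. 0" x] that by simp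
  have "ac_primitive L y (\<lambda>x. v 0)" by (rule ac_primitive_cong[OF y]) (rule refl, erule vc)
  from ac_primitive_eq[OF this, of L] L y0[of 0] y0[of L] show ?thesis by simp
qed

lemma chi_zero_imp_eigenvalue:
  assumes q: "q absolutely_integrable_on {0..pi}" and f: "f \<in> rational_class" and chi: "chi q f F z = 0"
  shows "z \<in> eigenvalues q f F"
proof -
  note P = phi_sl_ode[OF q, where z = z and f = f]
  note S = sl_ode_imp_sl_solution[OF P(1)]
  have "\<exists>x\<in>{0..pi}. phi q f z x \<noteq> 0"
  proof (rule ccontr)
    assume "\<not> ?thesis"
    then have z: "\<And>x. x \<in> {0..pi} \<Longrightarrow> phi q f z x = 0" by auto
    have "dphi q f z 0 = 0" by (rule sl_ode_zero[OF P(1) z pi_gt_zero])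
    moreover have "phi q f z 0 = 0" using z[of 0] by simp
    ultimately show False using bc_not_both_zero[OF f, of z] P by auto
  qed
  then have "is_eigenfunction q f F z (phi q f z)"
    unfolding is_eigenfunction_def using S P chi by (auto simp: chi_def)
  then show ?thesis by (auto simp: eigenvalues_def)
qed

text \<open>The condition at 0 is a single linear equation for the initial values, and nontrivial by
  \<open>bc_not_both_zero\<close>; its solutions are the multiples of the initial values of
  \<open>phi\<close>.\<close>

lemma eigenfunction_eq_phi:
  assumes q: "q absolutely_integrable_on {0..pi}" and f: "f \<in> rational_class"
    and ef: "is_eigenfunction q f F z y"
  obtains c where "c \<noteq> 0" "\<And>x. x \<in> {0..pi} \<Longrightarrow> y x = c * phi q f z x"
    "\<And>x. x \<in> {0..pi} \<Longrightarrow> interval_deriv y x = c * dphi q f z x"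
proof -
  have ode: "sl_ode pi (\<lambda>x. of_real (q x) - z) (\<lambda>x. 0) y (interval_deriv y)"
    using ef sl_solution_imp_sl_ode by (auto simp: is_eigenfunction_def)
  let ?a = "cpoly (bc_down f) z" and ?b = "cpoly (bc_up f) z"
  have bc: "?a * interval_deriv y 0 + ?b * y 0 = 0" using ef by (simp add: is_eigenfunction_def)
  have "\<exists>c. y 0 = c * ?a \<and> interval_deriv y 0 = c * (- ?b)"
  proof (cases "?a = 0")
    case True
    then have b: "?b \<noteq> 0" using bc_not_both_zero[OF f] by blast
    then show ?thesis using bc True by (intro exI[of _ "- interval_deriv y 0 / ?b"]) auto
  next
    case False
    then show ?thesis using bc
      by (intro exI[of _ "y 0 / ?a"]) (auto simp: field_simps add_eq_0_iff)
  qed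
  then obtain c where c: "y 0 = c * ?a" "interval_deriv y 0 = c * (- ?b)" by blast
  have "sl_ode pi (\<lambda>x. of_real (q x) - z) (\<lambda>x. 0) (\<lambda>x. c * phi q f z x) (\<lambda>x. c * dphi q f z x)"
    using sl_ode_lincomb[OF phi_sl_ode(1)[OF q, where z = z and f = f] phi_sl_ode(1)[OF q, where z = z and f = f], of c 0]
    by simp
  note u = sl_ode_unique[OF absolutely_integrable_diff_const[OF of_real_absolutely_integrable[OF q]] ode this]
  have 1: "y x = c * phi q f z x" "interval_deriv y x = c * dphi q f z x" if "x \<in> {0..pi}" for x
    using u[OF _ _ that] c phi_sl_ode[OF q] by auto
  moreover have "c \<noteq> 0" using ef 1 by (auto simp: is_eigenfunction_def)
  ultimately show thesis by (intro that)
qed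

text \<open>The initial values of \<open>phi\<close> move with z. By the Leibniz rule
  \<open>D\<close> is the sum of a homogeneous solution, whose initial values are the differentiated
  ones, and the z-derivatives of the two fundamental solutions, which start from zero.\<close>

lemma phi_spectral_derivative:
  assumes q: "q absolutely_integrable_on {0..pi}"
  obtains D D' where "sl_ode pi (\<lambda>x. of_real (q x) - z) (\<lambda>x. - phi q f z x) D D'"
    "D 0 = cpoly (pderiv (bc_down f)) z" "D' 0 = - cpoly (pderiv (bc_up f)) z"
    "\<And>x. x \<in> {0..pi} \<Longrightarrow> ((\<lambda>z. phi q f z x) has_field_derivative D x) (at z)"
    "\<And>x. x \<in> {0..pi} \<Longrightarrow> ((\<lambda>z. dphi q f z x) has_field_derivative D' x) (at z)"
proof -
  let ?q = "\<lambda>x. complex_of_real (q x)"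
  note Q = of_real_absolutely_integrable[OF q]
  note S = sl_init[OF Q pi_ge_zero]
  have "\<exists>D D'. sl_ode pi (\<lambda>x. ?q x - z) (\<lambda>x. - sl_y pi ?q ya va z x) D D' \<and> D 0 = 0 \<and> D' 0 = 0" for ya va
  proof (rule sl_ode_exists[OF absolutely_integrable_diff_const[OF Q] _ pi_ge_zero])
    have "(\<lambda>x. (-1) * sl_y pi ?q ya va z x) absolutely_integrable_on {0..pi}"
      by (intro set_integrable_mult_right impI sl_ode_integrable(1)[OF S(1)])
    then show "(\<lambda>x. - sl_y pi ?q ya va z x) absolutely_integrable_on {0..pi}" by simp
  qed
  then obtain C C' E E' where
    C: "sl_ode pi (\<lambda>x. ?q x - z) (\<lambda>x. - sl_y pi ?q 1 0 z x) C C'" "C 0 = 0" "C' 0 = 0" and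
    E: "sl_ode pi (\<lambda>x. ?q x - z) (\<lambda>x. - sl_y pi ?q 0 1 z x) E E'" "E 0 = 0" "E' 0 = 0" by metis
  note dC = sl_ode_spectral_derivative[OF Q pi_ge_zero S(1) S(2) S(3) C]
  note dE = sl_ode_spectral_derivative[OF Q pi_ge_zero S(1) S(2) S(3) E]
  let ?a = "cpoly (bc_down f) z" and ?b = "- cpoly (bc_up f) z"
  let ?a' = "cpoly (pderiv (bc_down f)) z" and ?b' = "- cpoly (pderiv (bc_up f)) z"
  define D where "D x = (?a' * sl_y pi ?q 1 0 z x + ?b' * sl_y pi ?q 0 1 z x) + (?a * C x + ?b * E x)" for x
  define D' where "D' x = (?a' * sl_v pi ?q 1 0 z x + ?b' * sl_v pi ?q 0 1 z x) + (?a * C' x + ?b * E' x)" for x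
  have lc: "phi q f z x = ?a * sl_y pi ?q 1 0 z x + ?b * sl_y pi ?q 0 1 z x" if "x \<in> {0..pi}" for x
    unfolding phi_def by (rule sl_init_lincomb[OF Q that])
  have "sl_ode pi (\<lambda>x. ?q x - z) (\<lambda>x. 1 * (?a' * 0 + ?b' * 0) + 1 * (?a * (- sl_y pi ?q 1 0 z x) + ?b * (- sl_y pi ?q 0 1 z x)))
    (\<lambda>x. 1 * (?a' * sl_y pi ?q 1 0 z x + ?b' * sl_y pi ?q 0 1 z x) + 1 * (?a * C x + ?b * E x))
    (\<lambda>x. 1 * (?a' * sl_v pi ?q 1 0 z x + ?b' * sl_v pi ?q 0 1 z x) + 1 * (?a * C' x + ?b * E' x))"
    by (intro sl_ode_lincomb S C E)
  then have "sl_ode pi (\<lambda>x. ?q x - z) (\<lambda>x. - phi q f z x) D D'"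
    by (rule sl_ode_cong) (simp_all add: D_def D'_def lc algebra_simps)
  moreover have "D 0 = ?a'" "D' 0 = ?b'" unfolding D_def D'_def using C E by (simp_all add: S)
  moreover have "((\<lambda>z. phi q f z x) has_field_derivative D x) (at z)"
    "((\<lambda>z. dphi q f z x) has_field_derivative D' x) (at z)" if x: "x \<in> {0..pi}" for x
  proof -
    have e: "(\<lambda>z. phi q f z x) = (\<lambda>z. cpoly (bc_down f) z * sl_y pi ?q 1 0 z x + (- cpoly (bc_up f) z) * sl_y pi ?q 0 1 z x)"
      "(\<lambda>z. dphi q f z x) = (\<lambda>z. cpoly (bc_down f) z * sl_v pi ?q 1 0 z x + (- cpoly (bc_up f) z) * sl_v pi ?q 0 1 z x)"
      unfolding phi_def dphi_def by (rule ext, rule sl_init_lincomb[OF Q x])+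
    show "((\<lambda>z. phi q f z x) has_field_derivative D x) (at z)"
      unfolding e D_def
      by (rule DERIV_cong[OF DERIV_add[OF DERIV_mult[OF cpoly_has_field_derivative dC(1)[OF x]]
          DERIV_mult[OF DERIV_minus[OF cpoly_has_field_derivative] dE(1)[OF x]]]]) (simp add: algebra_simps)
    show "((\<lambda>z. dphi q f z x) has_field_derivative D' x) (at z)"
      unfolding e D'_def
      by (rule DERIV_cong[OF DERIV_add[OF DERIV_mult[OF cpoly_has_field_derivative dC(2)[OF x]]
          DERIV_mult[OF DERIV_minus[OF cpoly_has_field_derivative] dE(2)[OF x]]]]) (simp add: algebra_simps)
  qed
  ultimately show thesis by (intro that)
qed

lemma phi_real:
  assumes q: "q absolutely_integrable_on {0..pi}" and x: "x \<in> {0..pi}"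
  shows "phi q f (of_real r) x \<in> \<real>" "dphi q f (of_real r) x \<in> \<real>"
  unfolding phi_def dphi_def
  by (rule sl_init_real[OF of_real_absolutely_integrable[OF q] x]; simp add: cpoly_of_real)+

text \<open>
  At an eigenvalue \<open>\<phi>\<close> satisfies the boundary condition at \<open>\<pi>\<close>, say with factor \<open>k\<close>; the Lagrange
  identity for \<open>\<phi>\<close> and its \<open>\<lambda>\<close>-derivative gives \<open>- k \<chi>'\<close> as the sum of \<open>\<integral> \<phi>\<^sup>2\<close> and two
  boundary terms which are nonnegative because \<open>f\<close> and \<open>F\<close> are Herglotz functions.
\<close>

lemma chi_simple_zero:
  assumes q: "q absolutely_integrable_on {0..pi}" and f: "f \<in> rational_class" and F: "F \<in> rational_class"
    and chi: "chi q f F (of_real r) = 0"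
  shows "deriv (chi q f F) (of_real r) \<noteq> 0"
proof
  define z where "z = complex_of_real r"
  assume der: "deriv (chi q f F) (of_real r) = 0"
  obtain D D' where D: "sl_ode pi (\<lambda>x. of_real (q x) - z) (\<lambda>x. - phi q f z x) D D'"
    "D 0 = cpoly (pderiv (bc_down f)) z" "D' 0 = - cpoly (pderiv (bc_up f)) z"
    "\<And>x. x \<in> {0..pi} \<Longrightarrow> ((\<lambda>z. phi q f z x) has_field_derivative D x) (at z)"
    "\<And>x. x \<in> {0..pi} \<Longrightarrow> ((\<lambda>z. dphi q f z x) has_field_derivative D' x) (at z)"
    by (rule phi_spectral_derivative[OF q, where z = z and f = f]) (rule that)
  note P = phi_sl_ode[OF q, where z = z and f = f]
  let ?u = "phi q f z" and ?u' = "dphi q f z"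
  have pp: "pi \<in> {0..pi}" by simp
  have "(chi q f F has_field_derivative
     (cpoly (pderiv (bc_down F)) z * ?u' pi + cpoly (bc_down F) z * D' pi
      - (cpoly (pderiv (bc_up F)) z * ?u pi + cpoly (bc_up F) z * D pi))) (at z)"
    unfolding chi_def[abs_def]
    by (rule DERIV_cong[OF DERIV_diff[OF DERIV_mult[OF cpoly_has_field_derivative D(5)[OF pp]]
        DERIV_mult[OF cpoly_has_field_derivative D(4)[OF pp]]]]) (simp add: algebra_simps)
  from DERIV_imp_deriv[OF this] der
  have d0: "cpoly (pderiv (bc_down F)) z * ?u' pi + cpoly (bc_down F) z * D' pi
      - (cpoly (pderiv (bc_up F)) z * ?u pi + cpoly (bc_up F) z * D pi) = 0" by (simp add: z_def)
  have "?u pi \<in> \<real>" "?u' pi \<in> \<real>" unfolding z_def by (intro phi_real[OF q]; simp)+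
  then obtain a b where ab: "?u pi = of_real a" "?u' pi = of_real b" by (auto elim!: Reals_cases)
  let ?d = "poly (bc_down F) r" and ?e = "poly (bc_up F) r"
  have bc: "?d * b = ?e * a"
  proof -
    have "complex_of_real (?d * b - ?e * a) = 0"
      using chi unfolding chi_def z_def[symmetric] ab by (simp add: z_def cpoly_of_real)
    then show ?thesis by (simp only: of_real_eq_0_iff)
  qed
  have de: "?d \<noteq> 0 \<or> ?e \<noteq> 0" using bc_not_both_zero[OF F, of "of_real r"] by (simp add: cpoly_of_real)
  have "\<exists>k. a = k * ?d \<and> b = k * ?e"
  proof (cases "?d = 0")
    case True then show ?thesis using bc de by (intro exI[of _ "b / ?e"]) auto
  next
    case False then show ?thesis using bc by (intro exI[of _ "a / ?d"]) (auto simp: field_simps)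
  qed
  then obtain k where k: "a = k * ?d" "b = k * ?e" by blast
  have ru: "?u x = of_real (Re (?u x))" if "x \<in> {0..pi}" for x
    using phi_real(1)[OF q that, of f r] by (simp add: z_def complex_is_Real_iff complex_eq_iff)
  have sq: "complex_of_real ((Re (?u x))\<^sup>2) = (?u x)\<^sup>2" if "x \<in> {0..pi}" for x
    by (metis of_real_power ru that)
  note W = ac_primitive_has_integral[OF sl_ode_wronskian_inhomogeneous[OF P(1) D(1)], of 0 pi]
  define I where "I = integral {0..pi} (\<lambda>x. (Re (?u x))\<^sup>2)"
  have cu: "continuous_on {0..pi} (\<lambda>x. (Re (?u x))\<^sup>2)"
    by (intro continuous_intros sl_ode_integrable(3)[OF P(1)])
  have hI: "((\<lambda>x. (Re (?u x))\<^sup>2) has_integral I) {0..pi}"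
    unfolding I_def by (intro integrable_integral integrable_continuous_real cu)
  have "((\<lambda>x. complex_of_real ((Re (?u x))\<^sup>2)) has_integral complex_of_real I) {0..pi}"
    using has_integral_linear[OF hI bounded_linear_of_real] by (simp add: o_def)
  from has_integral_neg[OF this]
  have "((\<lambda>x. - complex_of_real ((Re (?u x))\<^sup>2)) has_integral - complex_of_real I) {0..pi}" .
  then have "((\<lambda>x. ?u x * - ?u x) has_integral - complex_of_real I) {0..pi}"
    by (rule has_integral_eq[rotated]) (simp only: sq, simp add: power2_eq_square)
  then have WI: "?u pi * D' pi - ?u' pi * D pi - (?u 0 * D' 0 - ?u' 0 * D 0) = - complex_of_real I"
    by (rule has_integral_unique[OF W, rotated -1]) simp_all
  have "of_real k * (cpoly (pderiv (bc_down F)) z * ?u' pi - cpoly (pderiv (bc_up F)) z * ?u pi)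
      + (?u pi * D' pi - ?u' pi * D pi) = 0"
  proof -
    have "?u pi = of_real k * cpoly (bc_down F) z" "?u' pi = of_real k * cpoly (bc_up F) z"
      unfolding ab k by (simp_all add: z_def cpoly_of_real)
    then have "of_real k * (cpoly (pderiv (bc_down F)) z * ?u' pi - cpoly (pderiv (bc_up F)) z * ?u pi)
      + (?u pi * D' pi - ?u' pi * D pi) = of_real k * (cpoly (pderiv (bc_down F)) z * ?u' pi + cpoly (bc_down F) z * D' pi
      - (cpoly (pderiv (bc_up F)) z * ?u pi + cpoly (bc_up F) z * D pi))"
      by (simp add: algebra_simps)
    then show ?thesis unfolding d0 by simp
  qed
  moreover have "?u pi * D' pi - ?u' pi * D pi = (?u 0 * D' 0 - ?u' 0 * D 0) - complex_of_real I"
    using WI by (simp add: algebra_simps)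
  ultimately have "of_real k * (cpoly (pderiv (bc_down F)) z * ?u' pi - cpoly (pderiv (bc_up F)) z * ?u pi)
      + ((?u 0 * D' 0 - ?u' 0 * D 0) - complex_of_real I) = 0" by simp
  then have "complex_of_real (k * (poly (pderiv (bc_down F)) r * b - poly (pderiv (bc_up F)) r * a)
      + ((- (poly (bc_down f) r * poly (pderiv (bc_up f)) r) + poly (bc_up f) r * poly (pderiv (bc_down f)) r) - I)) = 0"
    unfolding ab P(2,3) D(2,3) unfolding z_def cpoly_of_real by simp
  then have "k * (poly (pderiv (bc_down F)) r * b - poly (pderiv (bc_up F)) r * a)
      + ((- (poly (bc_down f) r * poly (pderiv (bc_up f)) r) + poly (bc_up f) r * poly (pderiv (bc_down f)) r) - I) = 0"
    by (simp only: of_real_eq_0_iff)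
  then have "k\<^sup>2 * (poly (pderiv (bc_up F)) r * ?d - ?e * poly (pderiv (bc_down F)) r)
     + (poly (pderiv (bc_up f)) r * poly (bc_down f) r - poly (bc_up f) r * poly (pderiv (bc_down f)) r) + I = 0"
    unfolding k by (simp add: algebra_simps power2_eq_square)
  moreover have "0 \<le> k\<^sup>2 * (poly (pderiv (bc_up F)) r * ?d - ?e * poly (pderiv (bc_down F)) r)"
    by (intro mult_nonneg_nonneg bc_wronskian_nonneg F) simp
  moreover have "0 \<le> I" unfolding I_def
    by (intro integral_nonneg integrable_continuous_real cu) simp
  ultimately have "I = 0" using bc_wronskian_nonneg[OF f, of r] by linarith
  then have "\<forall>x\<in>cbox 0 pi. (Re (?u x))\<^sup>2 = 0"
    using has_integral_0_cbox_imp_0[of 0 pi "\<lambda>x. (Re (?u x))\<^sup>2"] cu hI pi_gt_zero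
    by (auto simp: cbox_interval simp flip: not_less)
  then have u0: "?u x = 0" if "x \<in> {0..pi}" for x using ru[OF that] that by (simp add: cbox_interval)
  have "?u' 0 = 0" by (rule sl_ode_zero[OF P(1) u0 pi_gt_zero])
  moreover have "?u 0 = 0" using u0[of 0] by simp
  ultimately show False using bc_not_both_zero[OF f, of z] P by auto
qed

section \<open>Equality of the Weyl functions at the midpoint\<close>

lemma norm_mult_diff_le:
  fixes X Y a b :: complex
  assumes "norm (X - a) \<le> \<epsilon>" "norm (Y - b) \<le> \<delta>" "norm a \<le> ya" "norm b \<le> va"
  shows "norm (X * Y - a * b) \<le> ya * \<delta> + \<epsilon> * va + \<epsilon> * \<delta>"
proof -
  have nn: "0 \<le> \<epsilon>" "0 \<le> \<delta>" "0 \<le> ya" "0 \<le> va" using assms norm_ge_zero order_trans by blast+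
  have "X * Y - a * b = a * (Y - b) + (X - a) * b + (X - a) * (Y - b)" by (simp add: algebra_simps)
  also have "norm \<dots> \<le> norm (a * (Y - b)) + norm ((X - a) * b) + norm ((X - a) * (Y - b))"
    by (intro norm_triangle_le add_mono norm_triangle_ineq order_refl)
  also have "\<dots> \<le> ya * \<delta> + \<epsilon> * va + \<epsilon> * \<delta>"
    unfolding norm_mult using assms nn by (intro add_mono mult_mono) auto
  finally show ?thesis .
qed

text \<open>The solution of y'' + rho^2 y = 0 with y(0) = al and y'(0) = rho be. Its derivative is
  rho times \<open>lead_T be (- al)\<close>, which is why the second argument pattern keeps
  recurring.\<close>

definition lead_T :: "complex \<Rightarrow> complex \<Rightarrow> complex \<Rightarrow> real \<Rightarrow> complex" where
  "lead_T al be rho x = al * cos (rho * of_real x) + be * sin (rho * of_real x)"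

lemma norm_sin_cos_scaled_le:
  assumes "0 \<le> x"
  shows "norm (sin (rho * of_real x)) \<le> exp (\<bar>Im rho\<bar> * x)" "norm (cos (rho * of_real x)) \<le> exp (\<bar>Im rho\<bar> * x)"
  using norm_sin_cos_le[of "rho * of_real x"] assms by (simp_all add: abs_mult)

lemma norm_lead_T_le:
  assumes "(al, be) = (if even k then (1, 0) else (0, 1))" "0 \<le> x"
  shows "norm (lead_T al be rho x) \<le> exp (\<bar>Im rho\<bar> * x)" "norm (lead_T be (- al) rho x) \<le> exp (\<bar>Im rho\<bar> * x)"
  using assms norm_sin_cos_scaled_le[of x rho] by (auto simp: lead_T_def split: if_splits)

text \<open>\<open>A\<close>, \<open>al\<close> and \<open>be\<close> come from the boundary
  coefficient, so two potentials share the main terms and differ only in \<open>M\<close> and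
  \<open>R\<close>. The factor rho before \<open>phi\<close> puts both components on the same scale,
  with errors one power of rho below the main term.\<close>

definition phi_asymptotic ::
  "(real \<Rightarrow> real) \<Rightarrow> boundary_coeff \<Rightarrow> complex \<Rightarrow> complex \<Rightarrow> (complex \<Rightarrow> complex) \<Rightarrow> real \<Rightarrow> real \<Rightarrow> bool" where
  "phi_asymptotic q f al be A M R \<longleftrightarrow> 0 \<le> M \<and> 1 \<le> R \<and> (\<forall>rho x. R \<le> norm rho \<longrightarrow> x \<in> {0..pi} \<longrightarrow>
    norm (rho * phi q f (rho\<^sup>2) x - rho * A rho * lead_T al be rho x) \<le> exp (\<bar>Im rho\<bar> * x) * (M * norm (A rho)) \<and>
    norm (dphi q f (rho\<^sup>2) x - rho * A rho * lead_T be (- al) rho x) \<le> exp (\<bar>Im rho\<bar> * x) * (M * norm (A rho)))"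

lemma phi_asymptoticD:
  assumes "phi_asymptotic q f al be A M R"
  shows "0 \<le> M" "1 \<le> R" and "\<And>rho x. R \<le> norm rho \<Longrightarrow> x \<in> {0..pi} \<Longrightarrow>
    norm (rho * phi q f (rho\<^sup>2) x - rho * A rho * lead_T al be rho x) \<le> exp (\<bar>Im rho\<bar> * x) * (M * norm (A rho)) \<and>
    norm (dphi q f (rho\<^sup>2) x - rho * A rho * lead_T be (- al) rho x) \<le> exp (\<bar>Im rho\<bar> * x) * (M * norm (A rho))"
  using assms unfolding phi_asymptotic_def by blast+

lemma phi_asymptotics:
  assumes q: "q absolutely_integrable_on {0..pi}" and bl: "bc_leading f al be K A"
  shows "\<exists>M R. phi_asymptotic q f al be A M R"
proof -
  let ?q = "\<lambda>x. complex_of_real (q x)"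
  note Q = of_real_absolutely_integrable[OF q]
  define I where "I = integral {0..pi} (\<lambda>x. norm (?q x))"
  have I0: "0 \<le> I" unfolding I_def
    using Q by (intro integral_nonneg) (auto simp: absolutely_integrable_on_def)
  have K: "0 \<le> K" and ab: "(al, be) = (if even (bc_index f) then (1, 0) else (0, 1))"
    using bl by (auto simp: bc_leading_def)
  \<comment> \<open>The first summand bounds the influence of the potential, 2 I N / |rho| with N
    \<le> 2 (1 + K) |rho| |A|; the second collects the errors of the two boundary
    coefficients.\<close>
  define M where "M = 4 * I * (1 + K) + 2 * K"
  have main: "norm (rho * phi q f (rho\<^sup>2) x - rho * A rho * lead_T al be rho x) \<le> exp (\<bar>Im rho\<bar> * x) * (M * norm (A rho)) \<and>
    norm (dphi q f (rho\<^sup>2) x - rho * A rho * lead_T be (- al) rho x) \<le> exp (\<bar>Im rho\<bar> * x) * (M * norm (A rho))"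
    if rho: "max 1 (2 * I) \<le> norm rho" and x: "x \<in> {0..pi}" for rho x
  proof -
    have rho1: "1 \<le> norm rho" and rho2: "2 * I \<le> norm rho" and rho0: "rho \<noteq> 0" using rho by auto
    let ?d = "cpoly (bc_down f) (rho\<^sup>2)" and ?u = "cpoly (bc_up f) (rho\<^sup>2)"
    let ?e = "exp (\<bar>Im rho\<bar> * x)"
    have d: "norm (rho * ?d - rho * A rho * al) \<le> K * norm (A rho)" and u: "norm (?u + rho * A rho * be) \<le> K * norm (A rho)"
      using bl rho1 by (auto simp: bc_leading_def)
    define N where "N = norm (- ?u) + norm rho * norm ?d"
    have le: "norm (A rho) \<le> norm rho * norm (A rho)" using rho1 by (simp add: mult_le_cancel_right1)
    have abn: "norm al \<le> 1" "norm be \<le> 1" using ab by (auto split: if_splits)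
    have "norm (rho * ?d) \<le> norm (rho * ?d - rho * A rho * al) + norm (rho * A rho * al)"
      by (metis diff_add_cancel norm_triangle_ineq)
    moreover have "norm (rho * A rho * al) \<le> norm rho * norm (A rho)"
      using abn by (simp add: norm_mult mult_left_le)
    moreover have "norm ?u \<le> norm (?u + rho * A rho * be) + norm (rho * A rho * be)"
      by (metis add_diff_cancel norm_triangle_ineq4)
    moreover have "norm (rho * A rho * be) \<le> norm rho * norm (A rho)"
      using abn by (simp add: norm_mult mult_left_le)
    ultimately have "N \<le> 2 * (K * norm (A rho)) + 2 * (norm rho * norm (A rho))"
      using d u by (simp add: N_def norm_mult)
    also have "\<dots> \<le> 2 * (K * (norm rho * norm (A rho))) + 2 * (norm rho * norm (A rho))"
      using mult_left_mono[OF le K] by simp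
    finally have "N \<le> 2 * (1 + K) * (norm rho * norm (A rho))" by (simp add: algebra_simps)
    then have "2 * I * N \<le> 2 * I * (2 * (1 + K) * (norm rho * norm (A rho)))"
      using I0 by (intro mult_left_mono) auto
    then have "2 * I * N / norm rho \<le> 4 * I * (1 + K) * norm (A rho)"
      using rho0 by (simp add: field_simps)
    then have N: "?e * (2 * I * N / norm rho) \<le> ?e * (4 * I * (1 + K) * norm (A rho))" by (intro mult_left_mono) auto
    note P = phi_sl_ode[OF q, where z = "rho\<^sup>2" and f = f]
    note as = sl_ode_asymptotics[OF Q pi_ge_zero order_refl rho2[unfolded I_def] rho0 P(1) x, folded I_def, unfolded P(2,3), folded N_def]
    have sc: "norm (sin (rho * of_real x)) \<le> ?e" "norm (cos (rho * of_real x)) \<le> ?e"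
      using norm_sin_cos_scaled_le[of x rho] x by auto
    have prod: "norm (a * b) \<le> ?e * (K * norm (A rho))" if "norm a \<le> K * norm (A rho)" "norm b \<le> ?e" for a b :: complex
    proof -
      have "norm (a * b) \<le> (K * norm (A rho)) * ?e" unfolding norm_mult using that K by (intro mult_mono) auto
      then show ?thesis by (simp add: mult.commute)
    qed
    have fin: "norm (X - L) \<le> ?e * (M * norm (A rho))"
      if "norm (X - Y) \<le> ?e * (2 * I * N / norm rho)" "Y - L = a * b + c * d"
        "norm a \<le> K * norm (A rho)" "norm b \<le> ?e" "norm c \<le> K * norm (A rho)" "norm d \<le> ?e" for X Y L a b c d :: complex
    proof -
      have "norm (X - L) \<le> norm (X - Y) + norm (a * b + c * d)"
        using norm_triangle_ineq[of "X - Y" "Y - L"] unfolding that(2)[symmetric] by simp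
      also have "norm (a * b + c * d) \<le> ?e * (K * norm (A rho)) + ?e * (K * norm (A rho))"
        by (intro norm_triangle_le add_mono prod that)
      finally show ?thesis using that(1) N unfolding M_def by (simp add: algebra_simps)
    qed
    have "norm (rho * phi q f (rho\<^sup>2) x - rho * A rho * lead_T al be rho x) \<le> ?e * (M * norm (A rho))"
      by (rule fin[OF as(1), where a = "rho * ?d - rho * A rho * al" and b = "cos (rho * of_real x)"
            and c = "- (?u + rho * A rho * be)" and d = "sin (rho * of_real x)"])
        (use d u sc in \<open>simp_all only: norm_minus_cancel\<close>, simp add: lead_T_def algebra_simps)
    moreover have "norm (dphi q f (rho\<^sup>2) x - rho * A rho * lead_T be (- al) rho x) \<le> ?e * (M * norm (A rho))"
      by (rule fin[OF as(2), where a = "- (rho * ?d - rho * A rho * al)" and b = "sin (rho * of_real x)"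
            and c = "- (?u + rho * A rho * be)" and d = "cos (rho * of_real x)"])
        (use d u sc in \<open>simp_all only: norm_minus_cancel\<close>, simp add: lead_T_def algebra_simps)
    ultimately show ?thesis by blast
  qed
  have "0 \<le> M" using I0 K by (simp add: M_def)
  show ?thesis unfolding phi_asymptotic_def
    by (rule exI[of _ M], rule exI[of _ "max 1 (2 * I)"]) (use \<open>0 \<le> M\<close> main in auto)
qed

section \<open>Growth of the midpoint Wronskian against that of the characteristic function\<close>

definition mid_wronskian ::
  "(real \<Rightarrow> real) \<Rightarrow> (real \<Rightarrow> real) \<Rightarrow> boundary_coeff \<Rightarrow> complex \<Rightarrow> complex" where
  "mid_wronskian q qt f z =
     phi q f z (pi/2) * dphi qt f z (pi/2) - dphi q f z (pi/2) * phi qt f z (pi/2)"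

text \<open>Both products in the Wronskian have the same main term \<open>?a\<close> times
  \<open>?b\<close>, up to the factor rho, because the potential does not enter it. It cancels, and
  the remainder is smaller by a factor rho than either product may be.\<close>

lemma mid_wronskian_bound:
  assumes q: "q absolutely_integrable_on {0..pi}" and qt: "qt absolutely_integrable_on {0..pi}"
    and bl: "bc_leading f al be K A"
  shows "\<exists>M R. 0 \<le> M \<and> 1 \<le> R \<and> (\<forall>rho. R \<le> norm rho \<longrightarrow>
    norm (mid_wronskian q qt f (rho\<^sup>2)) \<le> M * (norm (A rho) * norm (A rho) * exp (\<bar>Im rho\<bar> * pi)))"
proof -
  obtain M1 R1 where "phi_asymptotic q f al be A M1 R1" using phi_asymptotics[OF q bl] by blast
  note 1 = phi_asymptoticD[OF this]
  obtain M2 R2 where "phi_asymptotic qt f al be A M2 R2" using phi_asymptotics[OF qt bl] by blast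
  note 2 = phi_asymptoticD[OF this]
  have ab: "(al, be) = (if even (bc_index f) then (1, 0) else (0, 1))"
    using bl by (auto simp: bc_leading_def)
  define C where "C = M1 + M2 + M1 * M2"
  have main: "norm (mid_wronskian q qt f (rho\<^sup>2)) \<le> 2 * C * (norm (A rho) * norm (A rho) * exp (\<bar>Im rho\<bar> * pi))"
    if rho: "max R1 R2 \<le> norm rho" for rho
  proof -
    let ?x = "pi/2" let ?e = "exp (\<bar>Im rho\<bar> * ?x)"
    have x: "?x \<in> {0..pi}" by simp
    have rho1: "1 \<le> norm rho" using rho 1(2) by simp
    have ee: "?e * ?e = exp (\<bar>Im rho\<bar> * pi)" by (simp add: exp_add[symmetric])
    let ?a = "rho * A rho * lead_T al be rho ?x" and ?b = "rho * A rho * lead_T be (- al) rho ?x"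
    have a: "norm ?a \<le> norm rho * norm (A rho) * ?e" and b: "norm ?b \<le> norm rho * norm (A rho) * ?e"
      using norm_lead_T_le[OF ab, of ?x rho] by (auto simp: norm_mult intro!: mult_left_mono)
    note e1 = 1(3)[of rho ?x] and e2 = 2(3)[of rho ?x]
    have bnd: "norm rho * norm (A rho) * ?e * (?e * (m * norm (A rho))) + ?e * (m' * norm (A rho)) * (norm rho * norm (A rho) * ?e)
       + ?e * (m' * norm (A rho)) * (?e * (m * norm (A rho))) \<le> (m + m' + m * m') * (norm (A rho) * norm (A rho) * (?e * ?e)) * norm rho"
      if "0 \<le> m" "0 \<le> m'" for m m'
    proof -
      have "1 * (m * m' * (norm (A rho) * norm (A rho) * (?e * ?e))) \<le> norm rho * (m * m' * (norm (A rho) * norm (A rho) * (?e * ?e)))"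
        using that by (intro mult_right_mono rho1) auto
      then show ?thesis by (simp add: algebra_simps)
    qed
    have X: "norm (rho * phi q f (rho\<^sup>2) ?x * dphi qt f (rho\<^sup>2) ?x - ?a * ?b) \<le> C * (norm (A rho) * norm (A rho) * (?e * ?e)) * norm rho"
      using order_trans[OF norm_mult_diff_le[of _ ?a _ _ ?b, OF conjunct1[OF e1] conjunct2[OF e2] a b] bnd[of M2 M1]] rho x 1(1) 2(1)
      by (simp add: C_def add_ac mult_ac)
    have Y: "norm (rho * phi qt f (rho\<^sup>2) ?x * dphi q f (rho\<^sup>2) ?x - ?a * ?b) \<le> C * (norm (A rho) * norm (A rho) * (?e * ?e)) * norm rho"
      using order_trans[OF norm_mult_diff_le[of _ ?a _ _ ?b, OF conjunct1[OF e2] conjunct2[OF e1] a b] bnd[of M1 M2]] rho x 1(1) 2(1)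
      by (simp add: C_def add_ac mult_ac)
    have "rho * mid_wronskian q qt f (rho\<^sup>2) = (rho * phi q f (rho\<^sup>2) ?x * dphi qt f (rho\<^sup>2) ?x - ?a * ?b)
       - (rho * phi qt f (rho\<^sup>2) ?x * dphi q f (rho\<^sup>2) ?x - ?a * ?b)"
      unfolding mid_wronskian_def by (simp add: algebra_simps)
    then have "norm (rho * mid_wronskian q qt f (rho\<^sup>2)) \<le> 2 * (C * (norm (A rho) * norm (A rho) * (?e * ?e)) * norm rho)"
      using norm_triangle_le_diff[OF add_mono[OF X Y]] by (simp only: mult_2)
    then have "norm rho * norm (mid_wronskian q qt f (rho\<^sup>2)) \<le> norm rho * (2 * C * (norm (A rho) * norm (A rho) * (?e * ?e)))"
      by (simp add: norm_mult mult_ac)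
    then have "norm (mid_wronskian q qt f (rho\<^sup>2)) \<le> 2 * C * (norm (A rho) * norm (A rho) * (?e * ?e))"
      by (rule mult_left_le_imp_le) (use rho1 in linarith)
    then show ?thesis unfolding ee .
  qed
  have "0 \<le> 2 * C" using 1 2 by (simp add: C_def)
  show ?thesis
    by (rule exI[of _ "2 * C"], rule exI[of _ "max R1 R2"]) (use \<open>0 \<le> 2 * C\<close> 1(2) main in auto)
qed

text \<open>With common \<open>al\<close> and \<open>be\<close> one of the two main products
  vanishes and the other makes chi close to rho A B sin(rho pi), up to sign. On the squares sin(rho
  pi) = 2 sin cos of half the argument is at least exp(|Im rho| pi) / 32 in modulus; 128 C \<le>
  |rho| lets the error consume at most half of this, which leaves 1/64.\<close>

lemma chi_lower_bound:
  assumes q: "q absolutely_integrable_on {0..pi}"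
    and bf: "bc_leading f al be K A" and bF: "bc_leading F al be K' B"
  shows "\<exists>R\<ge>1. \<forall>rho n. R \<le> norm rho \<longrightarrow> rho \<in> square_contour n \<longrightarrow>
    norm rho * (norm (A rho) * norm (B rho) * exp (\<bar>Im rho\<bar> * pi)) \<le> 64 * norm (chi q f F (rho\<^sup>2))"
proof -
  obtain M R where "phi_asymptotic q f al be A M R" using phi_asymptotics[OF q bf] by blast
  note 1 = phi_asymptoticD[OF this]
  have ab: "(al, be) = (if even (bc_index f) then (1, 0) else (0, 1))"
    using bf by (auto simp: bc_leading_def)
  have K': "0 \<le> K'" using bF by (auto simp: bc_leading_def)
  define C where "C = M + K' + K' * M"
  have C0: "0 \<le> C" using 1 K' by (simp add: C_def)
  have "norm rho * (norm (A rho) * norm (B rho) * exp (\<bar>Im rho\<bar> * pi)) \<le> 64 * norm (chi q f F (rho\<^sup>2))"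
    if rho: "max R (128 * C) \<le> norm rho" and sq: "rho \<in> square_contour n" for rho n
  proof -
    let ?e = "exp (\<bar>Im rho\<bar> * pi)"
    have x: "pi \<in> {0..pi}" by simp
    have rho1: "1 \<le> norm rho" and rhoC: "128 * C \<le> norm rho" using rho 1(2) by simp_all
    let ?d = "cpoly (bc_down F) (rho\<^sup>2)" and ?u = "cpoly (bc_up F) (rho\<^sup>2)"
    have d: "norm (rho * ?d - rho * B rho * al) \<le> K' * norm (B rho)" and u: "norm (?u - - (rho * B rho * be)) \<le> K' * norm (B rho)"
      using bF rho1 by (auto simp: bc_leading_def)
    have abn: "norm al \<le> 1" "norm be \<le> 1" using ab by (auto split: if_splits)
    let ?a = "rho * A rho * lead_T al be rho pi" and ?b = "rho * A rho * lead_T be (- al) rho pi"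
    have a: "norm ?a \<le> norm rho * norm (A rho) * ?e" and b: "norm ?b \<le> norm rho * norm (A rho) * ?e"
      using norm_lead_T_le[OF ab, of pi rho] by (auto simp: norm_mult intro!: mult_left_mono)
    have db: "norm (rho * B rho * al) \<le> norm rho * norm (B rho)" and ub: "norm (- (rho * B rho * be)) \<le> norm rho * norm (B rho)"
      using abn by (simp_all add: norm_mult mult_left_le)
    note e = 1(3)[OF _ x, of rho]
    define Z where "Z = norm (A rho) * norm (B rho) * ?e"
    have Z0: "0 \<le> Z" by (simp add: Z_def)
    have bnd: "norm rho * norm (B rho) * (?e * (M * norm (A rho))) + K' * norm (B rho) * (norm rho * norm (A rho) * ?e)
       + K' * norm (B rho) * (?e * (M * norm (A rho))) \<le> norm rho * (C * Z)"
    proof -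
      have "1 * (K' * M * Z) \<le> norm rho * (K' * M * Z)"
        using K' 1 Z0 by (intro mult_right_mono rho1) auto
      then show ?thesis by (simp add: C_def Z_def algebra_simps)
    qed
    have Rrho: "R \<le> norm rho" using rho by simp
    have X: "norm (rho * ?d * dphi q f (rho\<^sup>2) pi - rho * B rho * al * ?b) \<le> norm rho * (C * Z)"
      by (rule order_trans[OF norm_mult_diff_le[OF d conjunct2[OF e[OF Rrho]] db b] bnd])
    have Y: "norm (?u * (rho * phi q f (rho\<^sup>2) pi) - - (rho * B rho * be) * ?a) \<le> norm rho * (C * Z)"
      by (rule order_trans[OF norm_mult_diff_le[OF u conjunct1[OF e[OF Rrho]] ub a] bnd])
    define s where "s = rho * B rho * al * ?b - - (rho * B rho * be) * ?a"
    have e2: "rho * chi q f F (rho\<^sup>2) - s = (rho * ?d * dphi q f (rho\<^sup>2) pi - rho * B rho * al * ?b)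
        - (?u * (rho * phi q f (rho\<^sup>2) pi) - - (rho * B rho * be) * ?a)"
      unfolding chi_def s_def by (simp add: algebra_simps)
    have 3: "norm (rho * chi q f F (rho\<^sup>2) - s) \<le> norm rho * (C * Z) + norm rho * (C * Z)"
      unfolding e2 by (rule norm_triangle_le_diff[OF add_mono[OF X Y]])
    have ns: "norm s = norm rho * norm rho * (norm (A rho) * norm (B rho)) * norm (sin (rho * of_real pi))"
    proof -
      have "s = rho * rho * (A rho * B rho) * sin (rho * of_real pi) \<or> s = - (rho * rho * (A rho * B rho) * sin (rho * of_real pi))"
        using ab by (auto simp: s_def lead_T_def split: if_splits)
      then show ?thesis by (auto simp: norm_mult)
    qed
    have sn: "?e / 32 \<le> norm (sin (rho * of_real pi))"
    proof -
      let ?w = "rho * complex_of_real (pi/2)" let ?h = "exp (\<bar>Im rho\<bar> * (pi/2)) / 8"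
      have "rho * of_real pi = 2 * ?w" by simp
      then have "sin (rho * of_real pi) = 2 * sin ?w * cos ?w" by (simp only: sin_double)
      then have "norm (sin (rho * of_real pi)) = 2 * (norm (sin ?w) * norm (cos ?w))" by (simp only: norm_mult) simp
      moreover have "?h * ?h \<le> norm (sin ?w) * norm (cos ?w)"
        by (intro mult_mono square_contour_sin_cos[OF sq]) auto
      moreover have "?h * ?h = ?e / 64" by (simp add: exp_add[symmetric])
      ultimately show ?thesis by simp
    qed
    have 4: "norm rho * norm rho * (norm (A rho) * norm (B rho)) * (?e / 32) \<le> norm s"
      unfolding ns by (rule mult_left_mono[OF sn]) simp
    have "norm s \<le> norm (rho * chi q f F (rho\<^sup>2)) + norm (rho * chi q f F (rho\<^sup>2) - s)"
      using norm_triangle_ineq4[of "rho * chi q f F (rho\<^sup>2)" "rho * chi q f F (rho\<^sup>2) - s"] by simp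
    with 3 4 have 5: "norm rho * norm rho * (Z / 32) \<le> norm rho * norm (chi q f F (rho\<^sup>2)) + norm rho * (2 * C * Z)"
      by (simp add: Z_def norm_mult mult_ac)
    have "norm rho * (norm rho * (Z / 32)) \<le> norm rho * (norm (chi q f F (rho\<^sup>2)) + 2 * C * Z)"
      using 5 by (simp add: algebra_simps)
    then have 6: "norm rho * (Z / 32) \<le> norm (chi q f F (rho\<^sup>2)) + 2 * C * Z"
      by (rule mult_left_le_imp_le) (use rho1 in linarith)
    have "128 * C * Z \<le> norm rho * Z" by (rule mult_right_mono[OF rhoC Z0])
    with 6 have "norm rho * Z \<le> 64 * norm (chi q f F (rho\<^sup>2))" by simp
    then show ?thesis by (simp add: Z_def)
  qed
  with 1(2) show ?thesis by (intro exI[of _ "max R (128 * C)"]) auto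
qed

text \<open>Equal indices enter twice: their parity gives both ends the same \<open>al\<close> and
  \<open>be\<close>, and their size gives |A| = |B|. Powers and exponentials then cancel in the
  quotient. Reality of the zeros is what \<open>chi_simple_zero\<close> needs.\<close>

lemma mid_wronskian_eq_0:
  assumes q: "q absolutely_integrable_on {0..pi}" and qt: "qt absolutely_integrable_on {0..pi}"
    and f: "f \<in> rational_class" and F: "F \<in> rational_class" and ind: "bc_index f = bc_index F"
    and real: "\<And>z. chi q f F z = 0 \<Longrightarrow> z \<in> \<real>"
    and zero: "\<And>z. chi q f F z = 0 \<Longrightarrow> mid_wronskian q qt f z = 0"
  shows "mid_wronskian q qt f z = 0"
proof -
  let ?G = "mid_wronskian q qt f" and ?X = "chi q f F"
  have G: "?G holomorphic_on UNIV"
    unfolding mid_wronskian_def[abs_def] by (intro holomorphic_intros phi_holomorphic q qt) auto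
  have simple: "deriv ?X z \<noteq> 0" if "?X z = 0" for z
    using real[OF that] chi_simple_zero[OF q f F] that by (auto elim!: Reals_cases)
  obtain H where H: "H holomorphic_on UNIV" "\<And>z. ?G z = H z * ?X z"
    using entire_quotient_simple_zeros[OF G chi_holomorphic[OF q] zero simple] by blast
  obtain al be K A where bf: "bc_leading f al be K A" using bc_leading_exists[OF f] by blast
  obtain al' be' K' B where bF': "bc_leading F al' be' K' B" using bc_leading_exists[OF F] by blast
  have "al' = al" "be' = be" using bf bF' ind by (auto simp: bc_leading_def split: if_splits)
  then have bF: "bc_leading F al be K' B" using bF' by simp
  obtain M R1 where 1: "0 \<le> M" "1 \<le> R1" "\<And>rho. R1 \<le> norm rho \<Longrightarrow>
    norm (?G (rho\<^sup>2)) \<le> M * (norm (A rho) * norm (A rho) * exp (\<bar>Im rho\<bar> * pi))"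
    using mid_wronskian_bound[OF q qt bf] by blast
  obtain R2 where 2: "\<And>rho n. R2 \<le> norm rho \<Longrightarrow> rho \<in> square_contour n \<Longrightarrow>
    norm rho * (norm (A rho) * norm (B rho) * exp (\<bar>Im rho\<bar> * pi)) \<le> 64 * norm (?X (rho\<^sup>2))"
    using chi_lower_bound[OF q bf bF] by blast
  obtain n0 :: nat where n0: "max R1 R2 \<le> real n0" using real_arch_simple by blast
  have "H z = 0"
  proof (rule entire_eq_0_of_square_contour_bound[OF H(1)])
    fix n rho assume n: "n0 \<le> n" and rho: "rho \<in> square_contour n"
    have nrho: "real n \<le> norm rho" by (rule square_contourD(2)[OF rho])
    then have R: "R1 \<le> norm rho" "R2 \<le> norm rho" "1 \<le> norm rho" using n n0 1(2) by linarith+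
    have A: "norm (A rho) * norm rho = norm rho ^ nat (bc_index f + 1)"
      using bf R(3) by (auto simp: bc_leading_def)
    have B: "norm (B rho) * norm rho = norm rho ^ nat (bc_index F + 1)"
      using bF R(3) by (auto simp: bc_leading_def)
    have rho0: "norm rho > 0" using R(3) by linarith
    then have "0 < norm (A rho) * norm rho" unfolding A by simp
    then have A0: "norm (A rho) > 0" by (simp add: zero_less_mult_iff)
    have BA: "norm (B rho) = norm (A rho)" using A B ind rho0 by (metis less_irrefl mult_cancel_right)
    define E where "E = norm (A rho) * norm (A rho) * exp (\<bar>Im rho\<bar> * pi)"
    have E: "0 < E" using A0 by (simp add: E_def)
    have X: "norm rho * E \<le> 64 * norm (?X (rho\<^sup>2))" using 2[OF R(2) rho] by (simp add: E_def BA)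
    have "norm (H (rho\<^sup>2)) * (norm rho * E) \<le> norm (H (rho\<^sup>2)) * (64 * norm (?X (rho\<^sup>2)))"
      by (intro mult_left_mono X) auto
    also have "\<dots> = 64 * norm (?G (rho\<^sup>2))" unfolding H(2) by (simp add: norm_mult)
    also have "\<dots> \<le> 64 * (M * E)" using 1(3)[OF R(1)] by (simp add: E_def)
    finally have "(norm (H (rho\<^sup>2)) * norm rho) * E \<le> (64 * M) * E" by (simp add: mult_ac)
    then have "norm (H (rho\<^sup>2)) * norm rho \<le> 64 * M" using E by (rule mult_right_le_imp_le)
    then show "norm (H (rho\<^sup>2)) \<le> (64 * M) / norm rho" using rho0 by (simp add: field_simps)
  qed
  then show ?thesis by (simp add: H(2))
qed

section \<open>The Borg--Marchenko argument\<close>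

text \<open>The positive and the negative part of \<open>h\<close> are densities of two measures
  that take the same finite value on each half-line. They therefore coincide, and uniqueness of
  densities makes the two parts equal a.e., which forces both to vanish.\<close>

lemma AE_zero_if_integrals_zero_real:
  fixes h :: "real \<Rightarrow> real"
  assumes h: "h absolutely_integrable_on {0..L}"
    and z: "\<And>s t. 0 \<le> s \<Longrightarrow> s \<le> t \<Longrightarrow> t \<le> L \<Longrightarrow> (h has_integral 0) {s..t}"
  shows "AE x in lebesgue. x \<in> {0..L} \<longrightarrow> h x = 0"
proof -
  define g0 where "g0 x = indicator {0..L} x * h x" for x :: real
  have g0: "integrable lebesgue g0" using h unfolding set_integrable_def g0_def by simp
  then have "g0 \<in> borel_measurable (completion lborel)" by simp
  \<comment> \<open>A Borel version of \<open>h\<close>, since the measures are compared with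
    respect to \<open>lborel\<close>.\<close>
  then obtain g where g: "g \<in> borel_measurable lborel" "AE x in lborel. g0 x = g x"
    using completion_ex_borel_measurable_real by blast
  have g': "AE x in lebesgue. g0 x = g x" using g(2) by (rule AE_completion)
  have gm: "g \<in> borel_measurable lebesgue" using g(1) by (rule measurable_completion)
  have "integrable lebesgue g"
    using integrable_cong_AE[of g0 lebesgue g] g0 g' gm by simp
  then have gi: "integrable lborel g" using integrable_completion[OF g(1)] by simp
  have zero: "integral\<^sup>L lborel (\<lambda>y. g y * indicator {x<..} y) = 0" for x :: real
  proof -
    have m: "(\<lambda>y. g y * indicator {x<..} y) \<in> borel_measurable lborel"
      using g(1) by (intro borel_measurable_times borel_measurable_indicator) auto
    have "integral\<^sup>L lborel (\<lambda>y. g y * indicator {x<..} y) = integral\<^sup>L lebesgue (\<lambda>y. g y * indicator {x<..} y)"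
      by (rule integral_completion[OF m, symmetric])
    also have "\<dots> = integral\<^sup>L lebesgue (\<lambda>y. indicator ({x<..} \<inter> {0..L}) y *\<^sub>R h y)"
    proof (rule integral_cong_AE)
      show "(\<lambda>y. g y * indicator {x<..} y) \<in> borel_measurable lebesgue" using m by (rule measurable_completion)
      have "(\<lambda>y. g0 y * indicator {x<..} y) \<in> borel_measurable lebesgue"
        using g0 by (intro borel_measurable_times borel_measurable_indicator) auto
      moreover have "(\<lambda>y. g0 y * indicator {x<..} y) = (\<lambda>y. indicator ({x<..} \<inter> {0..L}) y *\<^sub>R h y)"
        by (auto simp: g0_def indicator_def)
      ultimately show "(\<lambda>y. indicator ({x<..} \<inter> {0..L}) y *\<^sub>R h y) \<in> borel_measurable lebesgue" by simp
      show "AE y in lebesgue. g y * indicator {x<..} y = indicator ({x<..} \<inter> {0..L}) y *\<^sub>R h y"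
        using g' by eventually_elim (auto simp: g0_def indicator_def)
    qed
    also have "\<dots> = integral ({x<..} \<inter> {0..L}) h"
    proof -
      have "h absolutely_integrable_on ({x<..} \<inter> {0..L})"
        by (rule set_integrable_subset[OF h]) auto
      from set_lebesgue_integral_eq_integral(2)[OF this] show ?thesis
        by (simp add: set_lebesgue_integral_def)
    qed
    also have "\<dots> = 0"
    proof (cases "max x 0 \<le> L")
      case True
      have "integral ({x<..} \<inter> {0..L}) h = integral {max x 0..L} h"
        by (rule integral_spike_set; rule negligible_subset[OF negligible_sing[of x]]) auto
      also have "\<dots> = 0" using z[of "max x 0" L] True by (intro integral_unique) auto
      finally show ?thesis .
    next
      case False
      then have "{x<..} \<inter> {0..L} = {}" by auto
      then show ?thesis by simp
    qed
    finally show ?thesis .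
  qed
  have nn: "(\<integral>\<^sup>+ y. ennreal (g y * indicator {x<..} y) \<partial>lborel) = (\<integral>\<^sup>+ y. ennreal (- (g y * indicator {x<..} y)) \<partial>lborel)
      \<and> (\<integral>\<^sup>+ y. ennreal (g y * indicator {x<..} y) \<partial>lborel) < \<infinity>" for x :: real
  proof -
    have i: "integrable lborel (\<lambda>y. g y * indicator {x<..} y)"
      using integrable_mult_indicator[OF _ gi, of "{x<..}"] by (simp add: mult.commute)
    have f: "(\<integral>\<^sup>+ y. ennreal (g y * indicator {x<..} y) \<partial>lborel) < \<infinity>" "(\<integral>\<^sup>+ y. ennreal (- (g y * indicator {x<..} y)) \<partial>lborel) < \<infinity>"
      using i unfolding real_integrable_def by (auto simp: less_top)
    have "enn2real (\<integral>\<^sup>+ y. ennreal (g y * indicator {x<..} y) \<partial>lborel)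
        = enn2real (\<integral>\<^sup>+ y. ennreal (- (g y * indicator {x<..} y)) \<partial>lborel)"
      using real_lebesgue_integral_def[OF i] zero[of x] by simp
    then show ?thesis using f ennreal_enn2real unfolding infinity_ennreal_def by metis
  qed
  have em: "emeasure (density lborel (\<lambda>y. ennreal (c * g y))) {x<..} = (\<integral>\<^sup>+ y. ennreal (c * (g y * indicator {x<..} y)) \<partial>lborel)" for c x :: real
    using g(1) by (subst emeasure_density) (auto intro!: nn_integral_cong simp: indicator_def)
  \<comment> \<open>\<open>ennreal\<close> truncates negative numbers to 0, so the two densities are
    exactly the positive and the negative part of \<open>g\<close>.\<close>
  have "density lborel (\<lambda>y. ennreal (1 * g y)) = density lborel (\<lambda>y. ennreal ((-1) * g y))"
  proof (rule measure_eqI_lessThan)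
    show "emeasure (density lborel (\<lambda>y. ennreal (1 * g y))) {x<..} < \<infinity>" for x
      using nn[of x] unfolding em unfolding mult_1_left by (rule conjunct2)
    show "emeasure (density lborel (\<lambda>y. ennreal (1 * g y))) {x<..}
      = emeasure (density lborel (\<lambda>y. ennreal ((-1) * g y))) {x<..}" for x
      using nn[of x] unfolding em unfolding mult_1_left mult_minus1 by (rule conjunct1)
  qed simp_all
  then have "AE x in lborel. ennreal (1 * g x) = ennreal ((-1) * g x)"
    using g(1) by (intro sigma_finite_measure.density_unique[OF sigma_finite_lborel]) auto
  then have "AE x in lborel. g x = 0"
    by eventually_elim (metis ennreal_eq_0_iff ennreal_neg linorder_linear minus_minus mult_1 mult_minus1 neg_0_le_iff_le order_antisym)
  then have "AE x in lborel. g0 x = 0" using g(2) by eventually_elim simp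
  then have "AE x in lebesgue. g0 x = 0" by (rule AE_completion)
  then show ?thesis by eventually_elim (auto simp: g0_def)
qed

lemma AE_zero_if_integrals_zero:
  fixes h :: "real \<Rightarrow> complex"
  assumes "ac_primitive L (\<lambda>x. 0) h"
  shows "AE x in lebesgue. x \<in> {0..L} \<longrightarrow> h x = 0"
proof -
  note h = ac_primitive_integrable[OF assms] and z = ac_primitive_has_integral[OF assms]
  have "AE x in lebesgue. x \<in> {0..L} \<longrightarrow> Re (h x) = 0"
  proof (rule AE_zero_if_integrals_zero_real)
    show "(\<lambda>x. Re (h x)) absolutely_integrable_on {0..L}"
      using absolutely_integrable_linear[OF h bounded_linear_Re] by (simp add: o_def)
    show "((\<lambda>x. Re (h x)) has_integral 0) {s..t}" if "0 \<le> s" "s \<le> t" "t \<le> L" for s t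
      using has_integral_linear[OF z[OF that] bounded_linear_Re] by (simp add: o_def)
  qed
  moreover have "AE x in lebesgue. x \<in> {0..L} \<longrightarrow> Im (h x) = 0"
  proof (rule AE_zero_if_integrals_zero_real)
    show "(\<lambda>x. Im (h x)) absolutely_integrable_on {0..L}"
      using absolutely_integrable_linear[OF h bounded_linear_Im] by (simp add: o_def)
    show "((\<lambda>x. Im (h x)) has_integral 0) {s..t}" if "0 \<le> s" "s \<le> t" "t \<le> L" for s t
      using has_integral_linear[OF z[OF that] bounded_linear_Im] by (simp add: o_def)
  qed
  ultimately show ?thesis by eventually_elim (simp add: complex_eq_iff)
qed

lemma ac_primitive_zero_continuous:
  assumes F: "ac_primitive L (\<lambda>x. 0) f" and f: "continuous_on {0..L} f" and x: "x \<in> {0..L}" and L: "0 < L"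
  shows "f x = 0"
  using vector_derivative_unique_within_closed_interval[of 0 L x "\<lambda>x. 0 :: complex"]
    ac_primitive_has_vector_derivative[OF F f x] x L by auto

text \<open>A zero at \<open>x\<close> would make the nonreal \<open>z\<close> a Dirichlet
  eigenvalue on [0,x]. The Lagrange identity for the solution and its conjugate then reads (z - cnj
  z) times the integral of |y|^2 = 0, so the solution would vanish identically.\<close>

lemma sl_init_nonzero:
  assumes q: "(\<lambda>x. complex_of_real (q x)) absolutely_integrable_on {0..L}" and x: "0 < x" "x \<le> L"
    and z: "Im z \<noteq> 0"
  shows "sl_y L (\<lambda>x. complex_of_real (q x)) 0 1 z x \<noteq> 0"
proof
  let ?q = "\<lambda>x. complex_of_real (q x)"
  let ?y = "sl_y L ?q 0 1 z" and ?v = "sl_v L ?q 0 1 z"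
  assume y0: "?y x = 0"
  have L: "0 \<le> L" using x by simp
  note S = sl_init[OF q L, where z = z and ya = 0 and va = 1]
  have "sl_ode L (\<lambda>x. ?q x - cnj z) (\<lambda>x. 0) (\<lambda>x. cnj (?y x)) (\<lambda>x. cnj (?v x))"
    using sl_ode_cnj[OF S(1)] by simp
  note W = ac_primitive_has_integral[OF sl_ode_wronskian[OF S(1) this], of 0 x]
  have W: "((\<lambda>t. (z - cnj z) * (?y t * cnj (?y t))) has_integral 0) {0..x}"
    using W x y0 by (simp add: S)
  have ne: "z - cnj z \<noteq> 0" using z by (auto simp: complex_eq_iff)
  have "((\<lambda>t. inverse (z - cnj z) * ((z - cnj z) * (?y t * cnj (?y t)))) has_integral 0) {0..x}"
    using has_integral_mult_right[OF W, of "inverse (z - cnj z)"] by simp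
  then have "((\<lambda>t. complex_of_real ((norm (?y t))\<^sup>2)) has_integral 0) {0..x}"
    by (rule has_integral_eq[rotated]) (use ne in \<open>simp add: complex_norm_square[symmetric] mult.assoc[symmetric]\<close>)
  from has_integral_linear[OF this bounded_linear_Re]
  have hi: "((\<lambda>t. (norm (?y t))\<^sup>2) has_integral 0) (cbox 0 x)" by (simp add: o_def cbox_interval)
  have c: "continuous_on (cbox 0 x) (\<lambda>t. (norm (?y t))\<^sup>2)"
    using x by (intro continuous_intros continuous_on_subset[OF sl_ode_integrable(3)[OF S(1)]]) (auto simp: cbox_interval)
  have "?y t = 0" if "t \<in> {0..x}" for t
    using has_integral_0_cbox_imp_0[OF c _ hi, of t] that x by (auto simp: cbox_interval)
  then have "?v 0 = 0" by (rule sl_ode_zero[OF sl_ode_mono[OF S(1) x(2)] _ x(1)])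
  then show False by (simp add: S)
qed

text \<open>Once the two sine type solutions agree, so do their derivatives, and (q - qt) S has
  integral zero over every subinterval. It vanishes a.e., and \<open>S\<close> has no zero other
  than 0.\<close>

lemma potential_unique_of_proportional_solutions:
  fixes q qt :: "real \<Rightarrow> real"
  assumes q: "(\<lambda>x. complex_of_real (q x)) absolutely_integrable_on {0..L}"
    and qt: "(\<lambda>x. complex_of_real (qt x)) absolutely_integrable_on {0..L}"
    and L: "0 < L" and z: "Im z \<noteq> 0"
    and eq: "\<And>x. x \<in> {0..L} \<Longrightarrow>
      sl_y L (\<lambda>x. of_real (q x)) 0 1 z x * sl_y L (\<lambda>x. of_real (qt x)) 1 0 z x
      = sl_y L (\<lambda>x. of_real (qt x)) 0 1 z x * sl_y L (\<lambda>x. of_real (q x)) 1 0 z x"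
  shows "AE x in lebesgue. x \<in> {0..L} \<longrightarrow> q x = qt x"
proof -
  let ?q = "\<lambda>x. complex_of_real (q x)" and ?qt = "\<lambda>x. complex_of_real (qt x)"
  let ?S = "sl_y L ?q 0 1 z" and ?S' = "sl_v L ?q 0 1 z" and ?C = "sl_y L ?q 1 0 z" and ?C' = "sl_v L ?q 1 0 z"
  let ?T = "sl_y L ?qt 0 1 z" and ?T' = "sl_v L ?qt 0 1 z" and ?D = "sl_y L ?qt 1 0 z" and ?D' = "sl_v L ?qt 1 0 z"
  have L0: "0 \<le> L" using L by simp
  note S = sl_init[OF q L0, where z = z and ya = 0 and va = 1] and C = sl_init[OF q L0, where z = z and ya = 1 and va = 0]
  note T = sl_init[OF qt L0, where z = z and ya = 0 and va = 1] and D = sl_init[OF qt L0, where z = z and ya = 1 and va = 0]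
  have aS: "ac_primitive L ?S ?S'" and aS': "ac_primitive L ?S' (\<lambda>x. (?q x - z) * ?S x)"
    and aT: "ac_primitive L ?T ?T'" and aT': "ac_primitive L ?T' (\<lambda>x. (?qt x - z) * ?T x)"
    and aC: "ac_primitive L ?C ?C'" and aD: "ac_primitive L ?D ?D'"
    using S(1) T(1) C(1) D(1) by (auto simp: sl_ode_def)
  note cont = sl_ode_integrable(3,4)[OF S(1)] sl_ode_integrable(3,4)[OF T(1)]
    sl_ode_integrable(3,4)[OF C(1)] sl_ode_integrable(3,4)[OF D(1)]
  have sq: "(?S x)\<^sup>2 = (?T x)\<^sup>2" if x: "x \<in> {0..L}" for x
  proof -
    let ?k = "\<lambda>x. (?S' x * ?D x + ?D' x * ?S x) - (?T' x * ?C x + ?C' x * ?T x)"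
    have "ac_primitive L (\<lambda>x. ?S x * ?D x - ?T x * ?C x) ?k"
      by (intro ac_primitive_diff ac_primitive_mult aS aD aT aC)
    then have "ac_primitive L (\<lambda>x. 0) ?k" by (rule ac_primitive_cong) (simp_all add: eq)
    then have k: "?k x = 0"
      by (rule ac_primitive_zero_continuous[OF _ _ x L]) (intro continuous_intros cont)
    have w: "?C x * ?S' x - ?C' x * ?S x = 1" "?D x * ?T' x - ?D' x * ?T x = 1"
      using sl_ode_wronskian_constant[OF C(1) S(1) x] sl_ode_wronskian_constant[OF D(1) T(1) x]
      by (simp_all add: S C T D)
    \<comment> \<open>Modulo the assumed relation, \<open>?S x * ?T x\<close> times its derivative
      \<open>?k x\<close> is a combination of the two Wronskians, which are both 1.\<close>
    have "(?S x * ?T x) * ?k x = (?T x)\<^sup>2 * (?C x * ?S' x - ?C' x * ?S x) - (?S x)\<^sup>2 * (?D x * ?T' x - ?D' x * ?T x)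
       + (?S' x * ?T x + ?S x * ?T' x) * (?S x * ?D x - ?T x * ?C x)"
      by (simp add: algebra_simps power2_eq_square)
    then show ?thesis unfolding k w using eq[OF x] by simp
  qed
  have nzS: "?S x \<noteq> 0" if "x \<in> {0<..L}" for x using sl_init_nonzero[OF q _ _ z, of x] that by auto
  \<comment> \<open>Equality of squares leaves a sign open at each x. The quotient is continuous on
    the connected set (0,L] and takes only the values 1 and -1; the point 0 is excluded because
    \<open>?S\<close> vanishes there.\<close>
  have "(\<lambda>x. ?T x / ?S x) constant_on {0<..L}"
  proof (rule continuous_finite_range_constant)
    show "connected {0<..L}" by simp
    show "continuous_on {0<..L} (\<lambda>x. ?T x / ?S x)"
      using nzS by (intro continuous_intros continuous_on_subset[OF cont(1)] continuous_on_subset[OF cont(3)]) auto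
    have "?T x / ?S x \<in> {1, -1}" if "x \<in> {0<..L}" for x
    proof -
      have "(?T x / ?S x)\<^sup>2 = 1" using sq[of x, symmetric] nzS[OF that] that by (simp add: power_divide)
      then show ?thesis by (simp add: power2_eq_1_iff)
    qed
    then have "(\<lambda>x. ?T x / ?S x) ` {0<..L} \<subseteq> {1, -1}" by (rule image_subsetI)
    then show "finite ((\<lambda>x. ?T x / ?S x) ` {0<..L})" by (rule finite_subset) simp
  qed
  then obtain c where c: "\<And>x. x \<in> {0<..L} \<Longrightarrow> ?T x / ?S x = c" unfolding constant_on_def by blast
  have TS: "?T x = c * ?S x" if "x \<in> {0..L}" for x
  proof (cases "x = 0")
    case False
    then have x: "x \<in> {0<..L}" using that by auto
    show ?thesis using c[OF x] nzS[OF x] by (simp add: field_simps)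
  qed (simp add: S T)
  have "ac_primitive L (\<lambda>x. ?T x - c * ?S x) (\<lambda>x. ?T' x - c * ?S' x)"
    by (intro ac_primitive_diff ac_primitive_cmult aS aT)
  then have "ac_primitive L (\<lambda>x. 0) (\<lambda>x. ?T' x - c * ?S' x)" by (rule ac_primitive_cong) (simp_all add: TS)
  then have T'S': "?T' x - c * ?S' x = 0" if "x \<in> {0..L}" for x
    by (rule ac_primitive_zero_continuous[OF _ _ that L]) (intro continuous_intros cont)
  \<comment> \<open>Both solutions have slope 1 at 0, which settles the sign.\<close>
  from this[of 0] have c1: "c = 1" using L by (simp add: S T)
  have "ac_primitive L (\<lambda>x. ?S' x - ?T' x) (\<lambda>x. (?q x - z) * ?S x - (?qt x - z) * ?T x)"
    by (intro ac_primitive_diff aS' aT')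
  then have "ac_primitive L (\<lambda>x. 0) (\<lambda>x. (?q x - ?qt x) * ?S x)"
  proof (rule ac_primitive_cong)
    fix x assume x: "x \<in> {0..L}"
    show "?S' x - ?T' x = 0" using T'S'[OF x] c1 by simp
    show "(?q x - z) * ?S x - (?qt x - z) * ?T x = (?q x - ?qt x) * ?S x"
      using TS[OF x] c1 by (simp add: algebra_simps)
  qed
  then have "AE x in lebesgue. x \<in> {0..L} \<longrightarrow> (?q x - ?qt x) * ?S x = 0" by (rule AE_zero_if_integrals_zero)
  moreover have "AE x in lebesgue. x \<noteq> (0::real)"
    by (rule AE_I'[of "{0}"]) (simp_all add: negligible_iff_null_sets[symmetric])
  ultimately show ?thesis
  proof eventually_elim
    case (elim x)
    then show ?case using nzS[of x] by (auto simp del: of_real_diff)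
  qed
qed

section \<open>Comparison of the solutions running left from the midpoint\<close>

lemma AE_lebesgue_reflect:
  fixes a :: real
  assumes "AE x in lebesgue. P x"
  shows "AE x in lebesgue. P (a - x)"
proof -
  obtain N where N: "negligible N" "\<And>x. x \<notin> N \<Longrightarrow> P x"
    using AE_lebesgue_negligibleE[OF assms] by blast
  have "negligible ((\<lambda>x. a - x) ` N)"
    by (intro negligible_differentiable_image_negligible N(1)) (auto intro!: derivative_intros)
  then have "(\<lambda>x. a - x) ` N \<in> null_sets lebesgue" by (simp add: negligible_iff_null_sets)
  moreover have "P (a - x)" if "x \<notin> (\<lambda>x. a - x) ` N" for x
  proof (rule N(2), rule notI)
    assume "a - x \<in> N"
    then have "a - (a - x) \<in> (\<lambda>x. a - x) ` N" by blast
    with that show False by simp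
  qed
  ultimately show ?thesis by (intro AE_I') auto
qed

text \<open>The upper bound at pi/2 - x holds for all large rho, but the lower bound at pi/2 only on
  the squares, where whichever of sine and cosine is the main term has modulus at least 1/8 of its
  exponential. The condition 16 M \<le> |rho| halves this, hence the constant 16.\<close>

lemma phi_ratio_bound:
  assumes q: "q absolutely_integrable_on {0..pi}" and bl: "bc_leading f al be K A"
  shows "\<exists>M R. 0 \<le> M \<and> 1 \<le> R \<and> (\<forall>rho n x. R \<le> norm rho \<longrightarrow> rho \<in> square_contour n \<longrightarrow> x \<in> {0..pi/2} \<longrightarrow>
    phi q f (rho\<^sup>2) (pi/2) \<noteq> 0 \<and>
    exp (\<bar>Im rho\<bar> * x) * norm (phi q f (rho\<^sup>2) (pi/2 - x)) \<le> M * norm (phi q f (rho\<^sup>2) (pi/2)))"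
proof -
  obtain M R where "phi_asymptotic q f al be A M R" using phi_asymptotics[OF q bl] by blast
  note 1 = phi_asymptoticD[OF this]
  have ab: "(al, be) = (if even (bc_index f) then (1, 0) else (0, 1))"
    using bl by (auto simp: bc_leading_def)
  have main: "phi q f (rho\<^sup>2) (pi/2) \<noteq> 0 \<and>
    exp (\<bar>Im rho\<bar> * x) * norm (phi q f (rho\<^sup>2) (pi/2 - x)) \<le> 16 * (1 + M) * norm (phi q f (rho\<^sup>2) (pi/2))"
    if rho: "max R (16 * M) \<le> norm rho" and sq: "rho \<in> square_contour n" and x: "x \<in> {0..pi/2}" for rho n x
  proof -
    let ?t = "\<bar>Im rho\<bar>" let ?\<phi> = "phi q f (rho\<^sup>2)"
    have R: "R \<le> norm rho" and rho1: "1 \<le> norm rho" and rhoM: "16 * M \<le> norm rho" using rho 1(2) by simp_all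
    have "norm (A rho) * norm rho = norm rho ^ nat (bc_index f + 1)" using bl rho1 by (auto simp: bc_leading_def)
    moreover have "0 < norm rho" using rho1 by linarith
    ultimately have "0 < norm (A rho) * norm rho" by simp
    then have A0: "0 < norm (A rho)" by (simp add: zero_less_mult_iff)
    have up: "norm (?\<phi> s) \<le> (1 + M) * norm (A rho) * exp (?t * s)" if s: "s \<in> {0..pi}" for s
    proof -
      have "norm (rho * ?\<phi> s) \<le> norm (rho * ?\<phi> s - rho * A rho * lead_T al be rho s) + norm (rho * A rho * lead_T al be rho s)"
        by (metis diff_add_cancel norm_triangle_ineq)
      also have "\<dots> \<le> exp (?t * s) * (M * norm (A rho)) + norm rho * norm (A rho) * exp (?t * s)"
        using 1(3)[OF R s] norm_lead_T_le(1)[OF ab, of s rho] s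
        by (intro add_mono) (auto simp: norm_mult intro!: mult_left_mono)
      also have "exp (?t * s) * (M * norm (A rho)) \<le> norm rho * (exp (?t * s) * (M * norm (A rho)))"
        using mult_right_mono[OF rho1, of "exp (?t * s) * (M * norm (A rho))"] 1(1) by simp
      finally have "norm rho * norm (?\<phi> s) \<le> norm rho * ((1 + M) * norm (A rho) * exp (?t * s))"
        by (simp add: norm_mult algebra_simps)
      then show ?thesis by (rule mult_left_le_imp_le) (use rho1 in linarith)
    qed
    have low: "norm (A rho) * exp (?t * (pi/2)) \<le> 16 * norm (?\<phi> (pi/2))"
    proof -
      let ?e = "exp (?t * (pi/2))" let ?T = "lead_T al be rho (pi/2)"
      have "?e / 8 \<le> norm ?T" using ab square_contour_sin_cos[OF sq] by (auto simp: lead_T_def split: if_splits)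
      then have "norm rho * norm (A rho) * (?e / 8) \<le> norm (rho * A rho * ?T)"
        unfolding norm_mult by (intro mult_left_mono) auto
      also have "\<dots> \<le> norm (rho * ?\<phi> (pi/2)) + norm (rho * ?\<phi> (pi/2) - rho * A rho * ?T)"
        using norm_triangle_ineq4[of "rho * ?\<phi> (pi/2)" "rho * ?\<phi> (pi/2) - rho * A rho * ?T"] by simp
      also have "\<dots> \<le> norm rho * norm (?\<phi> (pi/2)) + ?e * (M * norm (A rho))"
        using 1(3)[OF R, of "pi/2"] by (simp add: norm_mult)
      also have "?e * (M * norm (A rho)) \<le> norm rho * norm (A rho) * (?e / 16)"
        using mult_right_mono[OF rhoM, of "?e * norm (A rho) / 16"] by (simp add: mult_ac)
      finally have "norm rho * (norm (A rho) * ?e) \<le> norm rho * (16 * norm (?\<phi> (pi/2)))"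
        by (simp add: algebra_simps)
      then show ?thesis by (rule mult_left_le_imp_le) (use rho1 in linarith)
    qed
    have "0 < norm (A rho) * exp (?t * (pi/2))" using A0 by simp
    then have nz: "?\<phi> (pi/2) \<noteq> 0" using low by auto
    have "exp (?t * x) * norm (?\<phi> (pi/2 - x)) \<le> exp (?t * x) * ((1 + M) * norm (A rho) * exp (?t * (pi/2 - x)))"
      using x by (intro mult_left_mono up) auto
    also have "\<dots> = (1 + M) * (norm (A rho) * (exp (?t * x) * exp (?t * (pi/2 - x))))" by (simp only: mult_ac)
    also have "exp (?t * x) * exp (?t * (pi/2 - x)) = exp (?t * (pi/2))"
      by (simp add: exp_add[symmetric] algebra_simps)
    also have "(1 + M) * (norm (A rho) * exp (?t * (pi/2))) \<le> (1 + M) * (16 * norm (?\<phi> (pi/2)))"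
      using 1(1) by (intro mult_left_mono low) auto
    finally show ?thesis using nz by (simp add: algebra_simps)
  qed
  show ?thesis
    by (rule exI[of _ "16 * (1 + M)"], rule exI[of _ "max R (16 * M)"]) (use 1(1,2) main in auto)
qed

text \<open>The factor 2 counts the sine itself and the error, whose relative size 2 I / |rho| is at
  most 1.\<close>

lemma sl_sine_bound:
  assumes q: "q absolutely_integrable_on {0..L}" and L: "0 \<le> L"
  shows "\<exists>R\<ge>1. \<forall>rho x. R \<le> norm rho \<longrightarrow> x \<in> {0..L} \<longrightarrow>
    norm rho * norm (sl_y L q 0 1 (rho\<^sup>2) x) \<le> 2 * exp (\<bar>Im rho\<bar> * x)"
proof -
  define I where "I = integral {0..L} (\<lambda>x. norm (q x))"
  have "norm rho * norm (sl_y L q 0 1 (rho\<^sup>2) x) \<le> 2 * exp (\<bar>Im rho\<bar> * x)"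
    if rho: "max 1 (2 * I) \<le> norm rho" and x: "x \<in> {0..L}" for rho x
  proof -
    have rho0: "rho \<noteq> 0" and rhoI: "2 * I \<le> norm rho" using rho by auto
    note S = sl_init[OF q L, where z = "rho\<^sup>2" and ya = 0 and va = 1]
    have "norm (rho * sl_y L q 0 1 (rho\<^sup>2) x - sin (rho * of_real x)) \<le> exp (\<bar>Im rho\<bar> * x) * (2 * I / norm rho)"
      using sl_ode_asymptotics(1)[OF q L order_refl rhoI[unfolded I_def] rho0 S(1) x] by (simp add: S I_def)
    also have "\<dots> \<le> exp (\<bar>Im rho\<bar> * x) * 1"
      using rhoI rho0 by (intro mult_left_mono) (auto simp: field_simps)
    finally have "norm (rho * sl_y L q 0 1 (rho\<^sup>2) x - sin (rho * of_real x)) \<le> exp (\<bar>Im rho\<bar> * x)" by simp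
    moreover have "norm (sin (rho * of_real x)) \<le> exp (\<bar>Im rho\<bar> * x)"
      using norm_sin_cos_scaled_le(1)[of x rho] x by simp
    moreover have "norm (rho * sl_y L q 0 1 (rho\<^sup>2) x) \<le> norm (rho * sl_y L q 0 1 (rho\<^sup>2) x - sin (rho * of_real x)) + norm (sin (rho * of_real x))"
      by (metis diff_add_cancel norm_triangle_ineq)
    ultimately show ?thesis by (simp add: norm_mult)
  qed
  then show ?thesis by (intro exI[of _ "max 1 (2 * I)"]) auto
qed

text \<open>The solutions starting at pi/2 and running left are realised on [0, pi/2] with the
  reflected potential \<open>r\<close>. The reversed direction is responsible for the minus sign
  before \<open>dphi\<close>.\<close>

lemma phi_reflected:
  assumes q: "q absolutely_integrable_on {0..pi}" and x: "x \<in> {0..pi/2}"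
  defines "r \<equiv> \<lambda>x. complex_of_real (q (pi/2 - x))"
  shows "r absolutely_integrable_on {0..pi/2}"
    and "phi q f z (pi/2 - x) = phi q f z (pi/2) * sl_y (pi/2) r 1 0 z x - dphi q f z (pi/2) * sl_y (pi/2) r 0 1 z x"
proof -
  have "(\<lambda>x. complex_of_real (q x)) absolutely_integrable_on {0..pi/2}"
    by (rule absolutely_integrable_on_subinterval[OF of_real_absolutely_integrable[OF q]]) auto
  from ac_primitive_integrable[OF ac_primitive_reflect[OF ac_primitiveI[OF this refl, of 0]]]
  have "(\<lambda>x. (-1) * (- complex_of_real (q (pi/2 - x)))) absolutely_integrable_on {0..pi/2}"
    by (rule set_integrable_mult_right[rotated])
  then show r: "r absolutely_integrable_on {0..pi/2}" by (simp add: r_def)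
  have "sl_ode (pi/2) (\<lambda>x. r x - z) (\<lambda>x. 0) (\<lambda>x. phi q f z (pi/2 - x)) (\<lambda>x. - dphi q f z (pi/2 - x))"
    unfolding r_def by (rule sl_ode_reflect[OF sl_ode_mono[OF phi_sl_ode(1)[OF q]]]) simp
  from sl_init_eqI(1)[OF r this x]
  show "phi q f z (pi/2 - x) = phi q f z (pi/2) * sl_y (pi/2) r 1 0 z x - dphi q f z (pi/2) * sl_y (pi/2) r 0 1 z x"
    unfolding sl_init_lincomb[OF r x, of "phi q f z (pi/2 - 0)"] by simp
qed

lemma potentials_eq_left_half:
  assumes q: "q absolutely_integrable_on {0..pi}" and qt: "qt absolutely_integrable_on {0..pi}"
    and f: "f \<in> rational_class" and W: "\<And>z. mid_wronskian q qt f z = 0"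
  shows "AE x in lebesgue. x \<in> {0..pi/2} \<longrightarrow> q x = qt x"
proof -
  let ?a = "pi/2"
  let ?r = "\<lambda>x. complex_of_real (q (?a - x))" and ?rt = "\<lambda>x. complex_of_real (qt (?a - x))"
  have r: "?r absolutely_integrable_on {0..?a}" and rt: "?rt absolutely_integrable_on {0..?a}"
    using phi_reflected(1)[OF q, of 0] phi_reflected(1)[OF qt, of 0] by simp_all
  have a0: "0 \<le> ?a" by simp
  obtain al be K A where bl: "bc_leading f al be K A" using bc_leading_exists[OF f] by blast
  obtain M1 R1 where 1: "0 \<le> M1" "1 \<le> R1" "\<And>rho n x. R1 \<le> norm rho \<Longrightarrow> rho \<in> square_contour n \<Longrightarrow> x \<in> {0..?a} \<Longrightarrow>
    phi q f (rho\<^sup>2) ?a \<noteq> 0 \<and> exp (\<bar>Im rho\<bar> * x) * norm (phi q f (rho\<^sup>2) (?a - x)) \<le> M1 * norm (phi q f (rho\<^sup>2) ?a)"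
    using phi_ratio_bound[OF q bl] by blast
  obtain M2 R2 where 2: "0 \<le> M2" "1 \<le> R2" "\<And>rho n x. R2 \<le> norm rho \<Longrightarrow> rho \<in> square_contour n \<Longrightarrow> x \<in> {0..?a} \<Longrightarrow>
    phi qt f (rho\<^sup>2) ?a \<noteq> 0 \<and> exp (\<bar>Im rho\<bar> * x) * norm (phi qt f (rho\<^sup>2) (?a - x)) \<le> M2 * norm (phi qt f (rho\<^sup>2) ?a)"
    using phi_ratio_bound[OF qt bl] by blast
  obtain R3 where 3: "\<And>rho x. R3 \<le> norm rho \<Longrightarrow> x \<in> {0..?a} \<Longrightarrow>
    norm rho * norm (sl_y ?a ?r 0 1 (rho\<^sup>2) x) \<le> 2 * exp (\<bar>Im rho\<bar> * x)"
    using sl_sine_bound[OF r a0] by blast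
  obtain R4 where 4: "\<And>rho x. R4 \<le> norm rho \<Longrightarrow> x \<in> {0..?a} \<Longrightarrow>
    norm rho * norm (sl_y ?a ?rt 0 1 (rho\<^sup>2) x) \<le> 2 * exp (\<bar>Im rho\<bar> * x)"
    using sl_sine_bound[OF rt a0] by blast
  obtain n0 :: nat where n0: "max (max R1 R2) (max R3 R4) \<le> real n0" using real_arch_simple by blast
  define E where "E x z = sl_y ?a ?r 0 1 z x * sl_y ?a ?rt 1 0 z x - sl_y ?a ?rt 0 1 z x * sl_y ?a ?r 1 0 z x" for x z
  have E0: "E x z = 0" if x: "x \<in> {0..?a}" for x z
  proof (rule entire_eq_0_of_square_contour_bound[where H = "E x" and C = "2 * M1 + 2 * M2"])
    show "E x holomorphic_on UNIV"
      unfolding E_def[abs_def] by (intro holomorphic_intros sl_init_holomorphic r rt x)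
    fix n rho assume n: "n0 \<le> n" and rho: "rho \<in> square_contour n"
    have "real n \<le> norm rho" by (rule square_contourD(2)[OF rho])
    then have R: "R1 \<le> norm rho" "R2 \<le> norm rho" "R3 \<le> norm rho" "R4 \<le> norm rho" "1 \<le> norm rho"
      using n n0 1(2) by linarith+
    let ?z = "rho\<^sup>2" let ?e = "exp (\<bar>Im rho\<bar> * x)"
    let ?p = "phi q f ?z ?a" and ?pt = "phi qt f ?z ?a"
    let ?S = "sl_y ?a ?r 0 1 ?z x" and ?St = "sl_y ?a ?rt 0 1 ?z x"
    have p: "?p \<noteq> 0" "?e * norm (phi q f ?z (?a - x)) \<le> M1 * norm ?p"
      and pt: "?pt \<noteq> 0" "?e * norm (phi qt f ?z (?a - x)) \<le> M2 * norm ?pt"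
      using 1(3)[OF R(1) rho x] 2(3)[OF R(2) rho x] by auto
    have w: "?p * dphi qt f ?z ?a = dphi q f ?z ?a * ?pt"
      using W[of ?z] by (simp add: mid_wronskian_def)
    \<comment> \<open>The cosine type solutions are eliminated in favour of \<open>phi\<close> at
      pi/2 - x. Multiplying by both midpoint values avoids quotients, and the product of the two
      sine type solutions is left with the midpoint Wronskian as its coefficient.\<close>
    have "?p * ?pt * E x ?z = ?S * phi qt f ?z (?a - x) * ?p - ?St * phi q f ?z (?a - x) * ?pt
        + ?S * ?St * (?p * dphi qt f ?z ?a - dphi q f ?z ?a * ?pt)"
      unfolding phi_reflected(2)[OF q x] phi_reflected(2)[OF qt x] E_def by (simp add: algebra_simps)
    then have e: "?p * ?pt * E x ?z = ?S * phi qt f ?z (?a - x) * ?p - ?St * phi q f ?z (?a - x) * ?pt"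
      unfolding w by simp
    \<comment> \<open>The growth exp(|Im rho| x) of the sine type solution is cancelled by the decay
      of the ratio in \<open>phi_ratio_bound\<close>; only the factor 1 / |rho| remains.\<close>
    have t: "norm rho * norm (s * u * v) \<le> 2 * m * (norm v * norm v')"
      if "norm rho * norm s \<le> 2 * ?e" "?e * norm u \<le> m * norm v'" for s u v v' :: complex and m
    proof -
      have "norm rho * norm (s * u * v) = (norm rho * norm s) * (norm u * norm v)" by (simp only: norm_mult mult_ac)
      also have "\<dots> \<le> (2 * ?e) * (norm u * norm v)" by (rule mult_right_mono[OF that(1)]) simp
      also have "\<dots> = 2 * norm v * (?e * norm u)" by (simp only: mult_ac)
      also have "\<dots> \<le> 2 * norm v * (m * norm v')" by (rule mult_left_mono[OF that(2)]) simp
      finally show ?thesis by (simp add: mult_ac)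
    qed
    have "norm rho * norm (?p * ?pt * E x ?z) \<le> norm rho * (norm (?S * phi qt f ?z (?a - x) * ?p) + norm (?St * phi q f ?z (?a - x) * ?pt))"
      unfolding e by (intro mult_left_mono norm_triangle_ineq4) simp
    also have "\<dots> \<le> 2 * M2 * (norm ?p * norm ?pt) + 2 * M1 * (norm ?pt * norm ?p)"
      unfolding distrib_left by (intro add_mono t 3 4 R x p pt)
    finally have "(norm (E x ?z) * norm rho) * (norm ?p * norm ?pt) \<le> (2 * M1 + 2 * M2) * (norm ?p * norm ?pt)"
      by (simp add: norm_mult algebra_simps)
    then have "norm (E x ?z) * norm rho \<le> 2 * M1 + 2 * M2"
      by (rule mult_right_le_imp_le) (use p pt in simp)
    moreover have "0 < norm rho" using R(5) by linarith
    ultimately show "norm (E x ?z) \<le> (2 * M1 + 2 * M2) / norm rho" by (simp only: pos_le_divide_eq)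
  qed
  have "AE x in lebesgue. x \<in> {0..?a} \<longrightarrow> q (?a - x) = qt (?a - x)"
  proof (rule potential_unique_of_proportional_solutions[OF r rt, of \<i>])
    fix x assume "x \<in> {0..?a}"
    from E0[OF this, of \<i>]
    show "sl_y ?a ?r 0 1 \<i> x * sl_y ?a ?rt 1 0 \<i> x = sl_y ?a ?rt 0 1 \<i> x * sl_y ?a ?r 1 0 \<i> x"
      by (simp add: E_def)
  qed simp_all
  from AE_lebesgue_reflect[OF this, of ?a] show ?thesis by eventually_elim auto
qed

section \<open>Uniqueness on both halves\<close>

text \<open>If both quotients are infinite, \<open>phi\<close> vanishes at pi/2 for both potentials
  and each product is zero; otherwise the equality is cross-multiplied. The constants relating
  eigenfunctions to \<open>phi\<close> drop out of the quotients.\<close>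

lemma log_deriv_eq_imp_wronskian_zero:
  assumes q: "q absolutely_integrable_on {0..pi}" and qt: "qt absolutely_integrable_on {0..pi}"
    and f: "f \<in> rational_class"
    and y: "is_eigenfunction q f F z y" and yt: "is_eigenfunction qt f F z yt"
    and ld: "log_deriv y (pi/2) = log_deriv yt (pi/2)"
  shows "mid_wronskian q qt f z = 0"
proof -
  have p: "pi/2 \<in> {0..pi}" by simp
  obtain c where c: "c \<noteq> 0" "\<And>x. x \<in> {0..pi} \<Longrightarrow> y x = c * phi q f z x"
    "\<And>x. x \<in> {0..pi} \<Longrightarrow> interval_deriv y x = c * dphi q f z x"
    using eigenfunction_eq_phi[OF q f y] by blast
  obtain ct where ct: "ct \<noteq> 0" "\<And>x. x \<in> {0..pi} \<Longrightarrow> yt x = ct * phi qt f z x"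
    "\<And>x. x \<in> {0..pi} \<Longrightarrow> interval_deriv yt x = ct * dphi qt f z x"
    using eigenfunction_eq_phi[OF qt f yt] by blast
  show ?thesis
    using ld c(1) ct(1) unfolding log_deriv_def c(2,3)[OF p] ct(2,3)[OF p] mid_wronskian_def
    by (auto split: if_splits simp: field_simps)
qed

text \<open>Kept separate because it is applied twice: to the given problems and to the reflected
  ones with \<open>f\<close> and \<open>F\<close> exchanged. Equality of the indices survives this
  exchange.\<close>

lemma left_half_uniqueness:
  assumes q: "q absolutely_integrable_on {0..pi}" and qt: "qt absolutely_integrable_on {0..pi}"
    and f: "f \<in> rational_class" and F: "F \<in> rational_class" and ind: "bc_index f = bc_index F"
    and en: "range (\<lambda>n. complex_of_real (lam n)) = eigenvalues q f F"
    and y: "\<And>n. is_eigenfunction q f F (of_real (lam n)) (y n)"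
    and yt: "\<And>n. is_eigenfunction qt f F (of_real (lam n)) (yt n)"
    and ld: "\<And>n. log_deriv (y n) (pi/2) = log_deriv (yt n) (pi/2)"
  shows "AE x in lebesgue. x \<in> {0..pi/2} \<longrightarrow> q x = qt x"
proof (rule potentials_eq_left_half[OF q qt f], rule mid_wronskian_eq_0[OF q qt f F ind])
  fix z assume chi: "chi q f F z = 0"
  obtain n where n: "z = of_real (lam n)"
    using chi_zero_imp_eigenvalue[OF q f chi] unfolding en[symmetric] by blast
  show "z \<in> \<real>" by (simp add: n)
  show "mid_wronskian q qt f z = 0"
    unfolding n by (rule log_deriv_eq_imp_wronskian_zero[OF q qt f y yt ld])
qed

text \<open>Reflection changes the sign of the derivative, and this is exactly the difference in
  sign between the boundary conditions at 0 and at pi, so \<open>f\<close> and \<open>F\<close>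
  change places.\<close>

lemma is_eigenfunction_reflect:
  assumes y: "is_eigenfunction q f F z y"
  shows "is_eigenfunction (\<lambda>x. q (pi - x)) F f z (\<lambda>x. y (pi - x))"
    and "\<And>x. x \<in> {0..pi} \<Longrightarrow> interval_deriv (\<lambda>x. y (pi - x)) x = - interval_deriv y (pi - x)"
proof -
  have ode: "sl_ode pi (\<lambda>x. of_real (q x) - z) (\<lambda>x. 0) y (interval_deriv y)"
    using y sl_solution_imp_sl_ode by (auto simp: is_eigenfunction_def)
  note R = sl_ode_imp_sl_solution[OF sl_ode_reflect[OF ode]]
  show d: "interval_deriv (\<lambda>x. y (pi - x)) x = - interval_deriv y (pi - x)" if "x \<in> {0..pi}" for x
    by (rule R(2)[OF that])
  obtain x where x: "x \<in> {0..pi}" "y x \<noteq> 0" using y by (auto simp: is_eigenfunction_def)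
  then have nz: "\<exists>x\<in>{0..pi}. y (pi - x) \<noteq> 0" by (intro bexI[of _ "pi - x"]) auto
  show "is_eigenfunction (\<lambda>x. q (pi - x)) F f z (\<lambda>x. y (pi - x))"
    using y R(1) nz d[of 0] d[of pi]
    by (auto simp: is_eigenfunction_def algebra_simps add_eq_0_iff)
qed

text \<open>Reflection is an involution, so one inclusion for arbitrary data gives both.\<close>

lemma eigenvalues_reflect: "eigenvalues (\<lambda>x. q (pi - x)) F f = eigenvalues q f F"
proof -
  have "eigenvalues q f F \<subseteq> eigenvalues (\<lambda>x. q (pi - x)) F f" for q f F
    unfolding eigenvalues_def using is_eigenfunction_reflect(1) by blast
  from this[of q f F] this[of "\<lambda>x. q (pi - x)" F f] show ?thesis by auto
qed

lemma absolutely_integrable_reflect_pi: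
  fixes q :: "real \<Rightarrow> real"
  assumes "q absolutely_integrable_on {0..pi}"
  shows "(\<lambda>x. q (pi - x)) absolutely_integrable_on {0..pi}"
proof -
  have "q integrable_on {0..pi}" "(\<lambda>x. norm (q x)) integrable_on {0..pi}"
    using assms by (auto simp: absolutely_integrable_on_def)
  then show ?thesis
    using has_integral_reflect_shift[of q _ pi pi 0] has_integral_reflect_shift[of "\<lambda>x. norm (q x)" _ pi pi 0]
    unfolding absolutely_integrable_on_def integrable_on_def by auto
qed

lemma log_deriv_reflect:
  assumes "is_eigenfunction q f F z y"
  shows "log_deriv (\<lambda>x. y (pi - x)) (pi/2) = map_option uminus (log_deriv y (pi/2))"
  using is_eigenfunction_reflect(2)[OF assms, of "pi/2"] by (simp add: log_deriv_def)

theorem theorem4p12: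
  fixes q qt :: "real \<Rightarrow> real"
    and f F :: boundary_coeff
    and lam lamt :: "nat \<Rightarrow> real"
    and y yt :: "nat \<Rightarrow> real \<Rightarrow> complex"
  assumes "q absolutely_integrable_on {0..pi}"
    and "qt absolutely_integrable_on {0..pi}"
    and "f \<in> rational_class" and "F \<in> rational_class"
    and "bc_index f = bc_index F"
    and "enumerates_eigenvalues q f F lam"
    and "enumerates_eigenvalues qt f F lamt"
    and "\<And>n. is_eigenfunction q f F (of_real (lam n)) (y n)"
    and "\<And>n. is_eigenfunction qt f F (of_real (lamt n)) (yt n)"
    and "\<And>n. lam n = lamt n"
    and "\<And>n. log_deriv (y n) (pi/2) = log_deriv (yt n) (pi/2)"
  shows "AE x in lebesgue. x \<in> {0..pi} \<longrightarrow> q x = qt x"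
proof -
  have en: "range (\<lambda>n. complex_of_real (lam n)) = eigenvalues q f F"
    using assms(6) by (simp add: enumerates_eigenvalues_def)
  have y: "is_eigenfunction q f F (of_real (lam n)) (y n)"
    and yt: "is_eigenfunction qt f F (of_real (lam n)) (yt n)" for n
    using assms(8)[of n] assms(9)[of n] assms(10)[of n] by simp_all
  have left: "AE x in lebesgue. x \<in> {0..pi/2} \<longrightarrow> q x = qt x"
    by (rule left_half_uniqueness[OF assms(1-5) en y yt assms(11)])
  \<comment> \<open>The midpoint is fixed by the reflection and both quotients there merely change
    sign, so the reflected data satisfy the same hypotheses.\<close>
  have "AE x in lebesgue. x \<in> {0..pi/2} \<longrightarrow> q (pi - x) = qt (pi - x)"
  proof (rule left_half_uniqueness)
    show "range (\<lambda>n. complex_of_real (lam n)) = eigenvalues (\<lambda>x. q (pi - x)) F f"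
      unfolding eigenvalues_reflect by (rule en)
    show "is_eigenfunction (\<lambda>x. q (pi - x)) F f (of_real (lam n)) (\<lambda>x. y n (pi - x))"
      "is_eigenfunction (\<lambda>x. qt (pi - x)) F f (of_real (lam n)) (\<lambda>x. yt n (pi - x))" for n
      by (rule is_eigenfunction_reflect(1)[OF y] is_eigenfunction_reflect(1)[OF yt])+
    show "log_deriv (\<lambda>x. y n (pi - x)) (pi/2) = log_deriv (\<lambda>x. yt n (pi - x)) (pi/2)" for n
      unfolding log_deriv_reflect[OF y] log_deriv_reflect[OF yt] assms(11) ..
  qed (simp_all add: assms absolutely_integrable_reflect_pi)
  from AE_lebesgue_reflect[OF this, of pi]
  have right: "AE x in lebesgue. x \<in> {pi/2..pi} \<longrightarrow> q x = qt x"
    by eventually_elim auto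
  show ?thesis using left right by eventually_elim auto
qed

end
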